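(* Let $n\ge 1$. Assume that $p\in L^{\infty}(\mathbb{R};L^{1}_{loc}(\mathbb{R}))$ and $q_{\alpha}\in L^{\infty}(\mathbb{R})$ for every multi-index $\alpha=(\alpha_1,\dots,\alpha_n)$ with $|\alpha|\le 2$. Let $u\in C(\mathbb{R};L^{1}_{loc}(\mathbb{R}^{n}))\cap L^{\infty}(\mathbb{R};L^{1}_{loc}(\mathbb{R}^{n}))$, with $pu\in L^{\infty}(\mathbb{R};L^{1}_{loc}(\mathbb{R}^{n}))$ (where $(pu)(t,x)=p(t,x_1)u(t,x)$), be a weak solution of $$u_{tt}(t,x)+\Delta^{2}u(t,x)+\sum_{|\alpha|\le 2}q_{\alpha}(t)\,\partial_x^{\alpha}u(t,x)+p(t,x_1)u(t,x)=0,\qquad (t,x)\in\mathbb{R}\times\mathbb{R}^{n}.$$ If there is some $r>0$ such that $u(t,x)=0$ for all $t\in\mathbb{R}$ and $|x|\ge r$, then, for all $t\in\mathbb{R}$, $u(t,x)=0$ for a.e. $x\in\mathbb{R}^{n}$.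
   Context: Here $x=(x_1,\dots,x_n)\in\mathbb{R}^n$, $|\alpha|=\alpha_1+\dots+\alpha_n$, $\partial_x^{\alpha}=(\partial/\partial x_1)^{\alpha_1}\cdots(\partial/\partial x_n)^{\alpha_n}$, and $\Delta$ is the Laplacian in $x$. All functions are real-valued. The coefficient $p$ depends only on $t$ and the first spatial coordinate $x_1$, and the $q_\alpha$ depend only on $t$. $L^{\infty}(\mathbb{R};L^{1}_{loc}(\mathbb{R}^{d}))$ is the space of measurable $g(t,x)$ such that for every compact $K\subset\mathbb{R}^d$, $\operatorname{ess\,sup}_{t\in\mathbb{R}}\int_K|g(t,x)|\,dx<\infty$; $C(\mathbb{R};L^1_{loc}(\mathbb{R}^d))$ is the space of $g$ such that $t\mapsto g(t,\cdot)|_K$ is continuous into $L^1(K)$ for every compact $K$. "Weak solution" means that the equation holds in the sense of distributions: for every $\zeta\in C_0^\infty(\mathbb{R}\times\mathbb{R}^n)$, $$\int_{\mathbb{R}}\int_{\mathbb{R}^n}\Big[u\,(\zeta_{tt}+\Delta^2\zeta)+\sum_{|\alpha|\le2}(-1)^{|\alpha|}q_\alpha(t)\,u\,\partial_x^\alpha\zeta+p(t,x_1)\,u\,\zeta\Big]dx\,dt=0.$$ For each $t$, the condition $u(t,x)=0$ for $|x|\ge r$ is understood for a.e. such $x$. *)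

theory Defs
  imports "HOL-Analysis.Analysis" "HOL-Probability.Essential_Supremum"
begin

text \<open>
  Space is \<open>real ^ 'n\<close> with a finite linearly ordered index type \<open>'n\<close>, so that
  \<open>n = CARD('n) \<ge> 1\<close> is arbitrary and the first coordinate is \<open>x $ Min UNIV\<close>.
  Measurability and integrals always refer to the completed measure \<open>lebesgue\<close>: the Bochner
  integral over \<open>lborel\<close> would be \<open>0\<close> for functions that are not Borel measurable.
\<close>

definition Linfty :: "(real \<Rightarrow> real) set" where
  "Linfty = {f. f \<in> borel_measurable lebesgue \<and>
                esssup lebesgue (\<lambda>t. ennreal \<bar>f t\<bar>) < \<infinity>}"

definition Linfty_L1loc :: "(real \<Rightarrow> 'a::euclidean_space \<Rightarrow> real) set" where
  "Linfty_L1loc = {g. (\<lambda>(t, x). g t x) \<in> borel_measurable lebesgue \<and>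
     (\<forall>K. compact K \<longrightarrow>
        esssup lebesgue (\<lambda>t. \<integral>\<^sup>+x\<in>K. ennreal \<bar>g t x\<bar> \<partial>lebesgue) < \<infinity>)}"

definition C_L1loc :: "(real \<Rightarrow> 'a::euclidean_space \<Rightarrow> real) set" where
  "C_L1loc = {g. \<forall>K. compact K \<longrightarrow>
     (\<forall>t. set_integrable lebesgue K (g t)) \<and>
     (\<forall>t. ((\<lambda>s. LINT x:K|lebesgue. \<bar>g s x - g t x\<bar>) \<longlongrightarrow> 0) (at t))}"

primrec Ck :: "nat \<Rightarrow> ('a::real_normed_vector \<Rightarrow> real) \<Rightarrow> bool" where
  "Ck 0 f \<longleftrightarrow> continuous_on UNIV f"
| "Ck (Suc k) f \<longleftrightarrow> (\<forall>z. f differentiable (at z)) \<and>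
                   (\<forall>v. Ck k (\<lambda>z. frechet_derivative f (at z) v))"

definition test_functions :: "('a::real_normed_vector \<Rightarrow> real) set" where
  "test_functions = {\<zeta>. (\<forall>k. Ck k \<zeta>) \<and> compact (closure {z. \<zeta> z \<noteq> 0})}"

definition dir_deriv :: "'a::real_normed_vector \<Rightarrow> ('a \<Rightarrow> real) \<Rightarrow> 'a \<Rightarrow> real" where
  "dir_deriv v f z = deriv (\<lambda>s. f (z + s *\<^sub>R v)) 0"

definition dt :: "(real \<times> (real ^ 'n) \<Rightarrow> real) \<Rightarrow> real \<times> (real ^ 'n) \<Rightarrow> real" where
  "dt = dir_deriv (1, 0)"

definition dx :: "'n \<Rightarrow> (real \<times> (real ^ 'n) \<Rightarrow> real) \<Rightarrow> real \<times> (real ^ 'n) \<Rightarrow> real" where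
  "dx i = dir_deriv (0, axis i 1)"

definition laplacian :: "(real \<times> (real ^ 'n) \<Rightarrow> real) \<Rightarrow> real \<times> (real ^ 'n) \<Rightarrow> real" where
  "laplacian f z = (\<Sum>i\<in>UNIV. dx i (dx i f) z)"

definition mi_order :: "('n::finite \<Rightarrow> nat) \<Rightarrow> nat" where
  "mi_order \<alpha> = (\<Sum>i\<in>UNIV. \<alpha> i)"

definition dx_multi ::
    "('n::{finite, linorder} \<Rightarrow> nat) \<Rightarrow> (real \<times> (real ^ 'n::{finite, linorder}) \<Rightarrow> real) \<Rightarrow>
     real \<times> (real ^ 'n::{finite, linorder}) \<Rightarrow> real" where
  "dx_multi \<alpha> f = foldr (\<lambda>i g. (dx i ^^ \<alpha> i) g) (sorted_list_of_set UNIV) f"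

text \<open>The sum below ranges over a finite set, so it is not the default value of \<^const>\<open>sum\<close>.\<close>

lemma finite_mi_order_le: "finite {\<alpha> :: 'n::finite \<Rightarrow> nat. mi_order \<alpha> \<le> m}"
proof (rule finite_subset)
  show "{\<alpha> :: 'n \<Rightarrow> nat. mi_order \<alpha> \<le> m} \<subseteq> PiE UNIV (\<lambda>_. {..m})"
  proof
    fix \<alpha> :: "'n \<Rightarrow> nat"
    assume "\<alpha> \<in> {\<alpha>. mi_order \<alpha> \<le> m}"
    then have "\<alpha> i \<le> m" for i
      using member_le_sum[of i UNIV \<alpha>] by (simp add: mi_order_def)
    then show "\<alpha> \<in> PiE UNIV (\<lambda>_. {..m})"
      by (simp add: PiE_UNIV_domain)
  qed
  show "finite (PiE (UNIV :: 'n set) (\<lambda>_. {..m}))"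
    by (intro finite_PiE) auto
qed

text \<open>
  If \<open>u\<close> and \<open>p u\<close> lie in \<^const>\<open>Linfty_L1loc\<close> and the \<open>q \<alpha>\<close> with \<open>mi_order \<alpha> \<le> 2\<close> in
  \<^const>\<open>Linfty\<close>, the integrand is integrable over space-time for every test function.
\<close>

definition weak_solution ::
    "(('n::{finite, linorder} \<Rightarrow> nat) \<Rightarrow> real \<Rightarrow> real) \<Rightarrow> (real \<Rightarrow> real \<Rightarrow> real) \<Rightarrow>
     (real \<Rightarrow> real ^ 'n::{finite, linorder} \<Rightarrow> real) \<Rightarrow> bool" where
  "weak_solution q p u \<longleftrightarrow> (\<forall>\<zeta>\<in>test_functions.
     (LINT t|lebesgue. LINT x|lebesgue.
        u t x * (dt (dt \<zeta>) (t, x) + laplacian (laplacian \<zeta>) (t, x))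
        + (\<Sum>\<alpha> | mi_order \<alpha> \<le> 2. (-1) ^ mi_order \<alpha> * q \<alpha> t * u t x * dx_multi \<alpha> \<zeta> (t, x))
        + p t (x $ Min UNIV) * u t x * \<zeta> (t, x)) = 0)"

end

theory Submission
  imports Defs "HOL-Computational_Algebra.Polynomial"
begin

text \<open>
  Test the equation with \<open>\<phi>(t) exp (\<theta> \<bullet> x)\<close>, where \<open>\<theta>\<^sub>i\<close> is real for \<open>i > 1\<close> and
  \<open>\<theta>\<^sub>1 = \<Lambda> - \<i> \<omega>\<close> with \<open>\<Lambda>\<close> large. The moment \<open>c(t) = \<integral> u(t,x) exp (\<theta> \<bullet> x) dx\<close> is bounded on the whole
  line and satisfies \<open>c'' + \<sigma>\<^sup>2 c = g\<close> with \<open>\<sigma> = \<Sum> \<theta>\<^sub>i\<^sup>2\<close>; as \<open>\<bar>Im \<sigma>\<bar> = 2 \<Lambda> \<omega>\<close>, this forces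
  \<open>\<bar>c\<bar> \<le> sup \<bar>g\<bar> / (2 \<Lambda> \<omega> \<bar>\<sigma>\<bar>)\<close>, and the terms with \<open>q\<close> can be absorbed. Take for \<open>\<omega>\<close> the frequencies of
  an antiperiodic Fourier series on an interval containing the \<open>x\<^sub>1\<close>-support. The bounds are then
  summable, so the \<open>x\<^sub>1\<close>-marginal of \<open>u exp (\<theta> \<bullet> x)\<close> is a function whose supremum is at most a small
  multiple of the moments of \<open>p u\<close>, while these moments are at most \<open>\<parallel>p\<parallel>\<close> times that supremum. Hence all
  moments vanish, and so does \<open>u\<close> by the Stone-Weierstrass theorem.
\<close>

section \<open>Smooth functions and cut-offs\<close>

text \<open>As Im \<sigma> is nonzero, every nonzero solution of c'' + \<sigma>^2 c = 0 is unbounded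
  on the line, so a bounded moment is governed by \<open>g\<close> alone and no initial data enter.
  The gain is |\<sigma>| |Im \<sigma>|, while derivatives of order at most 2 cost a multiple of
  |\<sigma>|; the surplus |Im \<sigma>| is what absorbs the \<open>q\<close>-terms. The obstacle is
  \<open>p\<close>, merely integrable in x_1: an L1 bound on \<open>u\<close> does not control p u,
  and a sup bound on the x_1-marginal has to take its place. Because \<open>p\<close> sees x_1 only,
  oscillation is introduced in that direction alone, and the moments decay like 1/(\<Lambda>
  \<omega>^3), summable over a one-dimensional sequence. The factor 1/\<Lambda> makes the passage
  from moments of p u to moments of \<open>u\<close> and back a contraction; the assumed bound on p
  u starts it. Real exponents in the other directions keep the weighted marginal real, so
  frequencies of one sign determine it. At the end \<Lambda> is traded for an arbitrary first
  exponent, since a vanishing marginal pairs to 0 with every bounded Borel function of x_1.\<close>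

definition smooth :: "('a::real_normed_vector \<Rightarrow> real) \<Rightarrow> bool" where
  "smooth f \<longleftrightarrow> (\<forall>k. Ck k f)"

text \<open>\<open>Ck\<close> is phrased with the choice operator \<open>frechet_derivative\<close>;
  uniqueness of derivatives lets an explicit candidate stand in for it.\<close>

lemma Ck_SucI:
  assumes "\<And>z. (f has_derivative f' z) (at z)" and "\<And>v. Ck k (\<lambda>z. f' z v)"
  shows "Ck (Suc k) f"
proof -
  have "frechet_derivative f (at z) = f' z" for z
    using frechet_derivative_at[OF assms(1)] by simp
  then show ?thesis
    using assms by (auto simp: differentiable_def)
qed

lemma Ck_Suc_has_derivative:
  "Ck (Suc k) f \<Longrightarrow> (f has_derivative frechet_derivative f (at z)) (at z)"
  by (simp add: frechet_derivative_works)

lemma Ck_SucD: "Ck (Suc k) f \<Longrightarrow> Ck k f"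
proof (induction k arbitrary: f)
  case 0
  then show ?case
    by (auto intro!: continuous_at_imp_continuous_on differentiable_imp_continuous_within)
next
  case (Suc k)
  then show ?case
    using Ck.simps(2) by blast
qed

lemma Ck_const: "Ck k (\<lambda>z. c)"
proof (induction k arbitrary: c)
  case (Suc k)
  show ?case by (rule Ck_SucI[where f' = "\<lambda>_ _. 0"]) (auto intro: Suc)
qed auto

lemma Ck_bounded_linear: "bounded_linear f \<Longrightarrow> Ck k f"
proof (cases k)
  case 0
  assume "bounded_linear f"
  then show ?thesis using 0 by (simp add: linear_continuous_on)
next
  case (Suc m)
  assume "bounded_linear f"
  then show ?thesis
    unfolding Suc by (intro Ck_SucI[where f' = "\<lambda>_. f"]) (auto intro: bounded_linear_imp_has_derivative Ck_const)
qed

lemma Ck_add: "Ck k f \<Longrightarrow> Ck k g \<Longrightarrow> Ck k (\<lambda>z. f z + g z)"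
proof (induction k arbitrary: f g)
  case 0
  then show ?case by (auto intro: continuous_on_add)
next
  case (Suc k)
  show ?case
    using Suc.prems Suc.IH
    by (intro Ck_SucI[OF has_derivative_add[OF Ck_Suc_has_derivative[of k] Ck_Suc_has_derivative[of k]]]) auto
qed

lemma Ck_mult: "Ck k f \<Longrightarrow> Ck k g \<Longrightarrow> Ck k (\<lambda>z. f z * g z)"
proof (induction k arbitrary: f g)
  case 0
  then show ?case by (auto intro: continuous_on_mult)
next
  case (Suc k)
  \<comment> \<open>The product rule leaves one factor undifferentiated, which must be lowered from
    \<open>Suc k\<close> to \<open>k\<close> before the induction hypothesis applies.\<close>
  have "Ck k f" "Ck k g" using Suc.prems Ck_SucD by auto
  then show ?case
    using Suc.prems Suc.IH
    by (intro Ck_SucI[OF has_derivative_mult[OF Ck_Suc_has_derivative[of k] Ck_Suc_has_derivative[of k]]])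
      (auto intro!: Ck_add)
qed

lemma smooth_const: "smooth (\<lambda>z. c)"
  by (simp add: smooth_def Ck_const)

lemma smooth_bounded_linear: "bounded_linear f \<Longrightarrow> smooth f"
  by (simp add: smooth_def Ck_bounded_linear)

lemma smooth_add: "smooth f \<Longrightarrow> smooth g \<Longrightarrow> smooth (\<lambda>z. f z + g z)"
  by (simp add: smooth_def Ck_add)

lemma smooth_mult: "smooth f \<Longrightarrow> smooth g \<Longrightarrow> smooth (\<lambda>z. f z * g z)"
  by (simp add: smooth_def Ck_mult)

lemma smooth_diff: "smooth f \<Longrightarrow> smooth g \<Longrightarrow> smooth (\<lambda>z. f z - g z)"
  using smooth_add[of f "\<lambda>z. (-1) * g z"] smooth_mult[of "\<lambda>_. -1" g] smooth_const by auto

lemma smooth_sum: "(\<And>i. i \<in> I \<Longrightarrow> smooth (f i)) \<Longrightarrow> smooth (\<lambda>z. \<Sum>i\<in>I. f i z)"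
  by (induction I rule: infinite_finite_induct) (auto intro: smooth_const smooth_add)

text \<open>Carrying all derivatives of an outer function as one sequence closes the induction for
  compositions: the chain rule merely replaces \<open>G n\<close> by
  \<open>G (Suc n)\<close>.\<close>

definition deriv_tower :: "(nat \<Rightarrow> real \<Rightarrow> real) \<Rightarrow> bool" where
  "deriv_tower G \<longleftrightarrow> (\<forall>n x. (G n has_real_derivative G (Suc n) x) (at x))"

lemma smooth_compose_tower:
  assumes "deriv_tower G" and "smooth f"
  shows "smooth (\<lambda>z. G n (f z))"
proof -
  have "Ck k (\<lambda>z. G n (f z))" for k
  proof (induction k arbitrary: n)
    case 0
    have "continuous_on UNIV f" using assms(2) by (metis Ck.simps(1) smooth_def)
    moreover have "continuous_on UNIV (G n)"
      using assms(1) by (meson DERIV_continuous_on DERIV_subset deriv_tower_def subset_UNIV)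
    ultimately have "continuous_on UNIV (\<lambda>z. G n (f z))"
      using continuous_on_compose2[of UNIV "G n" UNIV f] by blast
    then show ?case by simp
  next
    case (Suc k)
    have f: "Ck (Suc k) f" using assms(2) by (simp add: smooth_def)
    have "((\<lambda>z. G n (f z)) has_derivative (\<lambda>v. G (Suc n) (f z) * frechet_derivative f (at z) v)) (at z)" for z
      using Ck_Suc_has_derivative[OF f, of z] assms(1)
      by (auto simp: deriv_tower_def has_field_derivative_def
               intro!: has_derivative_compose[of f _ z UNIV "G n" "(*) (G (Suc n) (f z))"])
    then show ?case
      by (rule Ck_SucI) (use f Suc in \<open>auto intro: Ck_mult\<close>)
  qed
  then show ?thesis by (simp add: smooth_def)
qed

lemma smooth_deriv_tower:
  fixes f :: "real \<Rightarrow> real"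
  assumes "smooth f"
  shows "deriv_tower (\<lambda>n. (deriv ^^ n) f)"
proof -
  have d: "smooth g \<Longrightarrow> smooth (deriv g) \<and> (\<forall>x. (g has_real_derivative deriv g x) (at x))"
    for g :: "real \<Rightarrow> real"
  proof -
    assume g: "smooth g"
    have D: "(g has_real_derivative deriv g x) (at x)" for x
      using g by (metis Ck.simps(2) DERIV_deriv_iff_real_differentiable smooth_def)
    then have "deriv g = (\<lambda>z. frechet_derivative g (at z) 1)"
      by (metis has_field_derivative_def frechet_derivative_at mult.right_neutral)
    moreover have "smooth (\<lambda>z. frechet_derivative g (at z) 1)"
      using g unfolding smooth_def by (metis Ck.simps(2))
    ultimately show ?thesis using D by auto
  qed
  have "smooth ((deriv ^^ n) f)" for n
    by (induction n) (auto simp: assms d)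
  then show ?thesis
    using d by (auto simp: deriv_tower_def)
qed

section \<open>The flat function exp (-1/x), bumps and smooth steps\<close>

fun flat_poly :: "nat \<Rightarrow> real poly" where
  "flat_poly 0 = 1"
| "flat_poly (Suc n) = [:0, 0, 1:] * (flat_poly n - pderiv (flat_poly n))"

definition flat :: "nat \<Rightarrow> real \<Rightarrow> real" where
  "flat n x = (if x > 0 then poly (flat_poly n) (1 / x) * exp (- (1 / x)) else 0)"

lemma poly_exp_minus_tendsto_0:
  fixes p :: "real poly"
  shows "((\<lambda>y. poly p y * exp (- y)) \<longlongrightarrow> 0) at_top"
proof -
  have "((\<lambda>y. \<Sum>i\<le>degree p. coeff p i * (y ^ i / exp y)) \<longlongrightarrow> (\<Sum>i\<le>degree p. coeff p i * 0)) at_top"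
    by (intro tendsto_sum tendsto_mult tendsto_const tendsto_power_div_exp_0)
  then show ?thesis
    by (simp add: poly_altdef sum_divide_distrib exp_minus divide_inverse sum_distrib_right mult.assoc)
qed

text \<open>With y = 1/x, the x-derivative of P(y) exp(-y) is y^2 (P - P')(y) exp(-y), which is the
  recursion of \<open>flat_poly\<close>. At 0 all these functions are flat because exp(-y) beats
  every polynomial.\<close>

lemma deriv_tower_flat: "deriv_tower flat"
  unfolding deriv_tower_def
proof (intro allI)
  fix n :: nat and x :: real
  consider "x > 0" | "x < 0" | "x = 0" by linarith
  then show "(flat n has_real_derivative flat (Suc n) x) (at x)"
  proof cases
    case 1
    have "((\<lambda>x. poly (flat_poly n) (1 / x) * exp (- (1 / x))) has_real_derivative flat (Suc n) x) (at x)"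
      using 1 by (auto intro!: derivative_eq_intros simp: flat_def field_simps power2_eq_square)
    then show ?thesis
    proof (rule has_field_derivative_transform_within_open[where S = "{0<..}"])
    qed (use 1 in \<open>auto simp: flat_def\<close>)
  next
    case 2
    have "((\<lambda>x. 0) has_real_derivative flat (Suc n) x) (at x)"
      using 2 by (simp add: flat_def)
    then show ?thesis
      by (rule has_field_derivative_transform_within_open[where S = "{..<0}"]) (use 2 in \<open>auto simp: flat_def\<close>)
  next
    case 3
    \<comment> \<open>For y = 1/h the difference quotient is y P(y) exp(-y), once more a polynomial
      times exp(-y).\<close>
    have "((\<lambda>h. flat n h / h) \<longlongrightarrow> 0) (at_right 0)"
    proof (rule Lim_transform_eventually)
      have "((\<lambda>y. poly ([:0, 1:] * flat_poly n) y * exp (- y)) \<longlongrightarrow> 0) at_top"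
        by (rule poly_exp_minus_tendsto_0)
      then show "((\<lambda>h. poly ([:0, 1:] * flat_poly n) (inverse h) * exp (- inverse h)) \<longlongrightarrow> 0) (at_right 0)"
        by (rule filterlim_compose[OF _ filterlim_inverse_at_top_right])
      show "\<forall>\<^sub>F h in at_right 0. poly ([:0, 1:] * flat_poly n) (inverse h) * exp (- inverse h) = flat n h / h"
        unfolding eventually_at_right_field by (auto intro!: exI[of _ 1] simp: flat_def field_simps)
    qed
    moreover have "((\<lambda>h. flat n h / h) \<longlongrightarrow> 0) (at_left 0)"
      by (rule Lim_transform_eventually[OF tendsto_const])
        (auto simp: eventually_at_left_field flat_def intro!: exI[of _ "-1"])
    ultimately have "((\<lambda>h. flat n h / h) \<longlongrightarrow> 0) (at 0)"
      by (simp add: filterlim_at_split)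
    then show ?thesis
      using 3 by (simp add: has_field_derivative_def has_derivative_at DERIV_def flat_def
          flip: has_field_derivative_def)
  qed
qed

definition bump :: "real \<Rightarrow> real \<Rightarrow> real" where
  "bump d t = flat 0 (d\<^sup>2 - t\<^sup>2)"

lemma smooth_bump: "smooth (bump d)"
proof -
  have "smooth (\<lambda>t::real. d * d - t * t)"
    by (intro smooth_diff smooth_const smooth_mult smooth_bounded_linear bounded_linear_ident)
  from smooth_compose_tower[OF deriv_tower_flat this, of 0] show ?thesis
    by (simp add: bump_def[abs_def] power2_eq_square)
qed

lemma bump_nonneg: "bump d t \<ge> 0"
  by (simp add: bump_def flat_def)

lemma bump_pos: "\<bar>t\<bar> < d \<Longrightarrow> bump d t > 0"
  using abs_square_less_1 power_strict_mono[of "\<bar>t\<bar>" d 2] by (simp add: bump_def flat_def)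

lemma bump_eq_0: "\<bar>t\<bar> \<ge> d \<Longrightarrow> d > 0 \<Longrightarrow> bump d t = 0"
  using power_mono[of d "\<bar>t\<bar>" 2] by (simp add: bump_def flat_def)

text \<open>The step is the normalised primitive of a bump living on [0, 1]; the rest of its tower
  consists of the derivatives of that bump.\<close>

lemma smooth_step_exists:
  obtains G where "deriv_tower G" "\<And>x. x \<le> 0 \<Longrightarrow> G 0 x = 0" "\<And>x. x \<ge> 1 \<Longrightarrow> G 0 x = 1"
proof -
  define b where "b x = bump (1/2) (x - 1/2)" for x
  have sb: "smooth b"
  proof -
    have "smooth (\<lambda>x::real. x - 1/2)"
      by (intro smooth_diff smooth_const smooth_bounded_linear bounded_linear_ident)
    from smooth_compose_tower[OF smooth_deriv_tower[OF smooth_bump] this, of 0 "1/2"] show ?thesis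
      by (simp add: b_def[abs_def])
  qed
  then have cb: "continuous_on S b" for S
    by (metis Ck.simps(1) smooth_def continuous_on_subset subset_UNIV)
  have b0: "b x \<ge> 0" for x by (simp add: b_def bump_nonneg)
  have bz: "b x = 0" if "x \<le> 0 \<or> x \<ge> 1" for x
    using that by (auto simp: b_def intro!: bump_eq_0)
  have iz: "integral S b = 0" if "\<And>x. x \<in> S \<Longrightarrow> b x = 0" for S
    using integral_cong[of S b "\<lambda>_. 0"] that by simp
  \<comment> \<open>The lower limit -1 lies strictly left of the support, so the two cases of the
    derivative, right of -1 and left of 0, overlap and no gluing at 0 arises.\<close>
  define J where "J x = integral {-1..x} b" for x
  have dJ: "(J has_real_derivative b x) (at x)" for x
  proof (cases "x > -1")
    case True
    have "(J has_real_derivative b x) (at x within {-1..x+1})"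
      unfolding J_def using integral_has_real_derivative[OF cb, of x "-1" "x+1"] True by auto
    moreover have "at x within {-1..x+1} = at x"
      using True by (intro at_within_interior) (auto simp: interior_atLeastAtMost_real)
    ultimately show ?thesis by simp
  next
    case False
    have "integral {-1..y} b = 0" if "y < 0" for y
      using that by (intro iz) (auto intro: bz)
    then have "((\<lambda>y. 0) has_real_derivative b x) (at x) \<and> (\<forall>y\<in>{..<0}. 0 = J y)"
      using False by (auto simp: bz J_def)
    then show ?thesis
      by (rule_tac has_field_derivative_transform_within_open[of "\<lambda>y. 0" _ x "{..<0}"]) (use False in auto)
  qed
  have J0: "J x = 0" if "x \<le> 0" for x
    unfolding J_def using that by (intro iz) (auto intro: bz)
  have J1: "J x = J 1" if "x \<ge> 1" for x
  proof -
    have "integral {-1..1} b + integral {1..x} b = J x"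
      unfolding J_def using that by (intro Henstock_Kurzweil_Integration.integral_combine integrable_continuous_real cb) auto
    moreover have "integral {1..x} b = 0" by (intro iz) (auto intro: bz)
    ultimately show ?thesis by (simp add: J_def)
  qed
  have "J 1 > 0"
  proof -
    have "J 1 \<noteq> 0"
    proof
      assume "J 1 = 0"
      then have "\<forall>x\<in>cbox (-1) 1. b x = 0"
        using integral_eq_0_iff[of "-1" 1 b] cb b0 by (auto simp: J_def)
      then have "b (1/2) = 0" by auto
      moreover have "b (1/2) > 0" unfolding b_def by (rule bump_pos) auto
      ultimately show False by simp
    qed
    moreover have "J 1 \<ge> 0"
      unfolding J_def by (intro integral_nonneg integrable_continuous_real cb) (auto simp: b0)
    ultimately show ?thesis by simp
  qed
  define G where "G n x = (case n of 0 \<Rightarrow> J x | Suc m \<Rightarrow> (deriv ^^ m) b x) / J 1" for n x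
  have "(G n has_real_derivative G (Suc n) x) (at x)" for n x
  proof (cases n)
    case 0
    then show ?thesis unfolding G_def using dJ[of x] \<open>J 1 > 0\<close> by (auto intro!: derivative_eq_intros)
  next
    case (Suc m)
    then show ?thesis unfolding G_def
      using smooth_deriv_tower[OF sb, unfolded deriv_tower_def, rule_format, of m x] \<open>J 1 > 0\<close>
      by (auto intro!: derivative_eq_intros)
  qed
  moreover have "G 0 x = 0" if "x \<le> 0" for x
    using that by (simp add: G_def J0)
  moreover have "G 0 x = 1" if "x \<ge> 1" for x
    unfolding G_def using J1[OF that] \<open>J 1 > 0\<close> by simp
  ultimately show ?thesis
    by (intro that[of G]) (auto simp: deriv_tower_def)
qed

section \<open>Bounded weak solutions of second-order equations\<close>

lemma integral_lebesgue_eq_integral_interval: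
  fixes f :: "real \<Rightarrow> complex"
  assumes "continuous_on UNIV f" and "\<And>x. x \<notin> {a..b} \<Longrightarrow> f x = 0"
  shows "integrable lebesgue f" and "integral\<^sup>L lebesgue f = integral {a..b} f"
proof -
  have eq: "(\<lambda>x. indicator {a..b} x *\<^sub>R f x) = f"
    using assms(2) by (auto simp: indicator_def fun_eq_iff)
  have s: "set_integrable lebesgue {a..b} f"
    using assms(1) by (intro absolutely_integrable_continuous_real) (blast intro: continuous_on_subset)
  then show "integrable lebesgue f"
    by (simp add: set_integrable_def eq)
  show "integral\<^sup>L lebesgue f = integral {a..b} f"
    using set_lebesgue_integral_eq_integral(2)[OF s] by (simp add: set_lebesgue_integral_def eq)
qed

lemma convolution_has_vector_derivative:
  fixes K K' :: "real \<Rightarrow> real" and c :: "real \<Rightarrow> complex"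
  assumes K: "\<And>x. (K has_real_derivative K' x) (at x)" and cK': "continuous_on UNIV K'"
    and K0: "\<And>x. \<bar>x\<bar> > d \<Longrightarrow> K x = 0" and K'0: "\<And>x. \<bar>x\<bar> > d \<Longrightarrow> K' x = 0"
    and c: "continuous_on UNIV c"
  shows "((\<lambda>s. LINT t|lebesgue. K (s - t) * c t) has_vector_derivative
          (LINT t|lebesgue. K' (s - t) * c t)) (at s)"
proof -
  have cK: "continuous_on UNIV K"
    using K by (meson DERIV_continuous_on DERIV_subset subset_UNIV)
  have [continuous_intros]: "continuous_on S (\<lambda>x. K (g x))" "continuous_on S (\<lambda>x. K' (g x))"
    if "continuous_on S g" for S :: "'b::topological_space set" and g
    using continuous_on_compose2[OF cK that] continuous_on_compose2[OF cK' that] by auto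
  have [continuous_intros]: "continuous_on S (\<lambda>x. c (g x))"
    if "continuous_on S g" for S :: "'b::topological_space set" and g
    using continuous_on_compose2[OF c that] by auto
  \<comment> \<open>For \<open>x\<close> within distance 1 of \<open>s\<close> the integrand lives
    on one fixed interval in \<open>t\<close>, so the Leibniz rule for compact intervals
    applies.\<close>
  let ?U = "{s-1<..<s+1}" and ?a = "s - 1 - d" and ?b = "s + 1 + d"
  have I: "(LINT t|lebesgue. K (x - t) * c t) = integral {?a..?b} (\<lambda>t. K (x - t) * c t)"
    if "x \<in> ?U" for x
    using that by (intro integral_lebesgue_eq_integral_interval continuous_intros) (auto simp: K0)
  have I': "(LINT t|lebesgue. K' (s - t) * c t) = integral {?a..?b} (\<lambda>t. K' (s - t) * c t)"
    by (intro integral_lebesgue_eq_integral_interval continuous_intros) (auto simp: K'0)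
  have "((\<lambda>x. integral (cbox ?a ?b) (\<lambda>t. K (x - t) * c t)) has_vector_derivative
         integral (cbox ?a ?b) (\<lambda>t. K' (s - t) * c t)) (at s within ?U)"
  proof (rule leibniz_rule_vector_derivative)
    show "((\<lambda>x. of_real (K (x - t)) * c t) has_vector_derivative of_real (K' (x - t)) * c t) (at x within ?U)" for x t
    proof -
      have "((\<lambda>x. K (x - t)) has_real_derivative K' (x - t)) (at x)"
        using DERIV_shift[of K "K' (x - t)" x "- t"] K by simp
      then have "((\<lambda>x. of_real (K (x - t)) :: complex) has_vector_derivative of_real (K' (x - t))) (at x)"
        using has_vector_derivative_of_real has_real_derivative_iff_has_vector_derivative by blast
      from has_vector_derivative_mult_left[OF this, of "c t"] show ?thesis
        by (rule has_vector_derivative_at_within)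
    qed
    show "continuous_on (?U \<times> cbox ?a ?b) (\<lambda>(x, t). of_real (K' (x - t)) * c t)"
      unfolding split_beta by (intro continuous_intros)
  qed (auto intro!: integrable_continuous_real continuous_intros)
  then have "((\<lambda>x. integral {?a..?b} (\<lambda>t. K (x - t) * c t)) has_vector_derivative
         integral {?a..?b} (\<lambda>t. K' (s - t) * c t)) (at s)"
    by (subst (asm) at_within_open) auto
  then have "((\<lambda>x. LINT t|lebesgue. K (x - t) * c t) has_vector_derivative
         integral {?a..?b} (\<lambda>t. K' (s - t) * c t)) (at s)"
    by (rule has_vector_derivative_transform_within_open[where S = ?U]) (auto simp: I)
  then show ?thesis by (simp add: I')
qed

text \<open>The integrating factor is run into the future: a(t) is exp(-\<kappa> T) a(t + T) minus
  the integral of exp(-\<kappa> \<tau>) G(t + \<tau>) over [0, T]. Boundedness of \<open>a\<close>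
  kills the first term as T grows, and the integral is at most B / Re \<kappa>.\<close>

lemma bounded_solution_first_order:
  fixes a G :: "real \<Rightarrow> complex" and \<kappa> :: complex
  assumes a: "\<And>t. (a has_vector_derivative \<kappa> * a t + G t) (at t)"
    and A: "\<And>t. norm (a t) \<le> A" and B: "\<And>t. norm (G t) \<le> B" and \<kappa>: "Re \<kappa> > 0"
  shows "norm (a t) \<le> B / Re \<kappa>"
proof -
  define f where "f \<tau> = exp (- \<kappa> * of_real \<tau>) * a (t + \<tau>)" for \<tau> :: real
  have df: "(f has_vector_derivative exp (- \<kappa> * of_real \<tau>) * G (t + \<tau>)) (at \<tau>)" for \<tau>
  proof -
    have 1: "((\<lambda>\<tau>. a (t + \<tau>)) has_vector_derivative \<kappa> * a (t + \<tau>) + G (t + \<tau>)) (at \<tau>)"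
    proof -
      have "((\<lambda>\<tau>. t + \<tau>) has_vector_derivative 1) (at \<tau>)"
        unfolding has_real_derivative_iff_has_vector_derivative[symmetric]
        by (auto intro!: derivative_eq_intros)
      from vector_diff_chain_at[OF this a] show ?thesis by (simp add: o_def)
    qed
    have 2: "((\<lambda>\<tau>. exp (- \<kappa> * of_real \<tau>)) has_vector_derivative - \<kappa> * exp (- \<kappa> * of_real \<tau>)) (at \<tau>)"
      by (rule has_vector_derivative_real_field) (auto intro!: derivative_eq_intros)
    show ?thesis
      unfolding f_def using has_vector_derivative_mult[OF 2 1] by (simp add: algebra_simps)
  qed
  have key: "norm (a t) \<le> exp (- Re \<kappa> * T) * A + B / Re \<kappa>" if "T > 0" for T
  proof -
    \<comment> \<open>A primitive of the majorant B exp(- Re \<kappa> \<tau>) for the derivative of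
      \<open>f\<close>; the mean value inequality then replaces an estimate of the integral.\<close>
    define \<phi> where "\<phi> \<tau> = - B * exp (- Re \<kappa> * \<tau>) / Re \<kappa>" for \<tau> :: real
    have "norm (f T - f 0) \<le> \<phi> T - \<phi> 0"
    proof (rule differentiable_bound_general[OF that])
      show "continuous_on {0..T} f"
        using df by (meson continuous_at_imp_continuous_on has_vector_derivative_continuous)
      show "continuous_on {0..T} \<phi>" unfolding \<phi>_def by (intro continuous_intros) (use \<kappa> in auto)
      show "(f has_vector_derivative exp (- \<kappa> * of_real x) * G (t + x)) (at x)" for x by (rule df)
      show "(\<phi> has_vector_derivative B * exp (- Re \<kappa> * x)) (at x)" for x
        unfolding \<phi>_def has_real_derivative_iff_has_vector_derivative[symmetric]
        using \<kappa> by (auto intro!: derivative_eq_intros)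
      show "norm (exp (- \<kappa> * of_real x) * G (t + x)) \<le> B * exp (- Re \<kappa> * x)" for x
        using B[of "t + x"] by (simp add: norm_mult mult.commute)
    qed
    then have "norm (a t) \<le> norm (f T) + (\<phi> T - \<phi> 0)"
      using norm_triangle_ineq4[of "f T" "f T - f 0"] by (simp add: f_def)
    moreover have "norm (f T) \<le> exp (- Re \<kappa> * T) * A"
      using A[of "t + T"] by (simp add: f_def norm_mult)
    moreover have "\<phi> T \<le> 0" "\<phi> 0 = - (B / Re \<kappa>)"
      using \<kappa> order.trans[OF norm_ge_zero B] by (auto simp: \<phi>_def)
    ultimately show ?thesis by linarith
  qed
  have "((\<lambda>T. exp (- Re \<kappa> * T) * A + B / Re \<kappa>) \<longlongrightarrow> 0 * A + B / Re \<kappa>) at_top"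
  proof (intro tendsto_intros)
    have "filterlim (\<lambda>T. Re \<kappa> * T) at_top at_top"
      using \<kappa> by (intro filterlim_tendsto_pos_mult_at_top[OF tendsto_const]) (auto simp: filterlim_ident)
    then have "filterlim (\<lambda>T. - Re \<kappa> * T) at_bot at_top"
      by (simp add: filterlim_uminus_at_bot)
    then show "((\<lambda>T. exp (- Re \<kappa> * T)) \<longlongrightarrow> 0) at_top"
      by (rule filterlim_compose[OF exp_at_bot])
  qed
  then have "norm (a t) \<le> 0 * A + B / Re \<kappa>"
    by (rule tendsto_lowerbound) (rule eventually_mono[OF eventually_gt_at_top[of 0] key], auto)
  then show ?thesis by simp
qed

text \<open>
  The combinations \<open>C' + \<kappa> C\<close> and \<open>C' - \<kappa> C\<close> solve first-order equations, one unstable forwards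
  and one unstable backwards in time; their difference is \<open>2 \<kappa> C\<close>, which gives the factor
  \<open>\<bar>\<kappa>\<bar> Re \<kappa>\<close> instead of \<open>(Re \<kappa>)\<^sup>2\<close>.
\<close>

lemma bounded_solution_second_order:
  fixes C C' C'' :: "real \<Rightarrow> complex" and \<kappa> :: complex
  assumes C: "\<And>t. (C has_vector_derivative C' t) (at t)" "\<And>t. (C' has_vector_derivative C'' t) (at t)"
    and bd: "\<And>t. norm (C t) \<le> A" "\<And>t. norm (C' t) \<le> A'"
    and G: "\<And>t. norm (C'' t - \<kappa>\<^sup>2 * C t) \<le> B" and \<kappa>: "Re \<kappa> > 0"
  shows "norm (C t) \<le> B / (norm \<kappa> * Re \<kappa>)"
proof -
  define G where "G t = C'' t - \<kappa>\<^sup>2 * C t" for t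
  have b1: "norm (C' t + \<kappa> * C t) \<le> B / Re \<kappa>" for t
  proof (rule bounded_solution_first_order[where G = G and A = "A' + norm \<kappa> * A"])
    show "((\<lambda>t. C' t + \<kappa> * C t) has_vector_derivative \<kappa> * (C' t + \<kappa> * C t) + G t) (at t)" for t
      using has_vector_derivative_add[OF C(2) has_vector_derivative_mult_right[OF C(1), where a = \<kappa>], of t]
      by (simp add: G_def algebra_simps power2_eq_square)
    show "norm (C' t + \<kappa> * C t) \<le> A' + norm \<kappa> * A" for t
      by (rule norm_triangle_le) (auto simp: norm_mult intro!: add_mono mult_left_mono bd)
  qed (use G \<kappa> in \<open>auto simp: G_def\<close>)
  have "norm (C' (- s) - \<kappa> * C (- s)) \<le> B / Re \<kappa>" for s
  proof (rule bounded_solution_first_order[where a = "\<lambda>s. C' (- s) - \<kappa> * C (- s)" and G = "\<lambda>s. - G (- s)" and A = "A' + norm \<kappa> * A"])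
    fix s
    have "((\<lambda>t. C' t - \<kappa> * C t) has_vector_derivative C'' (- s) - \<kappa> * C' (- s)) (at (- s))"
      by (intro has_vector_derivative_diff C has_vector_derivative_mult_right)
    moreover have "(uminus has_vector_derivative - 1) (at s)"
      unfolding has_real_derivative_iff_has_vector_derivative[symmetric]
      by (auto intro!: derivative_eq_intros)
    ultimately have "((\<lambda>s. C' (- s) - \<kappa> * C (- s)) has_vector_derivative - (C'' (- s) - \<kappa> * C' (- s))) (at s)"
      using vector_diff_chain_at[of uminus "-1" s "\<lambda>t. C' t - \<kappa> * C t"]
      by (fastforce simp: o_def)
    then show "((\<lambda>s. C' (- s) - \<kappa> * C (- s)) has_vector_derivative
        \<kappa> * (C' (- s) - \<kappa> * C (- s)) + - G (- s)) (at s)"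
      by (simp add: G_def algebra_simps power2_eq_square)
    show "norm (C' (- s) - \<kappa> * C (- s)) \<le> A' + norm \<kappa> * A"
      by (rule norm_triangle_le_diff) (auto simp: norm_mult intro!: add_mono mult_left_mono bd)
    show "norm (- G (- s)) \<le> B" using G[of "- s"] unfolding norm_minus_cancel by (simp add: G_def)
  qed (use \<kappa> in \<open>auto simp: G_def\<close>)
  from this[of "- t"] have b2: "norm (C' t - \<kappa> * C t) \<le> B / Re \<kappa>" by simp
  have "norm (2 * \<kappa> * C t) = norm ((C' t + \<kappa> * C t) - (C' t - \<kappa> * C t))"
    by (simp add: algebra_simps)
  also have "\<dots> \<le> B / Re \<kappa> + B / Re \<kappa>"
    by (rule norm_triangle_le_diff) (intro add_mono b1 b2)
  finally have "norm \<kappa> * norm (C t) \<le> B / Re \<kappa>"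
    by (simp add: norm_mult)
  moreover have "norm \<kappa> > 0" using \<kappa> by auto
  ultimately show ?thesis using \<kappa> by (simp add: field_simps)
qed

section \<open>Mollification of weak equations in time\<close>

lemma smooth_real_deriv:
  fixes \<phi> :: "real \<Rightarrow> real"
  assumes "smooth \<phi>"
  shows "(\<phi> has_real_derivative deriv \<phi> x) (at x)" "(deriv \<phi> has_real_derivative deriv (deriv \<phi>) x) (at x)"
    "continuous_on UNIV \<phi>" "continuous_on UNIV (deriv \<phi>)" "continuous_on UNIV (deriv (deriv \<phi>))"
proof -
  have 1: "((deriv ^^ n) \<phi> has_real_derivative (deriv ^^ (Suc n)) \<phi> x) (at x)" for n x
    using smooth_deriv_tower[OF assms] by (simp only: deriv_tower_def)
  have 2: "continuous_on UNIV ((deriv ^^ n) \<phi>)" for n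
    using 1[of n] by (meson DERIV_continuous_on DERIV_subset subset_UNIV)
  show "(\<phi> has_real_derivative deriv \<phi> x) (at x)" "(deriv \<phi> has_real_derivative deriv (deriv \<phi>) x) (at x)"
    "continuous_on UNIV \<phi>" "continuous_on UNIV (deriv \<phi>)" "continuous_on UNIV (deriv (deriv \<phi>))"
    using 1[of 0 x] 1[of 1 x] 2[of 0] 2[of 1] 2[of 2] by (simp_all add: numeral_2_eq_2)
qed

lemma deriv_eq_0_off_support:
  fixes f :: "real \<Rightarrow> real"
  assumes "\<And>x. \<bar>x\<bar> > d \<Longrightarrow> f x = 0" and "\<bar>x\<bar> > d"
  shows "deriv f x = 0"
proof -
  have "open {x::real. \<bar>x\<bar> > d}"
    by (intro open_Collect_less continuous_intros)
  then have "(f has_real_derivative 0) (at x)"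
    using assms by (intro has_field_derivative_transform_within_open[OF DERIV_const, of "{x. \<bar>x\<bar> > d}"]) auto
  then show ?thesis by (rule DERIV_imp_deriv)
qed

lemma integral_lebesgue_reflect:
  fixes k :: "real \<Rightarrow> real"
  assumes "continuous_on UNIV k"
  shows "(LINT t|lebesgue. k (s - t)) = (LINT t|lebesgue. k t)"
proof -
  have [measurable]: "k \<in> borel_measurable borel"
    using assms by (rule borel_measurable_continuous_onI)
  have "(LINT t|lborel. k t) = (LINT t|lborel. k (s - t))"
    using lborel_integral_real_affine[of "-1" k s] by simp
  then show ?thesis by (simp add: integral_completion)
qed

text \<open>Young's inequality for an L1 kernel against a bounded function. The bound is requested
  only where the translated kernel is nonzero, so the lemma serves both for global bounds and for
  the oscillation of \<open>c\<close> near one point.\<close>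

lemma norm_convolution_le:
  fixes K :: "real \<Rightarrow> real" and f :: "real \<Rightarrow> complex"
  assumes K: "continuous_on UNIV K" "\<And>x. \<bar>x\<bar> > d \<Longrightarrow> K x = 0"
    and f: "f \<in> borel_measurable lebesgue" "AE t in lebesgue. K (s - t) \<noteq> 0 \<longrightarrow> norm (f t) \<le> B"
  shows "integrable lebesgue (\<lambda>t. K (s - t) * f t)"
    and "norm (LINT t|lebesgue. K (s - t) * f t) \<le> B * (LINT t|lebesgue. \<bar>K t\<bar>)"
proof -
  have cont: "continuous_on UNIV (\<lambda>t. K (s - t))"
    by (rule continuous_on_compose2[OF K(1)]) (auto intro!: continuous_intros)
  have "(\<lambda>t. K (s - t)) \<in> borel_measurable borel"
    by (rule borel_measurable_continuous_onI[OF cont])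
  then have [measurable]: "(\<lambda>t. K (s - t)) \<in> borel_measurable lebesgue"
    by (simp add: measurable_completion)
  note f(1)[measurable]
  have "integrable lebesgue (\<lambda>t. of_real \<bar>K (s - t)\<bar> :: complex)"
    by (rule integral_lebesgue_eq_integral_interval[of _ "s - d" "s + d"]) (auto intro!: continuous_intros cont K(2))
  then have i: "integrable lebesgue (\<lambda>t. \<bar>K (s - t)\<bar> * B)"
    using complex_of_real_integrable_eq by auto
  have b': "AE t in lebesgue. norm (K (s - t) * f t) \<le> \<bar>K (s - t)\<bar> * B"
    using f(2)
  proof eventually_elim
    case (elim t)
    then show ?case
      by (cases "K (s - t) = 0") (auto simp: norm_mult abs_mult intro!: mult_left_mono)
  qed
  have b: "AE t in lebesgue. norm (K (s - t) * f t) \<le> norm (\<bar>K (s - t)\<bar> * B)"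
    using b' by eventually_elim simp
  show I: "integrable lebesgue (\<lambda>t. K (s - t) * f t)"
    by (rule Bochner_Integration.integrable_bound[OF i _ b]) measurable
  have "norm (LINT t|lebesgue. K (s - t) * f t) \<le> (LINT t|lebesgue. norm (K (s - t) * f t))"
    by (rule integral_norm_bound)
  also have "\<dots> \<le> (LINT t|lebesgue. \<bar>K (s - t)\<bar> * B)"
    by (rule integral_mono_AE[OF integrable_norm[OF I] i b'])
  also have "\<dots> = B * (LINT t|lebesgue. \<bar>K t\<bar>)"
    using integral_lebesgue_reflect[of "\<lambda>t. \<bar>K t\<bar>" s] K(1) by (simp add: continuous_on_rabs)
  finally show "norm (LINT t|lebesgue. K (s - t) * f t) \<le> B * (LINT t|lebesgue. \<bar>K t\<bar>)" .
qed

text \<open>Convolution with a bump turns the weak equation into a classical one whose right-hand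
  side is still bounded by B times the mass of the bump, so the classical bound applies. The radius
  is chosen by continuity of \<open>c\<close> at \<open>s\<close>, which makes the mollified value
  close to the mass times c(s).\<close>

lemma weak_second_order_bound:
  fixes c g :: "real \<Rightarrow> complex" and \<kappa> :: complex
  assumes c: "continuous_on UNIV c" "\<And>t. norm (c t) \<le> S"
    and g: "g \<in> borel_measurable lebesgue" "AE t in lebesgue. norm (g t) \<le> B"
    and \<kappa>: "Re \<kappa> > 0"
    and weak: "\<And>\<phi>::real\<Rightarrow>real. smooth \<phi> \<Longrightarrow> \<exists>d. \<forall>x. \<bar>x\<bar> > d \<longrightarrow> \<phi> x = 0 \<Longrightarrow>
       (LINT t|lebesgue. deriv (deriv \<phi>) t * c t - \<kappa>\<^sup>2 * (\<phi> t * c t) + \<phi> t * g t) = 0"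
  shows "norm (c s) \<le> B / (norm \<kappa> * Re \<kappa>)"
proof (rule field_le_epsilon)
  fix e :: real assume "e > 0"
  have "isCont c s" using c(1) by (simp add: continuous_on_eq_continuous_at)
  then obtain \<delta> where \<delta>: "\<delta> > 0" "\<And>t. dist t s < \<delta> \<Longrightarrow> dist (c t) (c s) < e"
    using \<open>e > 0\<close> unfolding continuous_at_eps_delta by (metis dist_norm)
  define \<rho> where "\<rho> = bump \<delta>"
  note \<rho> = smooth_real_deriv[OF smooth_bump[of \<delta>], folded \<rho>_def]
  have z0: "\<bar>x\<bar> > \<delta> \<Longrightarrow> \<rho> x = 0" for x
    using \<delta>(1) by (simp add: \<rho>_def bump_eq_0)
  have z1: "\<bar>x\<bar> > \<delta> \<Longrightarrow> deriv \<rho> x = 0" for x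
    by (rule deriv_eq_0_off_support[OF z0])
  have z2: "\<bar>x\<bar> > \<delta> \<Longrightarrow> deriv (deriv \<rho>) x = 0" for x
    by (rule deriv_eq_0_off_support[OF z1])
  have cm: "c \<in> borel_measurable lebesgue"
    using borel_measurable_continuous_onI[OF c(1)] by (simp add: measurable_completion)
  \<comment> \<open>The kernel is not normalised; its mass is carried along and cancelled at the
    very end.\<close>
  define I where "I = (LINT t|lebesgue. \<bar>\<rho> t\<bar>)"
  have I: "I > 0"
  proof -
    have i: "integrable lebesgue \<rho>"
    proof -
      have "integrable lebesgue (\<lambda>t. of_real (\<rho> t) :: complex)"
        by (rule integral_lebesgue_eq_integral_interval[of _ "- \<delta>" "\<delta>"]) (auto intro!: continuous_intros \<rho>(3) z0)
      then show ?thesis by (simp add: complex_of_real_integrable_eq)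
    qed
    have "I \<noteq> 0"
    proof
      assume "I = 0"
      then have "AE t in lebesgue. \<rho> t = 0"
        using integral_nonneg_eq_0_iff_AE[of lebesgue "\<lambda>t. \<bar>\<rho> t\<bar>"] i by (auto simp: I_def)
      then have "AE t in lebesgue. \<not> (t \<in> {-\<delta><..<\<delta>})"
      proof eventually_elim
        case (elim t)
        then show ?case using bump_pos[of t \<delta>] by (auto simp: \<rho>_def abs_less_iff)
      qed
      then have "AE t in lborel. \<not> (t \<in> {-\<delta><..<\<delta>})"
        by (simp add: AE_completion_iff)
      then have "emeasure lborel {-\<delta><..<\<delta>} = 0"
        by (subst (asm) AE_iff_measurable[of "{-\<delta><..<\<delta>}"]) auto
      then show False using \<delta>(1) by simp
    qed
    moreover have "I \<ge> 0" unfolding I_def by simp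
    ultimately show ?thesis by simp
  qed
  have cS: "AE t in lebesgue. K (s - t) \<noteq> 0 \<longrightarrow> norm (c t) \<le> S" for K :: "real \<Rightarrow> real" and s
    by (rule AE_I2) (simp add: c(2))
  define C where "C s = (LINT t|lebesgue. \<rho> (s - t) * c t)" for s
  define C' where "C' s = (LINT t|lebesgue. deriv \<rho> (s - t) * c t)" for s
  define C'' where "C'' s = (LINT t|lebesgue. deriv (deriv \<rho>) (s - t) * c t)" for s
  have "norm (C s) \<le> B * I / (norm \<kappa> * Re \<kappa>)"
  proof (rule bounded_solution_second_order[where C' = C' and C'' = C''])
    show "(C has_vector_derivative C' s) (at s)" for s
      unfolding C_def C'_def by (rule convolution_has_vector_derivative[OF \<rho>(1) \<rho>(4) z0 z1 c(1)])
    show "(C' has_vector_derivative C'' s) (at s)" for s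
      unfolding C'_def C''_def by (rule convolution_has_vector_derivative[OF \<rho>(2) \<rho>(5) z1 z2 c(1)])
    show "norm (C s) \<le> S * I" for s
      unfolding C_def I_def by (rule norm_convolution_le[OF \<rho>(3) z0 cm cS])
    show "norm (C' s) \<le> S * (LINT t|lebesgue. \<bar>deriv \<rho> t\<bar>)" for s
      unfolding C'_def by (rule norm_convolution_le[OF \<rho>(4) z1 cm cS])
    show "norm (C'' s - \<kappa>\<^sup>2 * C s) \<le> B * I" for s
    proof -
      \<comment> \<open>Testing with the reflected and translated kernel evaluates the mollified
        equation at \<open>s\<close>; the two signs caused by the reflection cancel in the second
        derivative.\<close>
      define \<phi> where "\<phi> t = \<rho> (s - t)" for t
      have "smooth (\<lambda>t::real. s - t)"
        by (intro smooth_diff smooth_const smooth_bounded_linear bounded_linear_ident)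
      from smooth_compose_tower[OF smooth_deriv_tower[OF smooth_bump] this, of 0]
      have s\<phi>: "smooth \<phi>" by (simp add: \<phi>_def[abs_def] \<rho>_def)
      have rd: "((\<lambda>t. s - t) has_real_derivative - 1) (at t)" for t
        by (auto intro!: derivative_eq_intros)
      have "deriv \<phi> t = - deriv \<rho> (s - t)" for t
        unfolding \<phi>_def using DERIV_chain2[OF \<rho>(1) rd] by (intro DERIV_imp_deriv) simp
      then have d1: "deriv \<phi> = (\<lambda>t. - deriv \<rho> (s - t))" by auto
      have "deriv (deriv \<phi>) t = deriv (deriv \<rho>) (s - t)" for t
        unfolding d1 using DERIV_minus[OF DERIV_chain2[OF \<rho>(2) rd]] by (intro DERIV_imp_deriv) simp
      moreover have "\<exists>d. \<forall>x. \<bar>x\<bar> > d \<longrightarrow> \<phi> x = 0"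
        by (rule exI[of _ "\<delta> + \<bar>s\<bar>"]) (auto simp: \<phi>_def intro!: z0)
      ultimately have w: "(LINT t|lebesgue. deriv (deriv \<rho>) (s - t) * c t - \<kappa>\<^sup>2 * (\<rho> (s - t) * c t)
          + \<rho> (s - t) * g t) = 0"
        using weak[OF s\<phi>] by (simp add: \<phi>_def)
      have i1: "integrable lebesgue (\<lambda>t. deriv (deriv \<rho>) (s - t) * c t)"
        by (rule norm_convolution_le[OF \<rho>(5) z2 cm cS])
      have i2: "integrable lebesgue (\<lambda>t. \<rho> (s - t) * c t)"
        by (rule norm_convolution_le[OF \<rho>(3) z0 cm cS])
      have gB: "AE t in lebesgue. \<rho> (s - t) \<noteq> 0 \<longrightarrow> norm (g t) \<le> B"
        using g(2) by eventually_elim simp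
      have i3: "integrable lebesgue (\<lambda>t. \<rho> (s - t) * g t)"
        by (rule norm_convolution_le[OF \<rho>(3) z0 g(1) gB])
      have "C'' s - \<kappa>\<^sup>2 * C s + (LINT t|lebesgue. \<rho> (s - t) * g t) = 0"
        using w i1 i2 i3 by (simp add: C_def C''_def)
      then have "C'' s - \<kappa>\<^sup>2 * C s = - (LINT t|lebesgue. \<rho> (s - t) * g t)"
        by (simp add: eq_neg_iff_add_eq_0)
      then have "norm (C'' s - \<kappa>\<^sup>2 * C s) = norm (LINT t|lebesgue. \<rho> (s - t) * g t)"
        by (simp only: norm_minus_cancel)
      also have "\<dots> \<le> B * I"
        unfolding I_def by (rule norm_convolution_le[OF \<rho>(3) z0 g(1) gB])
      finally show ?thesis .
    qed
  qed (rule \<kappa>)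
  moreover have "norm (C s - I * c s) \<le> e * I"
  proof -
    have i2: "integrable lebesgue (\<lambda>t. \<rho> (s - t) * c t)"
      by (rule norm_convolution_le[OF \<rho>(3) z0 cm cS])
    have i3: "integrable lebesgue (\<lambda>t. \<rho> (s - t) * c s)"
      by (rule norm_convolution_le[OF \<rho>(3) z0, where B = "norm (c s)"]) auto
    have "(LINT t|lebesgue. \<rho> (s - t) * c s) = of_real (LINT t|lebesgue. \<rho> (s - t)) * c s"
      by simp
    also have "(LINT t|lebesgue. \<rho> (s - t)) = I"
      unfolding I_def using integral_lebesgue_reflect[OF \<rho>(3)] bump_nonneg[of \<delta>]
      by (simp add: \<rho>_def)
    finally have "C s - I * c s = (LINT t|lebesgue. \<rho> (s - t) * c t - \<rho> (s - t) * c s)"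
      unfolding C_def using i2 i3 by (simp only: Bochner_Integration.integral_diff)
    also have "\<dots> = (LINT t|lebesgue. \<rho> (s - t) * (c t - c s))"
      by (simp add: algebra_simps)
    also have "norm \<dots> \<le> e * I"
      unfolding I_def
    proof (rule norm_convolution_le[OF \<rho>(3) z0])
      have "\<rho> (s - t) \<noteq> 0 \<Longrightarrow> norm (c t - c s) \<le> e" for t
      proof -
        assume "\<rho> (s - t) \<noteq> 0"
        then have "dist t s < \<delta>"
          using bump_eq_0[of \<delta> "s - t"] \<delta>(1) by (cases "\<bar>s - t\<bar> < \<delta>") (auto simp: \<rho>_def dist_real_def)
        then show ?thesis
          using \<delta>(2)[of t] by (simp add: dist_norm)
      qed
      then show "AE t in lebesgue. \<rho> (s - t) \<noteq> 0 \<longrightarrow> norm (c t - c s) \<le> e" by simp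
    qed (use cm in auto)
    finally show ?thesis .
  qed
  ultimately have "norm (I * c s) \<le> B * I / (norm \<kappa> * Re \<kappa>) + e * I"
    using norm_triangle_ineq4[of "C s" "C s - I * c s"] by simp
  then have "I * norm (c s) \<le> I * (B / (norm \<kappa> * Re \<kappa>) + e)"
    using I by (simp add: norm_mult algebra_simps)
  then show "norm (c s) \<le> B / (norm \<kappa> * Re \<kappa>) + e"
    using I by simp
qed

section \<open>Functionals continuous under bounded convergence\<close>

definition bounded_borel :: "('a::topological_space \<Rightarrow> complex) set" where
  "bounded_borel = {f \<in> borel_measurable borel. \<exists>B. \<forall>x. norm (f x) \<le> B}"

lemma bounded_borelI:
  "f \<in> borel_measurable borel \<Longrightarrow> (\<And>x. norm (f x) \<le> B) \<Longrightarrow> f \<in> bounded_borel"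
  by (auto simp: bounded_borel_def)

lemma bounded_borel_add:
  assumes "f \<in> bounded_borel" "g \<in> bounded_borel"
  shows "(\<lambda>x. f x + g x) \<in> bounded_borel"
proof -
  obtain B C where "\<And>x. norm (f x) \<le> B" "\<And>x. norm (g x) \<le> C"
    using assms by (auto simp: bounded_borel_def)
  then show ?thesis
    using assms by (intro bounded_borelI[where B = "B + C"]) (auto simp: bounded_borel_def intro: norm_triangle_mono)
qed

lemma bounded_borel_mult:
  assumes "f \<in> bounded_borel" "g \<in> bounded_borel"
  shows "(\<lambda>x. f x * g x) \<in> bounded_borel"
proof -
  obtain B C where *: "\<And>x. norm (f x) \<le> B" "\<And>x. norm (g x) \<le> C"
    using assms by (auto simp: bounded_borel_def)
  then have "B \<ge> 0" by (meson norm_ge_zero order_trans)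
  with * show ?thesis
    using assms by (intro bounded_borelI[where B = "B * C"]) (auto simp: bounded_borel_def norm_mult intro!: mult_mono)
qed

lemma bounded_borel_const: "(\<lambda>x. c) \<in> bounded_borel"
  by (rule bounded_borelI[where B = "norm c"]) auto

lemma bounded_borel_indicator: "A \<in> sets borel \<Longrightarrow> (\<lambda>x. indicator A x) \<in> bounded_borel"
  by (rule bounded_borelI[where B = 1]) (auto simp: indicator_def)

lemma bounded_borel_restrict:
  fixes f :: "'a::euclidean_space \<Rightarrow> complex"
  assumes "compact K" "continuous_on K f"
  shows "(\<lambda>x. indicator K x * f x) \<in> bounded_borel"
proof -
  have "(\<lambda>x. indicator K x *\<^sub>R f x) \<in> borel_measurable borel"
    by (rule borel_measurable_continuous_on_indicator[OF borel_closed assms(2)])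
       (rule compact_imp_closed[OF assms(1)])
  moreover obtain B where "B > 0" "\<forall>y\<in>f ` K. norm y \<le> B"
    using compact_imp_bounded[OF compact_continuous_image[OF assms(2,1)]] bounded_pos by blast
  ultimately show ?thesis
    by (intro bounded_borelI[where B = B]) (auto simp: indicator_scaleR_eq_if indicator_times_eq_if)
qed

text \<open>
  This axiomatises integration against a complex measure carried by \<open>K\<close>. Differences of integrals
  over unrelated spaces are again of this form, so no signed measures are needed.
\<close>

locale bounded_convergence_functional =
  fixes L :: "('a::euclidean_space \<Rightarrow> complex) \<Rightarrow> complex" and K :: "'a set"
  assumes compact: "compact K"
    and add: "f \<in> bounded_borel \<Longrightarrow> g \<in> bounded_borel \<Longrightarrow> L (\<lambda>x. f x + g x) = L f + L g"
    and scale: "f \<in> bounded_borel \<Longrightarrow> L (\<lambda>x. c * f x) = c * L f"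
    and conv: "(\<And>n. F n \<in> bounded_borel) \<Longrightarrow> f \<in> bounded_borel \<Longrightarrow> (\<And>n x. norm (F n x) \<le> B) \<Longrightarrow>
      (\<And>x. (\<lambda>n::nat. F n x) \<longlonglongrightarrow> f x) \<Longrightarrow> (\<lambda>n. L (F n)) \<longlonglongrightarrow> L f"
    and local: "f \<in> bounded_borel \<Longrightarrow> g \<in> bounded_borel \<Longrightarrow> (\<And>x. x \<in> K \<Longrightarrow> f x = g x) \<Longrightarrow> L f = L g"
begin

lemma L_zero: "L (\<lambda>x. 0) = 0"
  using scale[OF bounded_borel_const[of 0], of 0] by simp

lemma L_sum:
  "finite I \<Longrightarrow> (\<And>i. i \<in> I \<Longrightarrow> f i \<in> bounded_borel) \<Longrightarrow>
   (\<lambda>x. \<Sum>i\<in>I. f i x) \<in> bounded_borel \<and> L (\<lambda>x. \<Sum>i\<in>I. f i x) = (\<Sum>i\<in>I. L (f i))"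
  by (induction I rule: finite_induct) (auto simp: L_zero bounded_borel_const bounded_borel_add add)

text \<open>Uniqueness as in the Riesz theorem, but for the functional itself: hat functions of the
  distance decrease to indicators of closed sets, Dynkin's theorem reaches all Borel sets, and
  monotone limits of simple functions reach bounded functions.\<close>

lemma vanishes_on_bounded_borel:
  assumes cont: "\<And>f. continuous_on K f \<Longrightarrow> L (\<lambda>x. indicator K x * of_real (f x)) = 0"
    and \<phi>: "\<phi> \<in> bounded_borel"
  shows "L \<phi> = 0"
proof -
  \<comment> \<open>An induction below has a case named \<open>add\<close>, which shadows the
    additivity of \<open>L\<close>.\<close>
  note L_add = add
  have closed: "L (\<lambda>x. indicator C x) = 0" if "closed C" for C
  \<comment> \<open>\<open>infdist\<close> to the empty set is 0 by convention, so there the hat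
    functions would tend to 1 on \<open>K\<close> instead of to the indicator.\<close>
  proof (cases "C = {}")
    case False
    define F where "F n x = (indicator K x * of_real (max 0 (1 - real n * infdist x C)) :: complex)" for n x
    have F: "F n \<in> bounded_borel" for n
      unfolding F_def
      by (rule bounded_borel_restrict[OF compact]) (intro continuous_intros)
    have "(\<lambda>n. L (F n)) \<longlonglongrightarrow> L (\<lambda>x. indicator K x * indicator C x)"
    proof (rule conv[OF F])
      show "(\<lambda>x. indicator K x * indicator C x) \<in> bounded_borel"
        using that compact by (intro bounded_borel_mult bounded_borel_indicator) (auto simp: borel_compact)
      show "norm (F n x) \<le> 1" for n x
        by (auto simp: F_def indicator_def infdist_nonneg)
      show "(\<lambda>n. F n x) \<longlonglongrightarrow> indicator K x * indicator C x" for x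
      proof (cases "x \<in> C")
        case True
        then show ?thesis by (simp add: F_def)
      next
        case f: False
        then have pos: "infdist x C > 0"
          using infdist_pos_not_in_closed[OF that False] by auto
        obtain N where N: "real N * infdist x C > 1"
          using reals_Archimedean3[OF pos] by blast
        have "F n x = 0" if "n \<ge> N" for n
        proof -
          have "real N * infdist x C \<le> real n * infdist x C"
            using that pos by (intro mult_right_mono) auto
          then show ?thesis using N by (simp add: F_def)
        qed
        then have "\<forall>\<^sub>F n in sequentially. F n x = 0"
          by (auto simp: eventually_sequentially)
        then show ?thesis using f by (simp add: tendsto_eventually)
      qed
    qed
    moreover have "L (F n) = 0" for n
      unfolding F_def by (rule cont) (intro continuous_intros)
    ultimately have "L (\<lambda>x. indicator K x * indicator C x) = 0"
      by (simp add: LIMSEQ_const_iff)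
    moreover have "L (\<lambda>x. indicator K x * indicator C x) = L (\<lambda>x. indicator C x)"
      using that compact by (intro local bounded_borel_mult bounded_borel_indicator) (auto simp: borel_compact)
    ultimately show ?thesis by simp
  qed (simp add: L_zero)
  have "Int_stable (Collect closed :: 'a set set)"
    by (auto simp: Int_stable_def)
  then have sets: "L (\<lambda>x. indicator A x) = 0" if "A \<in> sets borel" for A
  proof (rule sigma_sets_induct_disjoint[where \<Omega> = UNIV and A = A])
    show "A \<in> sigma_sets UNIV (Collect closed)"
      using that by (simp add: borel_eq_closed)
  next
    fix A :: "'a set" assume A: "A \<in> sigma_sets UNIV (Collect closed)" "L (\<lambda>x. indicator A x) = 0"
    then have Ab: "A \<in> sets borel" by (simp add: borel_eq_closed)
    have "(\<lambda>x. indicator (UNIV - A) x) = (\<lambda>x. (1::complex) + (-1) * indicator A x)"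
      by (auto simp: indicator_def)
    moreover have "L (\<lambda>x. 1) = 0"
      using closed[of UNIV] by simp
    ultimately show "L (\<lambda>x. indicator (UNIV - A) x) = 0"
      using add[OF bounded_borel_const[of 1] bounded_borel_mult[OF bounded_borel_const bounded_borel_indicator[OF Ab]], of "-1"]
        scale[OF bounded_borel_indicator[OF Ab], of "-1"] A(2)
      by simp
  next
    fix A :: "nat \<Rightarrow> 'a set"
    assume d: "disjoint_family A" and A: "range A \<subseteq> sigma_sets UNIV (Collect closed)"
      and L: "\<And>i. L (\<lambda>x. indicator (A i) x) = 0"
    have Ab: "A i \<in> sets borel" for i using A by (auto simp: borel_eq_closed)
    define F where "F n x = (\<Sum>i<n. indicator (A i) x :: complex)" for n x
    have F: "F n = (\<lambda>x. indicator (\<Union>i<n. A i) x)" for n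
      unfolding F_def using d
      by (auto simp: fun_eq_iff indicator_UN_disjoint disjoint_family_on_def)
    have "(\<lambda>n. L (F n)) \<longlonglongrightarrow> L (\<lambda>x. indicator (\<Union>i. A i) x)"
    proof (rule conv)
      show "F n \<in> bounded_borel" for n unfolding F by (rule bounded_borel_indicator) (use Ab in auto)
      show "(\<lambda>x. indicator (\<Union>i. A i) x) \<in> bounded_borel" by (rule bounded_borel_indicator) (use Ab in auto)
      show "norm (F n x) \<le> 1" for n x unfolding F by (auto simp: indicator_def)
      show "(\<lambda>n. F n x) \<longlonglongrightarrow> indicator (\<Union>i. A i) x" for x
        unfolding F by (rule LIMSEQ_indicator_UN)
    qed
    moreover have "L (F n) = 0" for n
      unfolding F_def using L_sum[of "{..<n}" "\<lambda>i x. indicator (A i) x"] bounded_borel_indicator[OF Ab] L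
      by auto
    ultimately show "L (\<lambda>x. indicator (\<Union> (range A)) x) = 0"
      by (simp add: LIMSEQ_const_iff)
  qed (auto simp: closed L_zero)
  \<comment> \<open>The bound is a premise inside the induction formula because the rule ranges over
    all nonnegative Borel functions; each case has to derive bounds for its pieces before it may use
    their hypotheses.\<close>
  have nonneg: "(\<exists>B. \<forall>x. f x \<le> B) \<longrightarrow> L (\<lambda>x. of_real (f x)) = 0"
    if "f \<in> borel_measurable borel" "\<And>x. 0 \<le> f x" for f :: "'a \<Rightarrow> real"
    using that
  proof (induction rule: borel_measurable_induct_real)
    case (set A)
    then show ?case using sets[of A] by (simp add: of_real_indicator)
  next
    case (mult u c)
    show ?case
    proof (intro impI, elim exE)
      fix B assume B: "\<forall>x. c * u x \<le> B"
      show "L (\<lambda>x. of_real (c * u x)) = 0"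
      proof (cases "c = 0")
        case False
        then have "\<forall>x. u x \<le> B / c" using B mult(1) by (simp add: field_simps)
        then have "L (\<lambda>x. of_real (u x)) = 0" "(\<lambda>x. complex_of_real (u x)) \<in> bounded_borel"
          using mult by (auto intro!: bounded_borelI[where B = "B / c"])
        then show ?thesis using scale[of "\<lambda>x. of_real (u x)" "of_real c"] by simp
      qed (simp add: L_zero)
    qed
  next
    case (add u v)
    show ?case
    proof (intro impI, elim exE)
      fix B assume B: "\<forall>x. v x + u x \<le> B"
      then have b: "u x \<le> B" "v x \<le> B" for x
        using add.hyps(2)[of x] add.hyps(4)[of x] B[rule_format, of x] by linarith+
      then have "(\<lambda>x. complex_of_real (u x)) \<in> bounded_borel" "(\<lambda>x. complex_of_real (v x)) \<in> bounded_borel"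
        using add by (auto intro!: bounded_borelI[where B = "B"])
      moreover have "L (\<lambda>x. of_real (u x)) = 0" "L (\<lambda>x. of_real (v x)) = 0"
        using b add.IH by blast+
      ultimately show "L (\<lambda>x. of_real (v x + u x)) = 0"
        by (simp add: L_add)
    qed
  next
    case (seq U)
    show ?case
    proof (intro impI, elim exE)
      fix B assume B: "\<forall>x. f x \<le> B"
      have U: "U i x \<le> f x" for i x
      proof (rule LIMSEQ_le_const)
        show "(\<lambda>i. U i x) \<longlonglongrightarrow> f x" using seq.hyps(4) by simp
        show "\<exists>N. \<forall>n\<ge>N. U i x \<le> U n x"
          using seq.hyps(3) by (auto simp: incseq_def le_fun_def)
      qed
      have UB: "U i x \<le> B" for i x using U[of i x] B by (meson order_trans)
      have "(\<lambda>n. L (\<lambda>x. of_real (U n x))) \<longlonglongrightarrow> L (\<lambda>x. of_real (f x))"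
      proof (rule conv[where B = B])
        show "(\<lambda>x. complex_of_real (U n x)) \<in> bounded_borel" for n
          using seq.hyps(1,2) UB by (auto intro!: bounded_borelI[where B = "B"])
        show "(\<lambda>x. complex_of_real (f x)) \<in> bounded_borel"
          using that B by (auto intro!: bounded_borelI[where B = "B"])
        show "norm (complex_of_real (U n x)) \<le> B" for n x
          using seq.hyps(2) UB by auto
        show "(\<lambda>n. complex_of_real (U n x)) \<longlonglongrightarrow> complex_of_real (f x)" for x
          using seq.hyps(4) by (intro tendsto_of_real) auto
      qed
      moreover have "L (\<lambda>x. of_real (U n x)) = 0" for n
        using seq.IH UB by blast
      ultimately show "L (\<lambda>x. of_real (f x)) = 0"
        by (simp add: LIMSEQ_const_iff)
    qed
  qed
  have real: "L (\<lambda>x. of_real (f x)) = 0 \<and> (\<lambda>x. complex_of_real (f x)) \<in> bounded_borel"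
    if f: "f \<in> borel_measurable borel" "\<And>x. \<bar>f x\<bar> \<le> B" for f :: "'a \<Rightarrow> real" and B
  proof -
    have B: "B \<ge> 0" using f(2) by (meson abs_ge_zero order_trans)
    have "max 0 (f x) \<le> B" "max 0 (- f x) \<le> B" for x
      using f(2)[of x] B by (auto simp: abs_le_iff)
    then have 1: "L (\<lambda>x. of_real (max 0 (f x))) = 0" "L (\<lambda>x. of_real (max 0 (- f x))) = 0"
      "(\<lambda>x. complex_of_real (max 0 (f x))) \<in> bounded_borel"
      "(\<lambda>x. complex_of_real (max 0 (- f x))) \<in> bounded_borel"
      using f(1) nonneg[of "\<lambda>x. max 0 (f x)"] nonneg[of "\<lambda>x. max 0 (- f x)"]
      by (auto intro!: bounded_borelI[where B = B])
    have "(\<lambda>x. complex_of_real (f x)) = (\<lambda>x. of_real (max 0 (f x)) + (-1) * of_real (max 0 (- f x)))"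
      by (auto simp: fun_eq_iff max_def)
    moreover have "L (\<lambda>x. of_real (max 0 (f x)) + (-1) * of_real (max 0 (- f x))) = 0"
      using 1 by (subst add) (auto intro: bounded_borel_mult[OF bounded_borel_const] simp only: scale mult_zero_right add_0)
    moreover have "(\<lambda>x. complex_of_real (f x)) \<in> bounded_borel"
      using f by (intro bounded_borelI[where B = B]) auto
    ultimately show ?thesis by simp
  qed
  obtain B where B: "\<And>x. norm (\<phi> x) \<le> B" and [measurable]: "\<phi> \<in> borel_measurable borel"
    using \<phi> by (auto simp: bounded_borel_def)
  have r: "L (\<lambda>x. of_real (Re (\<phi> x))) = 0 \<and> (\<lambda>x. complex_of_real (Re (\<phi> x))) \<in> bounded_borel"
  proof (rule real)
    show "\<bar>Re (\<phi> x)\<bar> \<le> B" for x using abs_Re_le_cmod[of "\<phi> x"] B[of x] by linarith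
  qed measurable
  have i: "L (\<lambda>x. of_real (Im (\<phi> x))) = 0 \<and> (\<lambda>x. complex_of_real (Im (\<phi> x))) \<in> bounded_borel"
  proof (rule real)
    show "\<bar>Im (\<phi> x)\<bar> \<le> B" for x using abs_Im_le_cmod[of "\<phi> x"] B[of x] by linarith
  qed measurable
  have "\<phi> = (\<lambda>x. of_real (Re (\<phi> x)) + \<i> * of_real (Im (\<phi> x)))"
    by (auto simp: fun_eq_iff complex_eq_iff)
  then have "L \<phi> = L (\<lambda>x. of_real (Re (\<phi> x))) + L (\<lambda>x. \<i> * of_real (Im (\<phi> x)))"
    using add r i bounded_borel_mult[OF bounded_borel_const] by metis
  then show ?thesis
    using r i scale by auto
qed

lemma vanishes_of_multiplicative_family:
  assumes G: "\<And>g. g \<in> G \<Longrightarrow> continuous_on K g" "(\<lambda>x. 1) \<in> G"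
      "\<And>f g. f \<in> G \<Longrightarrow> g \<in> G \<Longrightarrow> (\<lambda>x. f x * g x) \<in> G"
      "\<And>g. g \<in> G \<Longrightarrow> (\<lambda>x. cnj (g x)) \<in> G"
      "\<And>x y. x \<in> K \<Longrightarrow> y \<in> K \<Longrightarrow> x \<noteq> y \<Longrightarrow> \<exists>g\<in>G. g x \<noteq> g y"
    and L: "\<And>g. g \<in> G \<Longrightarrow> L (\<lambda>x. indicator K x * g x) = 0"
    and \<phi>: "\<phi> \<in> bounded_borel"
  shows "L \<phi> = 0"
proof (rule vanishes_on_bounded_borel[OF _ \<phi>])
  fix f :: "'a \<Rightarrow> real" assume f: "continuous_on K f"
  \<comment> \<open>The real functions that multiply \<open>E\<close> into itself form a ring to which Stone-Weierstrass
    applies, although \<open>G\<close> itself is neither real nor closed under addition.\<close>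
  define E where "E = {h. continuous_on K h \<and> (\<forall>g\<in>G. L (\<lambda>x. indicator K x * (h x * g x)) = 0)}"
  define R where "R = {f :: 'a \<Rightarrow> real. continuous_on K f \<and> (\<forall>h\<in>E. (\<lambda>x. of_real (f x) * h x) \<in> E)}"
  have E_add: "(\<lambda>x. h x + k x) \<in> E" if "h \<in> E" "k \<in> E" for h k
  proof -
    have "L (\<lambda>x. indicator K x * ((h x + k x) * g x)) = 0" if g: "g \<in> G" for g
    proof -
      have "L (\<lambda>x. indicator K x * (h x * g x) + indicator K x * (k x * g x)) = 0"
        using \<open>h \<in> E\<close> \<open>k \<in> E\<close> G(1)[OF g] g
        by (subst add) (auto simp: E_def intro!: bounded_borel_restrict[OF compact] continuous_intros)
      then show ?thesis by (simp add: algebra_simps)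
    qed
    then show ?thesis using that by (auto simp: E_def intro!: continuous_intros)
  qed
  have E_scale: "(\<lambda>x. c * h x) \<in> E" if "h \<in> E" for h c
  proof -
    have "L (\<lambda>x. indicator K x * ((c * h x) * g x)) = 0" if g: "g \<in> G" for g
    proof -
      have "L (\<lambda>x. c * (indicator K x * (h x * g x))) = 0"
        using \<open>h \<in> E\<close> G(1)[OF g] g
        by (subst scale) (auto simp: E_def intro!: bounded_borel_restrict[OF compact] continuous_intros)
      then show ?thesis by (simp add: algebra_simps)
    qed
    then show ?thesis using that by (auto simp: E_def intro!: continuous_intros)
  qed
  have E_G: "(\<lambda>x. g x * h x) \<in> E" if "h \<in> E" "g \<in> G" for h g
  proof -
    have "L (\<lambda>x. indicator K x * ((g x * h x) * g' x)) = 0" if g': "g' \<in> G" for g'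
      using \<open>h \<in> E\<close> G(3)[OF \<open>g \<in> G\<close> g'] by (auto simp: E_def algebra_simps)
    then show ?thesis using that G(1) by (auto simp: E_def intro!: continuous_intros)
  qed
  \<comment> \<open>\<open>E\<close> is a linear space stable under multiplication by
    \<open>g\<close> and by \<open>cnj g\<close>, hence under multiplication by their combinations
    Re g and Im g.\<close>
  have ReIm: "(\<lambda>x. Re (g x)) \<in> R \<and> (\<lambda>x. Im (g x)) \<in> R" if g: "g \<in> G" for g
  proof -
    have "(\<lambda>x. of_real (Re (g x)) * h x) \<in> E" if "h \<in> E" for h
    proof -
      have "(\<lambda>x. (1/2) * (g x * h x + cnj (g x) * h x)) \<in> E"
        by (intro E_scale E_add E_G that g G(4))
      moreover have "(\<lambda>x. (1/2) * (g x * h x + cnj (g x) * h x)) = (\<lambda>x. of_real (Re (g x)) * h x)"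
        by (simp add: distrib_right[symmetric] complex_add_cnj)
      ultimately show ?thesis by simp
    qed
    moreover have "(\<lambda>x. of_real (Im (g x)) * h x) \<in> E" if "h \<in> E" for h
    proof -
      have "(\<lambda>x. (- \<i>/2) * (g x * h x + (- 1) * (cnj (g x) * h x))) \<in> E"
        by (intro E_scale E_add E_G that g G(4))
      moreover have "(\<lambda>x. (- \<i>/2) * (g x * h x + (- 1) * (cnj (g x) * h x))) = (\<lambda>x. of_real (Im (g x)) * h x)"
        by (simp add: fun_eq_iff complex_eq_iff field_simps)
      ultimately show ?thesis by simp
    qed
    ultimately show ?thesis
      using G(1)[OF g] by (auto simp: R_def intro!: continuous_intros)
  qed
  have ring: "function_ring_on R K"
  proof
    show "continuous_on K f" if "f \<in> R" for f using that by (simp add: R_def)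
    show "(\<lambda>x. f x + g x) \<in> R" if "f \<in> R" "g \<in> R" for f g
      using that E_add by (auto simp: R_def distrib_right intro!: continuous_intros)
    show "(\<lambda>x. f x * g x) \<in> R" if "f \<in> R" "g \<in> R" for f g
      using that by (auto simp: R_def mult.assoc intro!: continuous_intros)
    show "(\<lambda>_. c) \<in> R" for c using E_scale by (auto simp: R_def)
    show "\<exists>f\<in>R. f x \<noteq> f y" if xy: "x \<in> K" "y \<in> K" "x \<noteq> y" for x y
    proof -
      obtain g where "g \<in> G" "g x \<noteq> g y" using G(5)[OF xy] by blast
      then show ?thesis using ReIm[of g] by (metis complex_eqI)
    qed
  qed (rule compact)
  have one: "(\<lambda>x. 1) \<in> E" using L by (auto simp: E_def)
  have R0: "L (\<lambda>x. indicator K x * of_real (f x)) = 0" if "f \<in> R" for f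
  proof -
    have "(\<lambda>x. of_real (f x) * 1) \<in> E"
      using that one unfolding R_def mem_Collect_eq by (elim conjE bspec)
    then show ?thesis using G(2) by (force simp: E_def)
  qed
  have "\<exists>g\<in>R. \<forall>x\<in>K. \<bar>f x - g x\<bar> < 1 / real (Suc n)" for n
    by (rule function_ring_on.Stone_Weierstrass_basic[OF ring f]) simp
  then obtain g where g: "\<And>n. g n \<in> R" "\<And>n x. x \<in> K \<Longrightarrow> \<bar>f x - g n x\<bar> < 1 / real (Suc n)"
    by metis
  obtain B where B: "\<And>x. x \<in> K \<Longrightarrow> \<bar>f x\<bar> \<le> B"
    using compact_imp_bounded[OF compact_continuous_image[OF f compact]] by (auto simp: bounded_iff)
  have cg: "continuous_on K (g n)" for n using g(1) by (simp add: R_def)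
  have "(\<lambda>n. L (\<lambda>x. indicator K x * of_real (g n x))) \<longlonglongrightarrow> L (\<lambda>x. indicator K x * of_real (f x))"
  proof (rule conv[where B = "\<bar>B\<bar> + 1"])
    show "(\<lambda>x. indicator K x * complex_of_real (g n x)) \<in> bounded_borel" for n
      by (intro bounded_borel_restrict compact continuous_intros cg)
    show "(\<lambda>x. indicator K x * complex_of_real (f x)) \<in> bounded_borel"
      by (intro bounded_borel_restrict compact continuous_intros f)
    show "norm (indicator K x * complex_of_real (g n x)) \<le> \<bar>B\<bar> + 1" for n x
    proof (cases "x \<in> K")
      case True
      have "1 / real (Suc n) \<le> 1" by simp
      then have "\<bar>g n x\<bar> \<le> \<bar>B\<bar> + 1"
        using B[OF True] g(2)[OF True, of n] by linarith
      then show ?thesis using True by simp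
    qed auto
    show "(\<lambda>n. indicator K x * complex_of_real (g n x)) \<longlonglongrightarrow> indicator K x * complex_of_real (f x)" for x
    proof (cases "x \<in> K")
      case True
      have "(\<lambda>n. g n x) \<longlonglongrightarrow> f x"
      proof (rule LIMSEQ_I)
        fix e :: real assume "e > 0"
        then obtain N where "1 / real (Suc N) < e"
          using nat_approx_posE by blast
        moreover have "1 / real (Suc n) \<le> 1 / real (Suc N)" if "n \<ge> N" for n
          using that by (simp add: frac_le)
        ultimately have "\<bar>f x - g n x\<bar> < e" if "n \<ge> N" for n
          using g(2)[OF True, of n] that by (meson less_le_trans less_trans)
        then show "\<exists>N. \<forall>n\<ge>N. norm (g n x - f x) < e"
          by (auto simp: abs_minus_commute)
      qed
      then show ?thesis by (intro tendsto_intros)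
    qed auto
  qed
  then show "L (\<lambda>x. indicator K x * of_real (f x)) = 0"
    using R0[OF g(1)] by (simp add: LIMSEQ_const_iff)
qed

end

section \<open>Half-integer Fourier series and marginals\<close>

text \<open>The complex measure behind this functional is the image under \<open>Y\<close> of the
  measure with density \<open>F\<close>; bounded convergence is dominated convergence with a
  multiple of |F|.\<close>

lemma integral_bounded_convergence_functional:
  fixes F :: "'b \<Rightarrow> complex" and Y :: "'b \<Rightarrow> 'a::euclidean_space"
  assumes F: "integrable N F" and Y[measurable]: "Y \<in> borel_measurable N"
    and K: "compact K" "AE x in N. F x \<noteq> 0 \<longrightarrow> Y x \<in> K"
  shows "bounded_convergence_functional (\<lambda>\<phi>. LINT x|N. F x * \<phi> (Y x)) K"
proof
  have [measurable]: "F \<in> borel_measurable N" using F by simp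
  have m: "(\<lambda>x. f (Y x)) \<in> borel_measurable N" if "f \<in> bounded_borel" for f
    using that by (auto intro: measurable_compose[OF Y] simp: bounded_borel_def)
  have i: "integrable N (\<lambda>x. F x * f (Y x))" if f: "f \<in> bounded_borel" for f
  proof -
    obtain B where B: "\<And>x. norm (f x) \<le> B" using f by (auto simp: bounded_borel_def)
    show ?thesis
    proof (rule Bochner_Integration.integrable_bound)
      show "integrable N (\<lambda>x. B * norm (F x))" using F by simp
      show "AE x in N. norm (F x * f (Y x)) \<le> norm (B * norm (F x))"
        using B order_trans[OF norm_ge_zero B]
        by (auto simp: norm_mult mult.commute[of "norm (F _)"] intro!: mult_right_mono)
    qed (use m[OF f] in measurable)
  qed
  show "compact K" by (rule K(1))
  show "(LINT x|N. F x * (f (Y x) + g (Y x))) = (LINT x|N. F x * f (Y x)) + (LINT x|N. F x * g (Y x))"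
    if "f \<in> bounded_borel" "g \<in> bounded_borel" for f g
    using i[OF that(1)] i[OF that(2)] by (simp add: distrib_left)
  show "(LINT x|N. F x * (c * f (Y x))) = c * (LINT x|N. F x * f (Y x))"
    if "f \<in> bounded_borel" for f c
    using i[OF that] by (simp add: mult.left_commute)
  show "(LINT x|N. F x * f (Y x)) = (LINT x|N. F x * g (Y x))"
    if "f \<in> bounded_borel" "g \<in> bounded_borel" "\<And>x. x \<in> K \<Longrightarrow> f x = g x" for f g
  proof (rule integral_cong_AE)
    show "AE x in N. F x * f (Y x) = F x * g (Y x)"
      using K(2) by eventually_elim (use that(3) in auto)
  qed (use i[OF that(1)] i[OF that(2)] in auto)
  show "(\<lambda>n. LINT x|N. F x * G n (Y x)) \<longlonglongrightarrow> (LINT x|N. F x * f (Y x))"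
    if "\<And>n. G n \<in> bounded_borel" "f \<in> bounded_borel" "\<And>n x. norm (G n x) \<le> B"
      "\<And>x. (\<lambda>n. G n x) \<longlonglongrightarrow> f x" for G f B
  proof (rule integral_dominated_convergence[where w = "\<lambda>x. B * norm (F x)"])
    show "AE x in N. norm (F x * G n (Y x)) \<le> B * norm (F x)" for n
      using that(3) by (auto simp: norm_mult mult.commute[of "norm (F _)"] intro!: mult_right_mono)
    show "AE x in N. (\<lambda>n. F x * G n (Y x)) \<longlonglongrightarrow> F x * f (Y x)"
      by (intro AE_I2 tendsto_intros that)
  qed (use i[OF that(1)] i[OF that(2)] F in auto)
qed

lemma bounded_convergence_functional_diff:
  assumes "bounded_convergence_functional L K" and "bounded_convergence_functional L' K"
  shows "bounded_convergence_functional (\<lambda>\<phi>. L \<phi> - L' \<phi>) K"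
proof -
  interpret A: bounded_convergence_functional L K by (rule assms)
  interpret B: bounded_convergence_functional L' K by (rule assms)
  show ?thesis
  proof
    show "(\<lambda>n. L (F n) - L' (F n)) \<longlonglongrightarrow> L f - L' f"
      if "\<And>n. F n \<in> bounded_borel" "f \<in> bounded_borel" "\<And>n x. norm (F n x) \<le> C"
        "\<And>x. (\<lambda>n. F n x) \<longlonglongrightarrow> f x" for F f C
      by (intro tendsto_diff A.conv[OF that] B.conv[OF that])
    show "L f - L' f = L g - L' g"
      if "f \<in> bounded_borel" "g \<in> bounded_borel" "\<And>x. x \<in> K \<Longrightarrow> f x = g x" for f g
      using A.local[OF that] B.local[OF that] by simp
  qed (auto simp: A.compact A.add B.add A.scale B.scale algebra_simps)
qed

section \<open>Orthogonality of characters and a Borel inverse of \<open>cis\<close>\<close>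

lemma integral_cis_period:
  fixes \<epsilon> :: real and j :: int
  assumes \<epsilon>: "\<epsilon> > 0"
  shows "integral\<^sup>L (lebesgue_on {- pi / \<epsilon>..pi / \<epsilon>}) (\<lambda>y. cis (\<epsilon> * of_int j * y)) = (if j = 0 then 2 * pi / \<epsilon> else 0)"
proof -
  let ?I = "{- pi / \<epsilon>..pi / \<epsilon>}"
  have c: "continuous_on ?I (\<lambda>y. cis (\<epsilon> * of_int j * y))"
    by (intro continuous_intros)
  have "- pi / \<epsilon> \<le> pi / \<epsilon>" using \<epsilon> by (simp add: divide_le_cancel)
  have eq: "integral\<^sup>L (lebesgue_on ?I) (\<lambda>y. cis (\<epsilon> * of_int j * y)) = integral ?I (\<lambda>y. cis (\<epsilon> * of_int j * y))"
    by (rule lebesgue_integral_eq_integral[OF continuous_imp_integrable_real[OF c]]) simp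
  show ?thesis
  proof (cases "j = 0")
    case True
    then show ?thesis unfolding eq using \<open>- pi / \<epsilon> \<le> pi / \<epsilon>\<close> by (simp add: scaleR_conv_of_real field_simps)
  next
    case False
    define a where "a = \<epsilon> * of_int j"
    have "a \<noteq> 0" using False \<epsilon> by (simp add: a_def)
    have "((\<lambda>y. cis (a * y)) has_integral (cis (a * (pi / \<epsilon>)) / (\<i> * of_real a) - cis (a * (- pi / \<epsilon>)) / (\<i> * of_real a))) ?I"
    proof (rule fundamental_theorem_of_calculus[OF \<open>- pi / \<epsilon> \<le> pi / \<epsilon>\<close>])
      fix y
      have "((\<lambda>z. exp (\<i> * of_real a * z) / (\<i> * of_real a)) has_field_derivative exp (\<i> * of_real a * of_real y)) (at (of_real y))"
        using \<open>a \<noteq> 0\<close> by (auto intro!: derivative_eq_intros)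
      from has_vector_derivative_real_field[OF this]
      show "((\<lambda>y. cis (a * y) / (\<i> * of_real a)) has_vector_derivative cis (a * y)) (at y within ?I)"
        by (simp add: cis_conv_exp mult.assoc)
    qed
    moreover have "cis (a * (pi / \<epsilon>)) = cis (a * (- pi / \<epsilon>))"
    proof -
      have "a * (pi / \<epsilon>) = of_int j * pi" "a * (- pi / \<epsilon>) = - (of_int j * pi)"
        using \<epsilon> by (auto simp: a_def)
      moreover have "sin (of_int j * pi) = 0" by (simp add: sin_zero_iff_int2)
      ultimately show ?thesis by (simp add: cis_def complex_eq_iff)
    qed
    ultimately show ?thesis unfolding eq using False by (simp add: a_def[symmetric] integral_unique)
  qed
qed

text \<open>\<open>Arg\<close> is continuous only off the closed negative half-axis. Setting it to 0
  there yields a Borel function on the whole plane that still inverts \<open>cis\<close> on the open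
  interval (-pi, pi).\<close>

definition slit_arg :: "complex \<Rightarrow> real" where
  "slit_arg z = indicator (- \<real>\<^sub>\<le>\<^sub>0) z * Arg z"

lemma slit_arg_measurable [measurable]: "slit_arg \<in> borel_measurable borel"
proof -
  have "(\<lambda>z. indicator (- \<real>\<^sub>\<le>\<^sub>0) z *\<^sub>R Arg z) \<in> borel_measurable borel"
    by (rule borel_measurable_continuous_on_indicator[OF _ continuous_on_Arg]) simp
  then show ?thesis by (simp add: slit_arg_def[abs_def])
qed

lemma slit_arg_cis: "\<bar>x\<bar> < pi \<Longrightarrow> slit_arg (cis x) = x"
proof -
  assume x: "\<bar>x\<bar> < pi"
  then have A: "Arg (cis x) = x" by (intro Arg_cis) auto
  have "cis x \<notin> \<real>\<^sub>\<le>\<^sub>0"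
  proof
    assume "cis x \<in> \<real>\<^sub>\<le>\<^sub>0"
    then have "cis x \<in> \<real> \<and> Re (cis x) < 0 \<or> cis x = 0"
      by (auto simp: complex_nonpos_Reals_iff complex_is_Real_iff complex_eq_iff)
    then have "Arg (cis x) = pi" using Arg_eq_pi[of "cis x"] by (auto simp: complex_is_Real_iff)
    then show False using A x by simp
  qed
  then show ?thesis using A by (simp add: slit_arg_def)
qed

text \<open>
  Half-integer frequencies, i.e. antiperiodic Fourier series with period \<open>2 \<pi> / \<epsilon>\<close>, avoid the
  frequency \<open>0\<close>, at which the conjugated operator is resonant. For real functions the negative
  frequencies are redundant.
\<close>

definition half_freq :: "real \<Rightarrow> nat \<Rightarrow> real" where
  "half_freq \<epsilon> k = \<epsilon> * (real k + 1 / 2)"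

text \<open>The factor is the inverse period \<epsilon> / (2 pi), doubled because each term stands
  for the frequencies plus and minus \<open>half_freq \<epsilon> k\<close> together.\<close>

definition half_series :: "real \<Rightarrow> (nat \<Rightarrow> complex) \<Rightarrow> real \<Rightarrow> real" where
  "half_series \<epsilon> c y = \<epsilon> / pi * (\<Sum>k. Re (c k * cis (half_freq \<epsilon> k * y)))"

section \<open>Series with summable coefficients\<close>

context
  fixes \<epsilon> :: real and c :: "nat \<Rightarrow> complex"
  assumes \<epsilon>: "\<epsilon> > 0" and c: "summable (\<lambda>k. norm (c k))"
begin

lemma half_series_summable: "summable (\<lambda>k. norm (Re (c k * cis (half_freq \<epsilon> k * y))))"
  by (rule summable_comparison_test'[OF c, of 0])
    (use abs_Re_le_cmod[of "c _ * cis (half_freq \<epsilon> _ * y)"] in \<open>auto simp: norm_mult\<close>)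

lemma abs_half_series_le: "\<bar>half_series \<epsilon> c y\<bar> \<le> \<epsilon> / pi * (\<Sum>k. norm (c k))"
proof -
  have "\<bar>\<Sum>k. Re (c k * cis (half_freq \<epsilon> k * y))\<bar> \<le> (\<Sum>k. \<bar>Re (c k * cis (half_freq \<epsilon> k * y))\<bar>)"
    by (rule summable_rabs) (use half_series_summable in simp)
  also have "\<dots> \<le> (\<Sum>k. norm (c k))"
    using half_series_summable[of y] c abs_Re_le_cmod[of "c _ * cis (half_freq \<epsilon> _ * y)"]
    by (intro suminf_le) (auto simp: norm_mult)
  finally have "\<epsilon> / pi * \<bar>\<Sum>k. Re (c k * cis (half_freq \<epsilon> k * y))\<bar> \<le> \<epsilon> / pi * (\<Sum>k. norm (c k))"
    using \<epsilon> by (intro mult_left_mono) auto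
  then show ?thesis using \<epsilon> unfolding half_series_def abs_mult by simp
qed

lemma half_series_measurable [measurable]: "half_series \<epsilon> c \<in> borel_measurable borel"
proof -
  have "(\<lambda>y. Re (c k * cis (half_freq \<epsilon> k * y))) \<in> borel_measurable borel" for k
    by (intro borel_measurable_continuous_onI continuous_intros)
  then show ?thesis unfolding half_series_def[abs_def] by measurable
qed

text \<open>Absolute summability permits termwise integration, and orthogonality leaves a single
  term.\<close>

lemma half_series_coefficient:
  "integral\<^sup>L (lebesgue_on {- pi / \<epsilon>..pi / \<epsilon>}) (\<lambda>y. half_series \<epsilon> c y * cis (- (half_freq \<epsilon> m * y))) = c m"
proof -
  let ?N = "lebesgue_on {- pi / \<epsilon>..pi / \<epsilon>}"
  define f where "f k y = \<epsilon> / pi * Re (c k * cis (half_freq \<epsilon> k * y)) * cis (- (half_freq \<epsilon> m * y))" for k y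
  have int: "integrable ?N (f k)" for k
    unfolding f_def by (intro continuous_imp_integrable_real continuous_intros)
  interpret N: finite_measure ?N
    by (rule finite_measure_lebesgue_on) (simp add: fmeasurable_compact)
  have fle: "norm (f k y) \<le> \<epsilon> / pi * norm (c k)" for k y
  proof -
    have "norm (f k y) = \<epsilon> / pi * \<bar>Re (c k * cis (half_freq \<epsilon> k * y))\<bar>"
      using \<epsilon> by (simp only: f_def norm_mult norm_of_real abs_mult norm_cis mult_1_right) simp
    also have "\<dots> \<le> \<epsilon> / pi * norm (c k)"
      using abs_Re_le_cmod[of "c k * cis (half_freq \<epsilon> k * y)"] \<epsilon>
      by (intro mult_left_mono) (simp_all add: norm_mult)
    finally show ?thesis .
  qed
  have val: "integral\<^sup>L ?N (f k) = (if k = m then c m else 0)" for k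
  proof -
    have ci: "integrable ?N (\<lambda>y. cis (\<epsilon> * of_int j * y))" for j :: int
      by (intro continuous_imp_integrable_real continuous_intros)
    \<comment> \<open>Splitting the real part produces the integer frequencies k - m and -(k + m +
      1). The second is never 0, so the conjugate half integrates to 0 and only k = m
      contributes.\<close>
    have "f k y = \<epsilon> / (2 * pi) * c k * cis (\<epsilon> * of_int (int k - int m) * y)
          + \<epsilon> / (2 * pi) * cnj (c k) * cis (\<epsilon> * of_int (- (int k + int m + 1)) * y)" for y
    proof -
      define g where "g = c k * cis (half_freq \<epsilon> k * y)"
      have "f k y = \<epsilon> / pi * ((g + cnj g) / 2) * cis (- (half_freq \<epsilon> m * y))"
        unfolding f_def g_def[symmetric] complex_add_cnj by simp
      also have "\<dots> = \<epsilon> / (2 * pi) * c k * (cis (half_freq \<epsilon> k * y) * cis (- (half_freq \<epsilon> m * y)))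
         + \<epsilon> / (2 * pi) * cnj (c k) * (cis (- (half_freq \<epsilon> k * y)) * cis (- (half_freq \<epsilon> m * y)))"
        by (simp add: g_def cis_cnj field_simps)
      also have "cis (half_freq \<epsilon> k * y) * cis (- (half_freq \<epsilon> m * y)) = cis (\<epsilon> * of_int (int k - int m) * y)"
        unfolding cis_mult by (rule arg_cong[of _ _ cis]) (simp add: half_freq_def algebra_simps)
      also have "cis (- (half_freq \<epsilon> k * y)) * cis (- (half_freq \<epsilon> m * y))
          = cis (\<epsilon> * of_int (- (int k + int m + 1)) * y)"
        unfolding cis_mult by (rule arg_cong[of _ _ cis]) (simp add: half_freq_def algebra_simps)
      finally show ?thesis .
    qed
    then have fk: "f k = (\<lambda>y. \<epsilon> / (2 * pi) * c k * cis (\<epsilon> * of_int (int k - int m) * y)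
          + \<epsilon> / (2 * pi) * cnj (c k) * cis (\<epsilon> * of_int (- (int k + int m + 1)) * y))"
      by (rule ext)
    have "integral\<^sup>L ?N (f k) = \<epsilon> / (2 * pi) * c k * (LINT y|?N. cis (\<epsilon> * of_int (int k - int m) * y))
          + \<epsilon> / (2 * pi) * cnj (c k) * (LINT y|?N. cis (\<epsilon> * of_int (- (int k + int m + 1)) * y))"
      unfolding fk by (simp only: Bochner_Integration.integral_add
        Bochner_Integration.integrable_mult_right Bochner_Integration.integral_mult_right ci)
    also have "\<dots> = (if k = m then c m else 0)"
      unfolding integral_cis_period[OF \<epsilon>] using \<epsilon> by auto
    finally show ?thesis .
  qed
  have sf: "summable (\<lambda>k. norm (f k y))" for y
    by (rule summable_comparison_test'[OF summable_mult[OF c, of "\<epsilon> / pi"], of 0]) (use fle in auto)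
  have "(\<lambda>k. integral\<^sup>L ?N (f k)) sums (LINT y|?N. (\<Sum>k. f k y))"
  proof (rule sums_integral[OF int])
    show "AE y in ?N. summable (\<lambda>k. norm (f k y))" using sf by auto
    have "norm (LINT y|?N. norm (f k y)) \<le> measure ?N (space ?N) * (\<epsilon> / pi) * norm (c k)" for k
    proof -
      have "(LINT y|?N. norm (f k y)) \<le> (LINT y|?N. \<epsilon> / pi * norm (c k))"
        using int fle by (intro integral_mono) auto
      then show ?thesis by (simp add: mult_ac)
    qed
    then show "summable (\<lambda>k. LINT y|?N. norm (f k y))"
      by (rule summable_comparison_test'[OF summable_mult[OF c], of 0])
  qed
  moreover have "(\<Sum>k. f k y) = half_series \<epsilon> c y * cis (- (half_freq \<epsilon> m * y))" for y
  proof -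
    have "summable (\<lambda>k. Re (c k * cis (half_freq \<epsilon> k * y)))"
      using half_series_summable by (rule summable_norm_cancel)
    then have "(\<lambda>k. Re (c k * cis (half_freq \<epsilon> k * y))) sums (\<Sum>k. Re (c k * cis (half_freq \<epsilon> k * y)))"
      by (rule summable_sums)
    then have "(\<lambda>k. complex_of_real (\<epsilon> / pi * Re (c k * cis (half_freq \<epsilon> k * y)))) sums of_real (half_series \<epsilon> c y)"
      unfolding half_series_def by (intro sums_of_real sums_mult)
    then have "(\<lambda>k. complex_of_real (\<epsilon> / pi * Re (c k * cis (half_freq \<epsilon> k * y))) * cis (- (half_freq \<epsilon> m * y)))
      sums (of_real (half_series \<epsilon> c y) * cis (- (half_freq \<epsilon> m * y)))"
      by (rule sums_mult2)
    then show ?thesis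
      unfolding f_def by (intro sums_unique[symmetric]) simp
  qed
  moreover have "(\<lambda>k. integral\<^sup>L ?N (f k)) sums c m"
    unfolding val using sums_If_finite_set[of "{m}" "\<lambda>_. c m"] by (simp add: if_distrib eq_commute)
  ultimately show ?thesis
    using sums_unique2 by fastforce
qed


text \<open>Uniqueness of Fourier coefficients for measures: the image of W under X and the measure
  with density \<open>half_series\<close> have the same half-integer coefficients. Both are carried
  to the unit circle, where the difference functional kills all monomials in z and its conjugate and
  hence every bounded Borel function.\<close>

lemma marginal_eq_half_series:
  fixes W X :: "'b \<Rightarrow> real" and \<phi> :: "real \<Rightarrow> complex"
  assumes W: "integrable M W" and X[measurable]: "X \<in> borel_measurable M"
    and supp: "AE x in M. W x \<noteq> 0 \<longrightarrow> \<bar>X x\<bar> < pi / \<epsilon>"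
    and coeff: "\<And>k. (LINT x|M. W x * cis (- (half_freq \<epsilon> k * X x))) = c k"
    and \<phi>: "\<phi> \<in> bounded_borel"
  shows "(LINT x|M. W x * \<phi> (X x)) = integral\<^sup>L (lebesgue_on {- pi / \<epsilon>..pi / \<epsilon>}) (\<lambda>y. half_series \<epsilon> c y * \<phi> y)"
proof -
  let ?I = "{- pi / \<epsilon>..pi / \<epsilon>}"
  let ?N = "lebesgue_on ?I"
  interpret N: finite_measure ?N
    by (rule finite_measure_lebesgue_on) (simp add: fmeasurable_compact)
  have mN: "f \<in> borel_measurable ?N" if "f \<in> borel_measurable borel" for f :: "real \<Rightarrow> 'z::topological_space"
    using that by (intro measurable_restrict_space1 measurable_completion) simp
  have hint: "integrable ?N (half_series \<epsilon> c)"
    using abs_half_series_le by (intro N.integrable_const_bound[where B = "\<epsilon> / pi * (\<Sum>k. norm (c k))"] mN half_series_measurable) auto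
  have twist: "integrable P (\<lambda>x. of_real (f x) * cis (g x))" 
    if f: "integrable P f" and g: "g \<in> borel_measurable P" for P :: "'z measure" and f g :: "'z \<Rightarrow> real"
  proof (rule Bochner_Integration.integrable_bound[OF f])
    have [measurable]: "cis \<in> borel_measurable borel"
      by (intro borel_measurable_continuous_onI continuous_intros)
    show "(\<lambda>x. of_real (f x) * cis (g x)) \<in> borel_measurable P"
      using f g by measurable
  qed (auto simp: norm_mult)
  have [measurable]: "cis \<in> borel_measurable borel"
    by (intro borel_measurable_continuous_onI continuous_intros)
  \<comment> \<open>The twist by half a frequency step moves half-integer frequencies to integer
    ones, so that the remaining factors are well-defined functions of
    \<open>cis (\<epsilon> * y)\<close>.\<close>
  define F where "F x = of_real (W x) * cis (- (\<epsilon> / 2 * X x))" for x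
  define H where "H y = of_real (half_series \<epsilon> c y) * cis (- (\<epsilon> / 2 * y))" for y
  define L where "L \<psi> = (LINT x|M. F x * \<psi> (cis (\<epsilon> * X x))) - (LINT y|?N. H y * \<psi> (cis (\<epsilon> * y)))" for \<psi>
  have F: "integrable M F" unfolding F_def by (rule twist[OF W]) simp
  have H: "integrable ?N H" unfolding H_def by (rule twist[OF hint]) (rule mN, measurable)
  have Ym: "(\<lambda>y. cis (\<epsilon> * y)) \<in> borel_measurable ?N" by (rule mN) measurable
  have Xm: "(\<lambda>x. cis (\<epsilon> * X x)) \<in> borel_measurable M" by measurable
  interpret bounded_convergence_functional L "sphere 0 1"
    unfolding L_def
    by (intro bounded_convergence_functional_diff integral_bounded_convergence_functional F H Ym Xm) auto
  have coeff': "(LINT x|M. W x * cis (half_freq \<epsilon> k * X x)) = cnj (c k)" for k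
  proof -
    have "cnj (c k) = (LINT x|M. cnj (W x * cis (- (half_freq \<epsilon> k * X x))))"
      unfolding coeff[symmetric] by (rule Bochner_Integration.integral_cnj[symmetric])
    then show ?thesis by (simp add: cis_cnj)
  qed
  have hcoeff': "(LINT y|?N. half_series \<epsilon> c y * cis (half_freq \<epsilon> k * y)) = cnj (c k)" for k
  proof -
    have "cnj (LINT y|?N. half_series \<epsilon> c y * cis (- (half_freq \<epsilon> k * y))) = (LINT y|?N. cnj (half_series \<epsilon> c y * cis (- (half_freq \<epsilon> k * y))))"
      by (rule Bochner_Integration.integral_cnj[symmetric])
    then show ?thesis unfolding half_series_coefficient by (simp add: cis_cnj)
  qed
  \<comment> \<open>The numbers j - 1/2 run through all half-integers: j \<le> 0 gives the
    prescribed coefficients, and j > 0 their conjugates, because W and the series are real.\<close>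
  have key: "(LINT x|M. W x * cis (\<epsilon> * (of_int j - 1 / 2) * X x)) = (LINT y|?N. half_series \<epsilon> c y * cis (\<epsilon> * (of_int j - 1 / 2) * y))" for j :: int
  proof (cases "j \<le> 0")
    case True
    then have "\<epsilon> * (of_int j - 1 / 2) = - half_freq \<epsilon> (nat (- j))"
      by (simp add: half_freq_def algebra_simps)
    then show ?thesis using coeff[of "nat (- j)"] half_series_coefficient[of "nat (- j)"] by simp
  next
    case False
    then have "\<epsilon> * (of_int j - 1 / 2) = half_freq \<epsilon> (nat (j - 1))"
      by (simp add: half_freq_def algebra_simps)
    then show ?thesis using coeff'[of "nat (j - 1)"] hcoeff'[of "nat (j - 1)"] by simp
  qed
  \<comment> \<open>Pulled back from the circle, \<psi> undoes both the twist and the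
    parametrisation and returns \<phi>, except at the endpoints of the period interval.\<close>
  define \<psi> where "\<psi> z = cis (slit_arg z / 2) * \<phi> (slit_arg z / \<epsilon>)" for z
  have \<psi>_cis: "cis (- (\<epsilon> / 2 * y)) * \<psi> (cis (\<epsilon> * y)) = \<phi> y" if "\<bar>y\<bar> < pi / \<epsilon>" for y
  proof -
    have "\<bar>\<epsilon> * y\<bar> < pi" using that \<epsilon> by (simp add: abs_mult field_simps)
    then have "slit_arg (cis (\<epsilon> * y)) = \<epsilon> * y" by (rule slit_arg_cis)
    then have "cis (- (\<epsilon> / 2 * y)) * \<psi> (cis (\<epsilon> * y)) = (cis (- (\<epsilon> / 2 * y)) * cis (\<epsilon> / 2 * y)) * \<phi> y"
      using \<epsilon> by (simp add: \<psi>_def)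
    then show ?thesis by (simp add: cis_mult)
  qed
  have \<phi>m[measurable]: "\<phi> \<in> borel_measurable borel" using \<phi> by (simp add: bounded_borel_def)
  have \<psi>m[measurable]: "\<psi> \<in> borel_measurable borel" unfolding \<psi>_def by measurable
  have "\<psi> \<in> bounded_borel"
    using \<phi> \<psi>m by (auto simp: bounded_borel_def \<psi>_def norm_mult)
  then have "L \<psi> = 0"
  proof (rule vanishes_of_multiplicative_family[where G = "{g. \<exists>m n. g = (\<lambda>z. z ^ m * cnj z ^ n)}", rotated -1])
    show "L (\<lambda>x. indicator (sphere 0 1) x * g x) = 0"
      if "g \<in> {g. \<exists>m n. g = (\<lambda>z. z ^ m * cnj z ^ n)}" for g
    proof -
      from that obtain m n where g: "g = (\<lambda>z. z ^ m * cnj z ^ n)" by auto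
      have e: "cis (- (\<epsilon> / 2 * y)) * (cis (\<epsilon> * y) ^ m * cnj (cis (\<epsilon> * y)) ^ n)
          = cis (\<epsilon> * (of_int (int m - int n) - 1 / 2) * y)" for y
        unfolding cis_cnj Complex.DeMoivre cis_mult by (rule arg_cong[of _ _ cis]) (simp add: algebra_simps)
      have "L (\<lambda>x. indicator (sphere 0 1) x * g x)
         = (LINT x|M. W x * cis (\<epsilon> * (of_int (int m - int n) - 1 / 2) * X x))
         - (LINT y|?N. half_series \<epsilon> c y * cis (\<epsilon> * (of_int (int m - int n) - 1 / 2) * y))"
        unfolding L_def F_def H_def g e[symmetric] by (simp add: mult.assoc)
      then show ?thesis unfolding key by simp
    qed
    show "(\<lambda>x. f x * g x) \<in> {g. \<exists>m n. g = (\<lambda>z. z ^ m * cnj z ^ n)}"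
      if "f \<in> {g. \<exists>m n. g = (\<lambda>z. z ^ m * cnj z ^ n)}" "g \<in> {g. \<exists>m n. g = (\<lambda>z. z ^ m * cnj z ^ n)}"
      for f g :: "complex \<Rightarrow> complex"
    proof -
      from that obtain m n m' n' where "f = (\<lambda>z. z ^ m * cnj z ^ n)" "g = (\<lambda>z. z ^ m' * cnj z ^ n')" by auto
      then have "(\<lambda>x. f x * g x) = (\<lambda>z. z ^ (m + m') * cnj z ^ (n + n'))"
        by (auto simp: power_add mult_ac)
      then show ?thesis by blast
    qed
    show "(\<lambda>x. 1) \<in> {g. \<exists>m n. g = (\<lambda>z::complex. z ^ m * cnj z ^ n)}"
      by (auto intro!: exI[of _ 0])
    show "(\<lambda>x. cnj (g x)) \<in> {g. \<exists>m n. g = (\<lambda>z. z ^ m * cnj z ^ n)}"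
      if "g \<in> {g. \<exists>m n. g = (\<lambda>z. z ^ m * cnj z ^ n)}" for g
    proof -
      from that obtain m n where "g = (\<lambda>z. z ^ m * cnj z ^ n)" by auto
      then have "(\<lambda>x. cnj (g x)) = (\<lambda>z. z ^ n * cnj z ^ m)" by (auto simp: mult.commute)
      then show ?thesis by blast
    qed
    show "\<exists>g\<in>{g. \<exists>m n. g = (\<lambda>z. z ^ m * cnj z ^ n)}. g x \<noteq> g y" if "x \<noteq> y" for x y :: complex
      using that by (intro bexI[of _ "\<lambda>z. z ^ 1 * cnj z ^ 0"]) (simp, blast)
  qed (auto intro!: continuous_intros)
  moreover have "(LINT x|M. F x * \<psi> (cis (\<epsilon> * X x))) = (LINT x|M. W x * \<phi> (X x))"
  proof (rule integral_cong_AE)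
    show "AE x in M. F x * \<psi> (cis (\<epsilon> * X x)) = W x * \<phi> (X x)"
      using supp
    proof eventually_elim
      case (elim x)
      then show ?case
        using \<psi>_cis[of "X x"] by (cases "W x = 0") (simp_all add: F_def mult.assoc)
    qed
  qed (use F W in measurable)
  moreover have "(LINT y|?N. H y * \<psi> (cis (\<epsilon> * y))) = (LINT y|?N. half_series \<epsilon> c y * \<phi> y)"
  proof (rule integral_cong_AE)
    \<comment> \<open>Both endpoints are mapped to -1, where \<open>slit_arg\<close> fails to invert
      \<open>cis\<close>. They form a null set on this side; on the side of W they are excluded by
      \<open>supp\<close>.\<close>
    have "AE y in lebesgue. y \<noteq> pi / \<epsilon> \<and> y \<noteq> - pi / \<epsilon>"
      using AE_lborel_singleton[of "pi / \<epsilon>"] AE_lborel_singleton[of "- pi / \<epsilon>"]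
      by (simp add: AE_completion_iff)
    then have "AE y in lebesgue. y \<in> ?I \<longrightarrow> \<bar>y\<bar> < pi / \<epsilon>"
      by eventually_elim auto
    then have "AE y in ?N. \<bar>y\<bar> < pi / \<epsilon>"
      by (subst AE_restrict_space_iff) auto
    then show "AE y in ?N. H y * \<psi> (cis (\<epsilon> * y)) = half_series \<epsilon> c y * \<phi> y"
    proof eventually_elim
      case (elim y)
      then show ?case
        using \<psi>_cis[of y] by (simp add: H_def mult.assoc)
    qed
  qed (unfold H_def, (rule mN, measurable)+)
  ultimately show ?thesis by (simp add: L_def)
qed

text \<open>The marginal has a density bounded by \<epsilon> / pi times the sum of the |c k|, which
  is then paired with the L1 norm of P. As P may be unbounded, the marginal identity is applied to
  truncations of P, and dominated convergence with majorant |W P| removes them.\<close>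

lemma norm_marginal_product_le:
  fixes W X :: "'b \<Rightarrow> real" and P :: "real \<Rightarrow> real"
  assumes W: "integrable M W" and X[measurable]: "X \<in> borel_measurable M"
    and supp: "AE x in M. W x \<noteq> 0 \<longrightarrow> \<bar>X x\<bar> < pi / \<epsilon>"
    and coeff: "\<And>k. (LINT x|M. W x * cis (- (half_freq \<epsilon> k * X x))) = c k"
    and P[measurable]: "P \<in> borel_measurable borel"
    and WP: "integrable M (\<lambda>x. W x * P (X x))"
    and PI: "integrable (lebesgue_on {- pi / \<epsilon>..pi / \<epsilon>}) P"
  shows "norm (LINT x|M. of_real (W x * P (X x)) * cis (\<omega> * X x))
    \<le> \<epsilon> / pi * (\<Sum>k. norm (c k)) * (LINT y|lebesgue_on {- pi / \<epsilon>..pi / \<epsilon>}. \<bar>P y\<bar>)"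
proof -
  let ?N = "lebesgue_on {- pi / \<epsilon>..pi / \<epsilon>}"
  define H where "H = \<epsilon> / pi * (\<Sum>k. norm (c k))"
  have [measurable]: "cis \<in> borel_measurable borel"
    by (intro borel_measurable_continuous_onI continuous_intros)
  have [measurable]: "W \<in> borel_measurable M" using W by simp
  have H0: "H \<ge> 0" unfolding H_def using \<epsilon> c by (intro mult_nonneg_nonneg suminf_nonneg) auto
  define \<phi> where "\<phi> n y = of_real (if \<bar>P y\<bar> \<le> real n then P y else 0) * cis (\<omega> * y)" for n y
  have \<phi>m[measurable]: "\<phi> n \<in> borel_measurable borel" for n unfolding \<phi>_def by measurable
  have \<phi>: "\<phi> n \<in> bounded_borel" for n
    by (rule bounded_borelI[where B = "real n"]) (auto simp: \<phi>_def norm_mult)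
  have mN: "f \<in> borel_measurable ?N" if "f \<in> borel_measurable borel" for f :: "real \<Rightarrow> 'z::topological_space"
    using that by (intro measurable_restrict_space1 measurable_completion) simp
  have bound: "norm (LINT x|M. W x * \<phi> n (X x)) \<le> H * (LINT y|?N. \<bar>P y\<bar>)" for n
  proof -
    have le: "norm (half_series \<epsilon> c y * \<phi> n y) \<le> H * \<bar>P y\<bar>" for y
      using abs_half_series_le[of y, folded H_def] H0 by (auto simp: \<phi>_def norm_mult intro!: mult_mono)
    have i: "integrable ?N (\<lambda>y. H * \<bar>P y\<bar>)" using PI by simp
    have i': "integrable ?N (\<lambda>y. half_series \<epsilon> c y * \<phi> n y)"
    proof (rule Bochner_Integration.integrable_bound[OF i])
      show "(\<lambda>y. half_series \<epsilon> c y * \<phi> n y) \<in> borel_measurable ?N" by (rule mN) measurable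
      show "AE y in ?N. norm (half_series \<epsilon> c y * \<phi> n y) \<le> norm (H * \<bar>P y\<bar>)"
        using le H0 by (simp add: abs_mult)
    qed
    have "norm (LINT x|M. W x * \<phi> n (X x)) = norm (LINT y|?N. half_series \<epsilon> c y * \<phi> n y)"
      by (simp only: marginal_eq_half_series[OF W X supp coeff \<phi>])
    also have "\<dots> \<le> (LINT y|?N. norm (half_series \<epsilon> c y * \<phi> n y))"
      by (rule integral_norm_bound)
    also have "\<dots> \<le> (LINT y|?N. H * \<bar>P y\<bar>)"
      using le by (intro integral_mono integrable_norm i i') auto
    finally show ?thesis by simp
  qed
  have "(\<lambda>n. LINT x|M. W x * \<phi> n (X x)) \<longlonglongrightarrow> (LINT x|M. of_real (W x * P (X x)) * cis (\<omega> * X x))"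
  proof (rule integral_dominated_convergence[where w = "\<lambda>x. \<bar>W x * P (X x)\<bar>"])
    show "AE x in M. (\<lambda>n. W x * \<phi> n (X x)) \<longlonglongrightarrow> of_real (W x * P (X x)) * cis (\<omega> * X x)"
    proof (rule AE_I2)
      fix x
      obtain N where "\<bar>P (X x)\<bar> \<le> real N" using real_arch_simple by blast
      then have "\<forall>\<^sub>F n in sequentially. W x * \<phi> n (X x) = of_real (W x * P (X x)) * cis (\<omega> * X x)"
        unfolding eventually_sequentially by (intro exI[of _ N]) (auto simp: \<phi>_def)
      then show "(\<lambda>n. W x * \<phi> n (X x)) \<longlonglongrightarrow> of_real (W x * P (X x)) * cis (\<omega> * X x)"
        by (rule tendsto_eventually)
    qed
    show "AE x in M. norm (W x * \<phi> n (X x)) \<le> \<bar>W x * P (X x)\<bar>" for n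
      by (auto simp: \<phi>_def norm_mult abs_mult)
  qed (measurable, measurable, use WP in simp)
  then have "(\<lambda>n. norm (LINT x|M. W x * \<phi> n (X x))) \<longlonglongrightarrow> norm (LINT x|M. of_real (W x * P (X x)) * cis (\<omega> * X x))"
    by (rule tendsto_norm)
  then show ?thesis
    unfolding H_def[symmetric] by (rule LIMSEQ_le_const2) (use bound in auto)
qed

end

section \<open>Sections, null sets and exponential moments\<close>

text \<open>Completeness of \<open>lebesgue\<close>: preimages under \<open>f\<close> and
  \<open>g\<close> differ by subsets of one null set.\<close>

lemma borel_measurable_lebesgue_cong_AE:
  fixes f g :: "'a::euclidean_space \<Rightarrow> 'b::topological_space"
  assumes g: "g \<in> borel_measurable lebesgue" and eq: "AE x in lebesgue. f x = g x"
  shows "f \<in> borel_measurable lebesgue"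
proof (rule measurableI)
  fix A :: "'b set" assume "A \<in> sets borel"
  then have A: "g -` A \<inter> space lebesgue \<in> sets lebesgue"
    by (rule measurable_sets[OF g])
  have ae: "AE x in lebesgue. x \<in> g -` A \<inter> space lebesgue \<longleftrightarrow> x \<in> f -` A \<inter> space lebesgue"
    using eq by eventually_elim auto
  show "f -` A \<inter> space lebesgue \<in> sets lebesgue"
    by (rule completion.in_sets_AE[OF ae A]) simp
qed auto

text \<open>Space-time carries the completion of the product measure, and a function measurable for
  it can have nonmeasurable sections. A Borel representative agrees with it on almost every section,
  which is enough for statements that hold for almost every t.\<close>

lemma lebesgue_measurable_section_representative:
  fixes f :: "real \<Rightarrow> 'a::euclidean_space \<Rightarrow> real"
  assumes "(\<lambda>(t, x). f t x) \<in> borel_measurable lebesgue"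
  obtains g where "case_prod g \<in> borel_measurable (lborel \<Otimes>\<^sub>M lborel)"
    "AE t in lebesgue. AE x in lebesgue. f t x = g t x"
proof -
  obtain h where h: "h \<in> borel_measurable lborel" "AE z in lborel. (\<lambda>(t, x). f t x) z = h z"
    using completion_ex_borel_measurable_real[OF assms] by blast
  have "AE z in (lborel \<Otimes>\<^sub>M lborel :: (real \<times> 'a) measure). (\<lambda>(t, x). f t x) z = h z"
    unfolding lborel_prod by (rule h(2))
  then have "AE t in lborel. AE x in lborel. (\<lambda>(t, x). f t x) (t, x) = h (t, x)"
    by (rule lborel_pair.AE_pair)
  then have "AE t in lebesgue. AE x in lebesgue. f t x = h (t, x)"
    by (simp add: AE_completion_iff)
  moreover have "case_prod (curry h) \<in> borel_measurable (lborel \<Otimes>\<^sub>M lborel)"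
    using h(1) by (simp add: lborel_prod)
  ultimately show ?thesis using that[of "curry h"] by simp
qed

lemma AE_section_measurable:
  fixes f :: "real \<Rightarrow> 'a::euclidean_space \<Rightarrow> real"
  assumes "(\<lambda>(t, x). f t x) \<in> borel_measurable lebesgue"
  shows "AE t in lebesgue. f t \<in> borel_measurable lebesgue"
proof -
  obtain g where g: "case_prod g \<in> borel_measurable (lborel \<Otimes>\<^sub>M lborel)"
    "AE t in lebesgue. AE x in lebesgue. f t x = g t x"
    using lebesgue_measurable_section_representative[OF assms] .
  have gt: "g t \<in> borel_measurable lebesgue" for t
    using measurable_Pair2[OF g(1), of t] by (intro measurable_completion) simp
  show ?thesis
    using g(2) by eventually_elim (rule borel_measurable_lebesgue_cong_AE[OF gt])
qed

lemma section_integral_measurable: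
  fixes f :: "real \<Rightarrow> 'a::euclidean_space \<Rightarrow> real" and w :: "'a \<Rightarrow> complex"
  assumes f: "(\<lambda>(t, x). f t x) \<in> borel_measurable lebesgue" and w: "w \<in> borel_measurable borel"
  shows "(\<lambda>t. LINT x|lebesgue. f t x * w x) \<in> borel_measurable lebesgue"
proof -
  obtain g where g[measurable]: "case_prod g \<in> borel_measurable (lborel \<Otimes>\<^sub>M lborel)"
    and eq: "AE t in lebesgue. AE x in lebesgue. f t x = g t x"
    using lebesgue_measurable_section_representative[OF f] .
  have [measurable]: "w \<in> borel_measurable lborel" using w by simp
  have "(\<lambda>t. LINT x|lborel. complex_of_real (g t x) * w x) \<in> borel_measurable lborel"
    by (intro lborel.borel_measurable_lebesgue_integral) measurable
  then have m: "(\<lambda>t. LINT x|lborel. complex_of_real (g t x) * w x) \<in> borel_measurable lebesgue"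
    by (intro measurable_completion) simp
  have gw: "(\<lambda>x. complex_of_real (g t x) * w x) \<in> borel_measurable lborel" for t
    by measurable
  show ?thesis
  proof (rule borel_measurable_lebesgue_cong_AE[OF m])
    show "AE t in lebesgue. (LINT x|lebesgue. f t x * w x) = (LINT x|lborel. complex_of_real (g t x) * w x)"
      using eq
    proof eventually_elim
      case (elim t)
      have gl: "(\<lambda>x. complex_of_real (g t x) * w x) \<in> borel_measurable lebesgue"
        by (rule measurable_completion[OF gw])
      have "(LINT x|lebesgue. f t x * w x) = (LINT x|lebesgue. complex_of_real (g t x) * w x)"
      proof (rule integral_cong_AE)
        have ae: "AE x in lebesgue. f t x * w x = complex_of_real (g t x) * w x"
          using elim by eventually_elim simp
        show "(\<lambda>x. f t x * w x) \<in> borel_measurable lebesgue"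
          by (rule borel_measurable_lebesgue_cong_AE[OF gl ae])
        show "AE x in lebesgue. f t x * w x = complex_of_real (g t x) * w x" by (rule ae)
      qed (rule gl)
      then show ?case
        using gw by (simp add: integral_completion)
    qed
  qed
qed

section \<open>Essential bounds and null sets in one coordinate\<close>

lemma Linfty_AE_bounded:
  assumes "q \<in> Linfty"
  shows "\<exists>C\<ge>0. AE t in lebesgue. \<bar>q t\<bar> \<le> C"
proof -
  obtain c where c: "esssup lebesgue (\<lambda>t. ennreal \<bar>q t\<bar>) = ennreal c" "c \<ge> 0"
    using assms by (cases "esssup lebesgue (\<lambda>t. ennreal \<bar>q t\<bar>)") (auto simp: Linfty_def)
  have "AE t in lebesgue. ennreal \<bar>q t\<bar> \<le> ennreal c"
    using esssup_AE[where M = lebesgue and f = "\<lambda>t. ennreal \<bar>q t\<bar>"] unfolding c(1) .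
  then have "AE t in lebesgue. \<bar>q t\<bar> \<le> c"
    by eventually_elim (use c(2) in \<open>simp add: ennreal_le_iff\<close>)
  then show ?thesis using c(2) by blast
qed

lemma Linfty_L1loc_AE_bounded:
  fixes g :: "real \<Rightarrow> 'a::euclidean_space \<Rightarrow> real"
  assumes g: "g \<in> Linfty_L1loc" and K: "compact K"
  shows "\<exists>C\<ge>0. AE t in lebesgue. g t \<in> borel_measurable lebesgue \<and> set_integrable lebesgue K (g t)
     \<and> (LINT x:K|lebesgue. \<bar>g t x\<bar>) \<le> C"
proof -
  let ?N = "\<lambda>t. \<integral>\<^sup>+x\<in>K. ennreal \<bar>g t x\<bar> \<partial>lebesgue"
  have lt: "esssup lebesgue ?N < \<infinity>" using g K by (simp add: Linfty_L1loc_def)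
  obtain c where c: "esssup lebesgue ?N = ennreal c" "c \<ge> 0"
    using lt by (cases "esssup lebesgue ?N") auto
  have "AE t in lebesgue. ?N t \<le> ennreal c"
    using esssup_AE[where M = lebesgue and f = ?N] unfolding c(1) .
  moreover have "AE t in lebesgue. g t \<in> borel_measurable lebesgue"
    using g by (intro AE_section_measurable) (simp add: Linfty_L1loc_def)
  ultimately have "AE t in lebesgue. g t \<in> borel_measurable lebesgue \<and> set_integrable lebesgue K (g t)
     \<and> (LINT x:K|lebesgue. \<bar>g t x\<bar>) \<le> c"
  proof eventually_elim
    case (elim t)
    have K': "K \<in> sets lebesgue" using K by (simp add: borel_compact)
    have eq: "(\<integral>\<^sup>+x. ennreal (norm (indicator K x *\<^sub>R g t x)) \<partial>lebesgue) = ?N t"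
      by (intro nn_integral_cong) (auto simp: indicator_def)
    have m: "(\<lambda>x. indicator K x *\<^sub>R g t x) \<in> borel_measurable lebesgue"
      using elim(2) K' by measurable
    have i: "set_integrable lebesgue K (g t)"
      unfolding set_integrable_def
      by (rule integrableI_bounded[OF m]) (use elim(1) eq in \<open>auto simp: less_top[symmetric] top_unique\<close>)
    have "ennreal (LINT x:K|lebesgue. \<bar>g t x\<bar>) = ennreal (LINT x|lebesgue. norm (indicator K x *\<^sub>R g t x))"
      by (simp add: set_lebesgue_integral_def abs_mult)
    also have "\<dots> = ?N t"
      unfolding eq[symmetric] using i
      by (intro nn_integral_eq_integral[symmetric]) (auto simp: set_integrable_def)
    also have "\<dots> \<le> ennreal c" by (rule elim(1))
    finally have "(LINT x:K|lebesgue. \<bar>g t x\<bar>) \<le> c"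
      by (simp only: ennreal_le_iff[OF c(2)])
    then show ?case using elim(2) i by blast
  qed
  then show ?thesis using c(2) by blast
qed

text \<open>Lets a coefficient of one variable be changed on a null set under an integral over all
  of space. Translation along the i-th axis takes the place of a splitting of
  \<open>real ^ 'n\<close> into coordinates.\<close>

lemma AE_lebesgue_component:
  fixes P :: "real \<Rightarrow> bool" and i :: "'n::finite"
  assumes "AE y in lebesgue. P y"
  shows "AE x in lebesgue. P ((x :: real ^ 'n) $ i)"
proof -
  have "AE y in lborel. P y" using assms by (simp add: AE_completion_iff)
  then obtain N where N: "{y. \<not> P y} \<subseteq> N" "emeasure lborel N = 0" "N \<in> sets lborel"
    by (auto elim!: AE_E)
  then have Nb[measurable]: "N \<in> sets borel" by simp
  define A where "A = {x :: real ^ 'n. x $ i \<in> N}"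
  have comp[measurable]: "(\<lambda>x :: real ^ 'n. x $ i) \<in> borel_measurable borel"
    by (intro borel_measurable_continuous_onI continuous_intros)
  have A[measurable]: "A \<in> sets borel" unfolding A_def by measurable
  have shift: "(\<integral>\<^sup>+x. indicator N ((x :: real ^ 'n) $ i + y) \<partial>lborel) = emeasure lborel A" for y
  proof -
    have "emeasure lborel A = emeasure (distr lborel borel ((+) (axis i y))) A"
      by (simp add: lborel_distr_plus)
    also have "\<dots> = (\<integral>\<^sup>+x. indicator A x \<partial>distr lborel borel ((+) (axis i y)))"
      by simp
    also have "\<dots> = (\<integral>\<^sup>+x. indicator A (axis i y + x) \<partial>lborel)"
      by (rule nn_integral_distr) auto
    also have "\<dots> = (\<integral>\<^sup>+x. indicator N ((x :: real ^ 'n) $ i + y) \<partial>lborel)"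
      by (intro nn_integral_cong) (auto simp: A_def indicator_def axis_def add.commute)
    finally show ?thesis by simp
  qed
  \<comment> \<open>By translation invariance the left-hand side is \<open>\<infinity>\<close> times the measure of \<open>A\<close>.\<close>
  have "(\<integral>\<^sup>+y. emeasure lborel A \<partial>(lborel :: real measure))
      = (\<integral>\<^sup>+y. (\<integral>\<^sup>+x. indicator N ((x :: real ^ 'n) $ i + y) \<partial>lborel) \<partial>lborel)"
    by (simp add: shift)
  also have "\<dots> = (\<integral>\<^sup>+x. (\<integral>\<^sup>+y. indicator N ((x :: real ^ 'n) $ i + y) \<partial>lborel) \<partial>lborel)"
    by (rule lborel_pair.Fubini') measurable
  also have "\<dots> = (\<integral>\<^sup>+x. 0 \<partial>(lborel :: (real ^ 'n) measure))"
  proof (intro nn_integral_cong)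
    fix x :: "real ^ 'n"
    have "(\<integral>\<^sup>+y. indicator N (x $ i + y) \<partial>lborel) = (\<integral>\<^sup>+y. indicator N y \<partial>distr lborel borel ((+) (x $ i)))"
      by (rule nn_integral_distr[symmetric]) auto
    then show "(\<integral>\<^sup>+y. indicator N (x $ i + y) \<partial>lborel) = 0"
      using N(2) by (simp add: lborel_distr_plus)
  qed
  finally have "emeasure lborel A = 0"
    by (simp add: emeasure_lborel_UNIV ennreal_mult_eq_top_iff)
  then have "AE x in lborel. x \<notin> A"
    by (intro AE_not_in null_setsI) auto
  then have "AE x in lborel. P ((x :: real ^ 'n) $ i)"
    by eventually_elim (use N(1) in \<open>auto simp: A_def\<close>)
  then show ?thesis by (rule AE_completion)
qed

text \<open>Real exponentials are closed under products, equal to their conjugates and separate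
  points, so integration against U vanishes on all bounded Borel functions. Applied to the sign of U
  this gives the L1 norm.\<close>

lemma AE_zero_of_exponential_moments:
  fixes U :: "'a::euclidean_space \<Rightarrow> real"
  assumes U: "integrable lebesgue U" and supp: "AE x in lebesgue. norm x \<ge> r \<longrightarrow> U x = 0"
    and mom: "\<And>\<eta>. (LINT x|lebesgue. U x * exp (\<eta> \<bullet> x)) = 0"
  shows "AE x in lebesgue. U x = 0"
proof -
  define L where "L \<phi> = (LINT x|lebesgue. of_real (U x) * \<phi> x)" for \<phi> :: "'a \<Rightarrow> complex"
  let ?K = "cball 0 r :: 'a set"
  have idm: "(\<lambda>x. x) \<in> borel_measurable (lebesgue :: 'a measure)"
    by (intro measurable_completion) simp
  interpret bounded_convergence_functional L ?K
    unfolding L_def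
    by (rule integral_bounded_convergence_functional[OF _ idm])
       (use U supp in \<open>auto elim!: eventually_mono\<close>)
  have zero: "L \<phi> = 0" if "\<phi> \<in> bounded_borel" for \<phi>
    using that
  proof (rule vanishes_of_multiplicative_family[where G = "range (\<lambda>\<eta> x. complex_of_real (exp (\<eta> \<bullet> x)))", rotated -1])
    show "L (\<lambda>x. indicator ?K x * g x) = 0"
      if "g \<in> range (\<lambda>\<eta> x. complex_of_real (exp (\<eta> \<bullet> x)))" for g
    proof -
      from that obtain \<eta> where g: "g = (\<lambda>x. complex_of_real (exp (\<eta> \<bullet> x)))" by auto
      have gm[measurable]: "g \<in> borel_measurable borel"
        unfolding g by (intro borel_measurable_continuous_onI continuous_intros)
      have gl: "g \<in> borel_measurable lebesgue" by (intro measurable_completion) simp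
      have Um: "U \<in> borel_measurable lebesgue" using U by simp
      have "L (\<lambda>x. indicator ?K x * g x) = (LINT x|lebesgue. of_real (U x) * g x)"
        unfolding L_def
      proof (rule integral_cong_AE)
        show ae: "AE x in lebesgue. of_real (U x) * (indicator ?K x * g x) = of_real (U x) * g x"
          using supp by eventually_elim (auto simp: indicator_def)
        show m: "(\<lambda>x. of_real (U x) * g x) \<in> borel_measurable lebesgue"
          by (intro borel_measurable_times gl measurable_compose[OF Um]) simp
        show "(\<lambda>x. of_real (U x) * (indicator ?K x * g x)) \<in> borel_measurable lebesgue"
          by (rule borel_measurable_lebesgue_cong_AE[OF m ae])
      qed
      also have "\<dots> = of_real (LINT x|lebesgue. U x * exp (\<eta> \<bullet> x))"
        unfolding g by (subst integral_complex_of_real[symmetric]) simp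
      finally show ?thesis using mom by simp
    qed
    show "(\<lambda>x. 1) \<in> range (\<lambda>\<eta> x. complex_of_real (exp (\<eta> \<bullet> (x :: 'a))))"
      by (rule image_eqI[of _ _ 0]) auto
    show "(\<lambda>x. f x * g x) \<in> range (\<lambda>\<eta> x. complex_of_real (exp (\<eta> \<bullet> x)))"
      if "f \<in> range (\<lambda>\<eta> x. complex_of_real (exp (\<eta> \<bullet> x)))" "g \<in> range (\<lambda>\<eta> x. complex_of_real (exp (\<eta> \<bullet> x)))"
      for f g :: "'a \<Rightarrow> complex"
    proof -
      from that obtain a b where "f = (\<lambda>x. complex_of_real (exp (a \<bullet> x)))" "g = (\<lambda>x. complex_of_real (exp (b \<bullet> x)))"
        by auto
      then show ?thesis
        by (intro image_eqI[of _ _ "a + b"]) (auto simp: inner_add_left exp_add exp_of_real[symmetric])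
    qed
    show "\<exists>g\<in>range (\<lambda>\<eta> x. complex_of_real (exp (\<eta> \<bullet> x))). g x \<noteq> g y" if "x \<noteq> y" for x y :: 'a
    proof (rule bexI[of _ "\<lambda>z. complex_of_real (exp ((x - y) \<bullet> z))"])
      have "(x - y) \<bullet> (x - y) \<noteq> 0" using that by simp
      then show "complex_of_real (exp ((x - y) \<bullet> x)) \<noteq> complex_of_real (exp ((x - y) \<bullet> y))"
        unfolding of_real_eq_iff exp_inj_iff by (simp add: inner_diff_right)
    qed auto
  qed (auto intro!: continuous_intros)
  \<comment> \<open>The functional accepts Borel functions only, while U is merely Lebesgue
    measurable; the sign is therefore taken of a Borel version of U.\<close>
  obtain V where V: "V \<in> borel_measurable lborel" "AE x in lborel. U x = V x"
    using completion_ex_borel_measurable_real[of U lborel] U by auto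
  have Vb[measurable]: "V \<in> borel_measurable borel" using V(1) by simp
  have UV: "AE x in lebesgue. U x = V x" using V(2) by (rule AE_completion)
  have "L (\<lambda>x. of_real (sgn (V x))) = 0"
  proof (rule zero, rule bounded_borelI[where B = 1])
    show "(\<lambda>x. complex_of_real (sgn (V x))) \<in> borel_measurable borel" by measurable
  qed (auto simp: sgn_if)
  moreover have "L (\<lambda>x. of_real (sgn (V x))) = of_real (LINT x|lebesgue. \<bar>U x\<bar>)"
  proof -
    have "L (\<lambda>x. of_real (sgn (V x))) = (LINT x|lebesgue. complex_of_real \<bar>U x\<bar>)"
      unfolding L_def
    proof (rule integral_cong_AE)
      have "V \<in> borel_measurable lebesgue" by (intro measurable_completion) simp
      then show "(\<lambda>x. complex_of_real (U x) * complex_of_real (sgn (V x))) \<in> borel_measurable lebesgue"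
        using U by measurable
      show "AE x in lebesgue. complex_of_real (U x) * complex_of_real (sgn (V x)) = complex_of_real \<bar>U x\<bar>"
        using UV by eventually_elim (auto simp: sgn_if)
    qed (use U in measurable)
    then show ?thesis by simp
  qed
  ultimately have "(LINT x|lebesgue. \<bar>U x\<bar>) = 0" by simp
  then have "AE x in lebesgue. \<bar>U x\<bar> = 0"
    using integral_nonneg_eq_0_iff_AE[of lebesgue "\<lambda>x. \<bar>U x\<bar>"] U by simp
  then show ?thesis by simp
qed

section \<open>Exponential test functions\<close>

definition wave :: "('n::finite \<Rightarrow> complex) \<Rightarrow> real ^ 'n \<Rightarrow> complex" where
  "wave \<theta> x = exp (\<Sum>i\<in>UNIV. \<theta> i * of_real (x $ i))"

lemma norm_wave: "norm (wave \<theta> x) = exp (\<Sum>i\<in>UNIV. Re (\<theta> i) * x $ i)"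
  by (simp add: wave_def)

lemma continuous_on_wave: "continuous_on S (wave \<theta>)"
  unfolding wave_def[abs_def] by (intro continuous_intros)

lemma wave_measurable [measurable]: "wave \<theta> \<in> borel_measurable borel"
  by (intro borel_measurable_continuous_onI continuous_on_wave)

lemma wave_shift: "wave \<theta> (x + s *\<^sub>R axis i 1) = exp (\<theta> i * of_real s) * wave \<theta> x"
proof -
  have "(\<Sum>j\<in>UNIV. \<theta> j * of_real ((x + s *\<^sub>R axis i 1) $ j))
      = (\<Sum>j\<in>UNIV. \<theta> j * of_real (x $ j)) + (\<Sum>j\<in>UNIV. if j = i then \<theta> i * of_real s else 0)"
    unfolding sum.distrib[symmetric] by (intro sum.cong) (auto simp: axis_def algebra_simps)
  then show ?thesis by (simp add: wave_def exp_add)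
qed

lemma norm_wave_le:
  assumes "norm x \<le> r" and "\<And>i. \<bar>Re (\<theta> i)\<bar> \<le> A i"
  shows "norm (wave \<theta> x) \<le> exp (\<Sum>i\<in>UNIV. A i * r)"
proof -
  have "Re (\<theta> i) * x $ i \<le> A i * r" for i
  proof -
    have "Re (\<theta> i) * x $ i \<le> \<bar>Re (\<theta> i)\<bar> * \<bar>x $ i\<bar>"
      by (metis abs_ge_self abs_mult)
    also have "\<dots> \<le> A i * r"
      using assms(2)[of i] component_le_norm_cart[of x i] assms(1) by (intro mult_mono) auto
    finally show ?thesis .
  qed
  then show ?thesis unfolding norm_wave by (simp add: sum_mono)
qed

section \<open>Derivatives of plane waves\<close>

lemma dir_deriv_cong:
  assumes "open T" "z \<in> T" "\<And>y. y \<in> T \<Longrightarrow> f y = g y"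
  shows "dir_deriv v f z = dir_deriv v g z"
  unfolding dir_deriv_def
proof (rule deriv_cong_ev)
  have "((\<lambda>s. z + s *\<^sub>R v) \<longlongrightarrow> z + 0 *\<^sub>R v) (nhds 0)"
    by (intro tendsto_intros filterlim_ident)
  then have "\<forall>\<^sub>F s in nhds 0. z + s *\<^sub>R v \<in> T"
    using assms(1,2) by (intro topological_tendstoD) auto
  then show "\<forall>\<^sub>F s in nhds 0. f (z + s *\<^sub>R v) = g (z + s *\<^sub>R v)"
    by eventually_elim (rule assms(3))
qed simp

text \<open>Test functions are real, but spatial derivatives of an exponential act by multiplying
  its complex amplitude; \<open>a\<close> records that amplitude. The set \<open>T\<close> is the
  region where a cut-off function still coincides with the wave.\<close>

definition plane_wave_on ::
  "(real \<times> (real ^ 'n)) set \<Rightarrow> ('n::finite \<Rightarrow> complex) \<Rightarrow> (real \<Rightarrow> real) \<Rightarrow> complex \<Rightarrow> (real \<times> (real ^ 'n) \<Rightarrow> real) \<Rightarrow> bool"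
  where "plane_wave_on T \<theta> \<phi> a f \<longleftrightarrow> (\<forall>t x. (t, x) \<in> T \<longrightarrow> f (t, x) = \<phi> t * Re (a * wave \<theta> x))"

lemma plane_wave_dx:
  assumes T: "open T" and f: "plane_wave_on T \<theta> \<phi> a f"
  shows "plane_wave_on T \<theta> \<phi> (\<theta> i * a) (dx i f)"
  unfolding plane_wave_on_def
proof (intro allI impI)
  fix t x assume tx: "(t, x) \<in> T"
  have "dx i f (t, x) = dir_deriv (0, axis i 1) (\<lambda>(t, x). \<phi> t * Re (a * wave \<theta> x)) (t, x)"
    unfolding dx_def by (rule dir_deriv_cong[OF T tx]) (use f in \<open>auto simp: plane_wave_on_def\<close>)
  also have "\<dots> = deriv (\<lambda>s. \<phi> t * Re (a * (exp (\<theta> i * of_real s) * wave \<theta> x))) 0"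
    by (simp add: dir_deriv_def wave_shift)
  also have "\<dots> = \<phi> t * Re (\<theta> i * a * wave \<theta> x)"
  proof (rule DERIV_imp_deriv)
    have "((\<lambda>s. a * (exp (\<theta> i * of_real s) * wave \<theta> x)) has_vector_derivative \<theta> i * a * wave \<theta> x) (at 0)"
      by (rule has_vector_derivative_real_field) (auto intro!: derivative_eq_intros)
    then have "((\<lambda>s. Re (a * (exp (\<theta> i * of_real s) * wave \<theta> x))) has_vector_derivative Re (\<theta> i * a * wave \<theta> x)) (at 0)"
      by (rule bounded_linear.has_vector_derivative[OF bounded_linear_Re])
    then show "((\<lambda>s. \<phi> t * Re (a * (exp (\<theta> i * of_real s) * wave \<theta> x))) has_real_derivative
        \<phi> t * Re (\<theta> i * a * wave \<theta> x)) (at 0)"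
      unfolding has_real_derivative_iff_has_vector_derivative[symmetric] by (rule DERIV_cmult)
  qed
  finally show "dx i f (t, x) = \<phi> t * Re (\<theta> i * a * wave \<theta> x)" .
qed

lemma plane_wave_dt:
  assumes T: "open T" and \<phi>: "\<And>t. (\<phi> has_real_derivative \<phi>' t) (at t)" and f: "plane_wave_on T \<theta> \<phi> a f"
  shows "plane_wave_on T \<theta> \<phi>' a (dt f)"
  unfolding plane_wave_on_def
proof (intro allI impI)
  fix t x assume tx: "(t, x) \<in> T"
  have "dt f (t, x) = dir_deriv (1, 0) (\<lambda>(t, x). \<phi> t * Re (a * wave \<theta> x)) (t, x)"
    unfolding dt_def by (rule dir_deriv_cong[OF T tx]) (use f in \<open>auto simp: plane_wave_on_def\<close>)
  also have "\<dots> = deriv (\<lambda>s. \<phi> (t + s) * Re (a * wave \<theta> x)) 0"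
    by (simp add: dir_deriv_def)
  also have "\<dots> = \<phi>' t * Re (a * wave \<theta> x)"
  proof (rule DERIV_imp_deriv)
    have "((\<lambda>s. \<phi> (t + s)) has_real_derivative \<phi>' t) (at 0)"
      using DERIV_shift[of \<phi> "\<phi>' t" 0 t] \<phi>[of t] by (simp add: add.commute)
    then show "((\<lambda>s. \<phi> (t + s) * Re (a * wave \<theta> x)) has_real_derivative \<phi>' t * Re (a * wave \<theta> x)) (at 0)"
      by (rule DERIV_cmult_right)
  qed
  finally show "dt f (t, x) = \<phi>' t * Re (a * wave \<theta> x)" .
qed

lemma plane_wave_laplacian:
  assumes T: "open T" and f: "plane_wave_on T \<theta> \<phi> a f"
  shows "plane_wave_on T \<theta> \<phi> ((\<Sum>i\<in>UNIV. (\<theta> i)\<^sup>2) * a) (laplacian f)"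
proof -
  have "plane_wave_on T \<theta> \<phi> (\<theta> i * (\<theta> i * a)) (dx i (dx i f))" for i
    by (intro plane_wave_dx T f)
  then show ?thesis
    by (auto simp: plane_wave_on_def laplacian_def sum_distrib_left[symmetric] Re_sum[symmetric]
        sum_distrib_right power2_eq_square mult.assoc)
qed

text \<open>Each derivative contributes a scalar factor, so the fold over the sorted list turns into
  a product over its set and the order of differentiation disappears.\<close>

lemma plane_wave_dx_multi:
  fixes \<alpha> :: "'n::{finite, linorder} \<Rightarrow> nat"
  assumes T: "open T" and f: "plane_wave_on T \<theta> \<phi> a f"
  shows "plane_wave_on T \<theta> \<phi> ((\<Prod>i\<in>UNIV. \<theta> i ^ \<alpha> i) * a) (dx_multi \<alpha> f)"
proof -
  have pow: "plane_wave_on T \<theta> \<phi> (\<theta> i ^ k * b) ((dx i ^^ k) g)"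
    if "plane_wave_on T \<theta> \<phi> b g" for i k b g
  proof (induction k)
    case (Suc k)
    then show ?case using plane_wave_dx[OF T Suc, of i] by (simp add: mult.assoc)
  qed (use that in simp)
  have "distinct is \<Longrightarrow> plane_wave_on T \<theta> \<phi> ((\<Prod>i\<in>set is. \<theta> i ^ \<alpha> i) * a) (foldr (\<lambda>i g. (dx i ^^ \<alpha> i) g) is f)" for "is"
  proof (induction "is")
    case (Cons i "is")
    then show ?case using pow[of "(\<Prod>i\<in>set is. \<theta> i ^ \<alpha> i) * a" _ i "\<alpha> i"] by (simp add: mult.assoc)
  qed (use f in simp)
  from this[of "sorted_list_of_set UNIV"] show ?thesis
    by (simp add: dx_multi_def)
qed

section \<open>Cut-off plane waves as test functions\<close>

lemma exp_tower: "deriv_tower (\<lambda>n. exp)"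
  by (auto simp: deriv_tower_def)

lemma smooth_cos: "smooth f \<Longrightarrow> smooth (\<lambda>z. cos (f z))" and smooth_sin: "smooth f \<Longrightarrow> smooth (\<lambda>z. sin (f z))"
proof -
  \<comment> \<open>Differentiating the cosine n times shifts it by n quarter periods.\<close>
  have cd: "deriv_tower (\<lambda>n x. cos (x + real n * (pi / 2)))"
    unfolding deriv_tower_def
  proof (intro allI)
    fix n x
    have "x + real (Suc n) * (pi / 2) = (x + real n * (pi / 2)) + pi / 2"
      by (simp add: algebra_simps)
    also have "cos \<dots> = - sin (x + real n * (pi / 2))"
      by (simp add: cos_add[of _ "pi / 2"])
    finally show "((\<lambda>x. cos (x + real n * (pi / 2))) has_real_derivative cos (x + real (Suc n) * (pi / 2))) (at x)"
      by (auto intro!: derivative_eq_intros)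
  qed
  show c: "smooth (\<lambda>z. cos (f z))" if "smooth f" for f :: "'a \<Rightarrow> real"
    using smooth_compose_tower[OF cd that, of 0] by simp
  have "sin (f z) = cos (f z - pi / 2)" for z by (simp add: cos_diff)
  then show "smooth (\<lambda>z. sin (f z))" if "smooth f"
    using c[OF smooth_diff[OF that smooth_const[of "pi/2"]]] by simp
qed

lemma smooth_wave: "smooth (\<lambda>z :: real \<times> (real ^ 'n). Re (a * wave \<theta> (snd z)))"
proof -
  have lin: "smooth (\<lambda>z :: real \<times> (real ^ 'n). \<Sum>i\<in>UNIV. b i * snd z $ i)" for b
    by (intro smooth_sum smooth_mult smooth_const smooth_bounded_linear
        bounded_linear_compose[OF bounded_linear_vec_nth bounded_linear_snd])
  have "Re (a * wave \<theta> x) = exp (\<Sum>i\<in>UNIV. Re (\<theta> i) * x $ i) *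
     (Re a * cos (\<Sum>i\<in>UNIV. Im (\<theta> i) * x $ i) - Im a * sin (\<Sum>i\<in>UNIV. Im (\<theta> i) * x $ i))" for x
    by (simp add: wave_def Re_exp Im_exp algebra_simps)
  then show ?thesis
    using smooth_compose_tower[OF exp_tower lin[of "\<lambda>i. Re (\<theta> i)"]]
    by (auto intro!: smooth_mult smooth_diff smooth_const smooth_cos smooth_sin lin)
qed

text \<open>The solution is supported in a ball, so an exponential may be cut off outside it without
  changing any pairing with the solution.\<close>

lemma plane_wave_test_function_exists:
  fixes \<theta> :: "'n::finite \<Rightarrow> complex" and \<phi> :: "real \<Rightarrow> real"
  assumes r: "r \<ge> 0" and \<phi>: "smooth \<phi>" "\<exists>d. \<forall>x. \<bar>x\<bar> > d \<longrightarrow> \<phi> x = 0"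
  shows "\<exists>\<zeta>\<in>test_functions. plane_wave_on {z. norm (snd z) < r} \<theta> \<phi> a \<zeta>"
proof -
  obtain G where G: "deriv_tower G" "\<And>x. x \<le> 0 \<Longrightarrow> G 0 x = 0" "\<And>x. x \<ge> 1 \<Longrightarrow> G 0 x = 1"
    using smooth_step_exists by metis
  obtain d where d: "\<And>x. \<bar>x\<bar> > d \<Longrightarrow> \<phi> x = 0" using \<phi>(2) by blast
  \<comment> \<open>The squared norm, unlike the norm, is smooth at the origin. The cut-off is 1 for
    |x| \<le> r and 0 once |x|^2 \<ge> r^2 + 1.\<close>
  define cut where "cut z = 1 - G 0 ((\<Sum>i\<in>UNIV. snd z $ i * snd z $ i) - r\<^sup>2)" for z :: "real \<times> (real ^ 'n)"
  have sq: "(\<Sum>i\<in>UNIV. x $ i * x $ i) = (norm x)\<^sup>2" for x :: "real ^ 'n"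
    by (simp add: norm_vec_def L2_set_def sum_nonneg power2_eq_square[symmetric])
  have "smooth (\<lambda>z :: real \<times> (real ^ 'n). (\<Sum>i\<in>UNIV. snd z $ i * snd z $ i) - r\<^sup>2)"
    by (intro smooth_sum smooth_mult smooth_const smooth_diff smooth_bounded_linear
        bounded_linear_compose[OF bounded_linear_vec_nth bounded_linear_snd])
  from smooth_compose_tower[OF G(1) this, of 0] have cut: "smooth cut"
    unfolding cut_def by (intro smooth_diff smooth_const)
  have \<phi>': "smooth (\<lambda>z :: real \<times> (real ^ 'n). \<phi> (fst z))"
    using smooth_compose_tower[OF smooth_deriv_tower[OF \<phi>(1)] smooth_bounded_linear[OF bounded_linear_fst], of 0]
    by simp
  define \<zeta> where "\<zeta> z = \<phi> (fst z) * cut z * Re (a * wave \<theta> (snd z))" for z :: "real \<times> (real ^ 'n)"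
  have "smooth \<zeta>"
    unfolding \<zeta>_def by (intro smooth_mult \<phi>' cut smooth_wave)
  moreover have "compact (closure {z. \<zeta> z \<noteq> 0})"
  proof -
    have "{z. \<zeta> z \<noteq> 0} \<subseteq> cball 0 d \<times> cball 0 (sqrt (r\<^sup>2 + 1))"
    proof
      fix z assume z: "z \<in> {z. \<zeta> z \<noteq> 0}"
      then have "\<bar>fst z\<bar> \<le> d" using d[of "fst z"] by (force simp: \<zeta>_def)
      moreover have "(norm (snd z))\<^sup>2 - r\<^sup>2 < 1"
        using z G(3)[of "(norm (snd z))\<^sup>2 - r\<^sup>2"] by (force simp: \<zeta>_def cut_def sq)
      then have "norm (snd z) \<le> sqrt (r\<^sup>2 + 1)" by (intro real_le_rsqrt) simp
      ultimately show "z \<in> cball 0 d \<times> cball 0 (sqrt (r\<^sup>2 + 1))"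
        by (cases z) simp
    qed
    then have "bounded {z. \<zeta> z \<noteq> 0}"
      by (rule bounded_subset[rotated]) (intro bounded_Times bounded_cball)
    then show ?thesis by simp
  qed
  ultimately have "\<zeta> \<in> test_functions"
    by (simp add: test_functions_def smooth_def)
  moreover have "plane_wave_on {z. norm (snd z) < r} \<theta> \<phi> a \<zeta>"
  proof -
    have "cut (t, x) = 1" if "norm x < r" for t x
    proof -
      have "(norm x)\<^sup>2 \<le> r\<^sup>2" using that by (intro power_mono) auto
      then show ?thesis using G(2) by (simp add: cut_def sq)
    qed
    then show ?thesis by (auto simp: plane_wave_on_def \<zeta>_def)
  qed
  ultimately show ?thesis by blast
qed

text \<open>The bound involves \<theta> only through its real parts, hence is uniform in the
  oscillation frequencies.\<close>

lemma integrable_times_wave: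
  assumes h: "integrable lebesgue h" and supp: "AE x in lebesgue. norm x \<ge> r \<longrightarrow> h x = 0"
    and A: "\<And>i. \<bar>Re (\<theta> i)\<bar> \<le> A i"
  shows "integrable lebesgue (\<lambda>x. of_real (h x) * wave \<theta> x)" (is ?int)
    and "norm (LINT x|lebesgue. of_real (h x) * wave \<theta> x) \<le> exp (\<Sum>i\<in>UNIV. A i * r) * (LINT x|lebesgue. \<bar>h x\<bar>)" (is ?bd)
proof -
  have hm: "h \<in> borel_measurable lebesgue" using h by simp
  have wm: "wave \<theta> \<in> borel_measurable lebesgue" by (intro measurable_completion) simp
  have m: "(\<lambda>x. of_real (h x) * wave \<theta> x) \<in> borel_measurable lebesgue"
    by (intro borel_measurable_times wm measurable_compose[OF hm]) simp
  let ?E = "exp (\<Sum>i\<in>UNIV. A i * r)"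
  have b: "AE x in lebesgue. norm (of_real (h x) * wave \<theta> x) \<le> ?E * \<bar>h x\<bar>"
    using supp
  proof eventually_elim
    case (elim x)
    show ?case
    proof (cases "norm x \<ge> r")
      case True
      then show ?thesis using elim by simp
    next
      case False
      then have "norm (wave \<theta> x) \<le> ?E" by (intro norm_wave_le A) simp
      then show ?thesis
        unfolding norm_mult norm_of_real by (subst mult.commute) (rule mult_right_mono, auto)
    qed
  qed
  have i: "integrable lebesgue (\<lambda>x. ?E * \<bar>h x\<bar>)" using h by simp
  show ?int
    by (rule Bochner_Integration.integrable_bound[OF i m]) (use b in \<open>eventually_elim, simp\<close>)
  have "norm (LINT x|lebesgue. of_real (h x) * wave \<theta> x) \<le> (LINT x|lebesgue. norm (of_real (h x) * wave \<theta> x))"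
    by (rule integral_norm_bound)
  also have "\<dots> \<le> (LINT x|lebesgue. ?E * \<bar>h x\<bar>)"
    by (rule integral_mono_AE[OF integrable_norm[OF \<open>?int\<close>] i b])
  finally show ?bd by simp
qed

text \<open>By completeness \<open>f\<close> and \<open>g\<close> are measurable together; if
  neither is, both integrals have the default value 0.\<close>

lemma integral_lebesgue_cong_AE:
  fixes f g :: "'a::euclidean_space \<Rightarrow> 'b::{banach, second_countable_topology}"
  assumes eq: "AE x in lebesgue. f x = g x"
  shows "integral\<^sup>L lebesgue f = integral\<^sup>L lebesgue g"
proof (cases "g \<in> borel_measurable lebesgue")
  case True
  then show ?thesis
    using borel_measurable_lebesgue_cong_AE[OF True eq] eq by (intro integral_cong_AE)
next
  case False
  have "AE x in lebesgue. g x = f x" using eq by eventually_elim simp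
  then have "f \<notin> borel_measurable lebesgue"
    using False borel_measurable_lebesgue_cong_AE by blast
  then have "\<not> integrable lebesgue f" "\<not> integrable lebesgue g"
    using False borel_measurable_integrable by blast+
  then show ?thesis by (simp add: not_integrable_integral_eq)
qed

lemma Re_of_real_mult: "Re (of_real r * z) = r * Re z"
  by simp

text \<open>Testing with the real part of \<open>a\<close> times the wave separates space from time
  and yields that Re (a J) has integral 0, where J is the complex integrand. The amplitudes 1 and
  -\<i> recover its real and imaginary parts.\<close>

lemma weak_solution_plane_wave:
  fixes \<theta> :: "'n::{finite, linorder} \<Rightarrow> complex"
    and p :: "real \<Rightarrow> real \<Rightarrow> real"
    and q :: "('n::{finite, linorder} \<Rightarrow> nat) \<Rightarrow> real \<Rightarrow> real"
    and u :: "real \<Rightarrow> real ^ 'n::{finite, linorder} \<Rightarrow> real"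
  assumes weak: "weak_solution q p u"
    and u: "\<And>t. integrable lebesgue (u t)"
    and pu: "AE t in lebesgue. integrable lebesgue (\<lambda>x. p t (x $ Min UNIV) * u t x)"
    and supp: "\<And>t. AE x in lebesgue. norm x \<ge> r \<longrightarrow> u t x = 0" and r: "r \<ge> 0"
    and \<phi>: "smooth \<phi>" "\<exists>d. \<forall>x. \<bar>x\<bar> > d \<longrightarrow> \<phi> x = 0"
  shows "(LINT t|lebesgue.
      of_real (deriv (deriv \<phi>) t) * (LINT x|lebesgue. of_real (u t x) * wave \<theta> x)
      + ((\<Sum>i\<in>UNIV. (\<theta> i)\<^sup>2)\<^sup>2) * (of_real (\<phi> t) * (LINT x|lebesgue. of_real (u t x) * wave \<theta> x))
      + of_real (\<phi> t) * ((\<Sum>\<alpha> | mi_order \<alpha> \<le> 2. (-1) ^ mi_order \<alpha> * of_real (q \<alpha> t) * (\<Prod>i\<in>UNIV. \<theta> i ^ \<alpha> i))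
          * (LINT x|lebesgue. of_real (u t x) * wave \<theta> x)
        + (LINT x|lebesgue. of_real (p t (x $ Min UNIV) * u t x) * wave \<theta> x))) = (0::complex)"
    (is "integral\<^sup>L lebesgue ?J = 0")
proof -
  define c where "c t = (LINT x|lebesgue. of_real (u t x) * wave \<theta> x)" for t
  define f where "f t = (LINT x|lebesgue. of_real (p t (x $ Min UNIV) * u t x) * wave \<theta> x)" for t
  define \<sigma> where "\<sigma> = (\<Sum>i\<in>UNIV. (\<theta> i)\<^sup>2)"
  define Q where "Q t = (\<Sum>\<alpha> | mi_order \<alpha> \<le> 2. (-1) ^ mi_order \<alpha> * of_real (q \<alpha> t) * (\<Prod>i\<in>UNIV. \<theta> i ^ \<alpha> i))" for t
  define D where "D t = of_real (deriv (deriv \<phi>) t) + \<sigma>\<^sup>2 * of_real (\<phi> t) + of_real (\<phi> t) * Q t" for t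
  define J where "J t = D t * c t + of_real (\<phi> t) * f t" for t
  note \<phi>d = smooth_real_deriv[OF \<phi>(1)]
  let ?T = "{z :: real \<times> (real ^ 'n::{finite, linorder}). norm (snd z) < r}"
  have T: "open ?T" by (intro open_Collect_less continuous_intros)
  have key: "(LINT t|lebesgue. Re (a * J t)) = 0" for a
  proof -
    obtain \<zeta> where \<zeta>: "\<zeta> \<in> test_functions" "plane_wave_on ?T \<theta> \<phi> a \<zeta>"
      using plane_wave_test_function_exists[OF r \<phi>, of \<theta> a] by blast
    let ?I = "\<lambda>t x. u t x * (dt (dt \<zeta>) (t, x) + laplacian (laplacian \<zeta>) (t, x))
        + (\<Sum>\<alpha> | mi_order \<alpha> \<le> 2. (-1) ^ mi_order \<alpha> * q \<alpha> t * u t x * dx_multi \<alpha> \<zeta> (t, x))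
        + p t (x $ Min UNIV) * u t x * \<zeta> (t, x)"
    have z0: "\<zeta> (t, x) = \<phi> t * Re (a * wave \<theta> x)" if "norm x < r" for t x
      using \<zeta>(2) that by (simp add: plane_wave_on_def)
    have z1: "dt (dt \<zeta>) (t, x) = deriv (deriv \<phi>) t * Re (a * wave \<theta> x)" if "norm x < r" for t x
      using plane_wave_dt[OF T \<phi>d(2) plane_wave_dt[OF T \<phi>d(1) \<zeta>(2)]] that by (simp add: plane_wave_on_def)
    have z2: "laplacian (laplacian \<zeta>) (t, x) = \<phi> t * Re (\<sigma> * (\<sigma> * a) * wave \<theta> x)" if "norm x < r" for t x
      using plane_wave_laplacian[OF T plane_wave_laplacian[OF T \<zeta>(2)]] that
      by (simp add: plane_wave_on_def \<sigma>_def)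
    have z3: "dx_multi \<alpha> \<zeta> (t, x) = \<phi> t * Re ((\<Prod>i\<in>UNIV. \<theta> i ^ \<alpha> i) * (a * wave \<theta> x))" if "norm x < r" for t x \<alpha>
      using plane_wave_dx_multi[OF T \<zeta>(2), of \<alpha>] that
      unfolding plane_wave_on_def mult.assoc by auto
    have sumRe: "(\<Sum>\<alpha> | mi_order \<alpha> \<le> 2. (-1) ^ mi_order \<alpha> * q \<alpha> t * y * (\<phi> t * Re ((\<Prod>i\<in>UNIV. \<theta> i ^ \<alpha> i) * b)))
        = Re (b * of_real y * (of_real (\<phi> t) * Q t))" for t y b
    proof -
      have "(-1) ^ mi_order \<alpha> * q \<alpha> t * y * (\<phi> t * Re ((\<Prod>i\<in>UNIV. \<theta> i ^ \<alpha> i) * b))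
         = Re (b * of_real y * (of_real (\<phi> t) * ((-1) ^ mi_order \<alpha> * of_real (q \<alpha> t) * (\<Prod>i\<in>UNIV. \<theta> i ^ \<alpha> i))))" for \<alpha>
      proof -
        have eq: "b * of_real y * (of_real (\<phi> t) * ((-1) ^ mi_order \<alpha> * of_real (q \<alpha> t) * (\<Prod>i\<in>UNIV. \<theta> i ^ \<alpha> i)))
          = of_real ((-1) ^ mi_order \<alpha> * q \<alpha> t * y * \<phi> t) * ((\<Prod>i\<in>UNIV. \<theta> i ^ \<alpha> i) * b)"
          by (simp add: mult_ac)
        show ?thesis unfolding eq Re_of_real_mult by (simp only: mult_ac)
      qed
      then show ?thesis unfolding Q_def by (simp add: sum_distrib_left)
    qed
    have inner: "AE t in lebesgue. (LINT x|lebesgue. ?I t x) = Re (a * J t)"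
      using pu
    proof eventually_elim
      case (elim t)
      have supp': "AE x in lebesgue. norm x \<ge> r \<longrightarrow> p t (x $ Min UNIV) * u t x = 0"
        using supp[of t] by eventually_elim simp
      have i1: "integrable lebesgue (\<lambda>x. of_real (u t x) * wave \<theta> x)"
        by (rule integrable_times_wave[OF u supp, of "\<theta>" "\<lambda>i. \<bar>Re (\<theta> i)\<bar>"]) simp
      have i2: "integrable lebesgue (\<lambda>x. of_real (p t (x $ Min UNIV) * u t x) * wave \<theta> x)"
        by (rule integrable_times_wave[OF elim supp', of "\<theta>" "\<lambda>i. \<bar>Re (\<theta> i)\<bar>"]) simp
      have "(LINT x|lebesgue. ?I t x) = (LINT x|lebesgue. Re (a * (D t * (of_real (u t x) * wave \<theta> x)
          + of_real (\<phi> t) * (of_real (p t (x $ Min UNIV) * u t x) * wave \<theta> x))))"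
      proof (rule integral_lebesgue_cong_AE)
        show "AE x in lebesgue. ?I t x = Re (a * (D t * (of_real (u t x) * wave \<theta> x)
          + of_real (\<phi> t) * (of_real (p t (x $ Min UNIV) * u t x) * wave \<theta> x)))"
          using supp[of t]
        proof eventually_elim
          case (elim x)
          show ?case
          proof (cases "norm x < r")
            case True
            have "?I t x = Re (u t x * deriv (deriv \<phi>) t * (a * wave \<theta> x)) + Re (u t x * \<phi> t * (\<sigma> * (\<sigma> * a) * wave \<theta> x))
              + Re ((a * wave \<theta> x) * of_real (u t x) * (of_real (\<phi> t) * Q t))
              + Re (p t (x $ Min UNIV) * u t x * \<phi> t * (a * wave \<theta> x))"
              unfolding z0[OF True] z1[OF True] z2[OF True] z3[OF True] sumRe
              by (simp only: Re_of_real_mult of_real_mult[symmetric]) (simp add: algebra_simps)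
            also have "\<dots> = Re (a * (D t * (of_real (u t x) * wave \<theta> x)
              + of_real (\<phi> t) * (of_real (p t (x $ Min UNIV) * u t x) * wave \<theta> x)))"
              unfolding plus_complex.sel(1)[symmetric] D_def
              by (rule arg_cong[of _ _ Re]) (simp add: algebra_simps power2_eq_square)
            finally show ?thesis .
          next
            case False
            then show ?thesis using elim by simp
          qed
        qed
      qed
      also have "\<dots> = Re (LINT x|lebesgue. a * (D t * (of_real (u t x) * wave \<theta> x)
          + of_real (\<phi> t) * (of_real (p t (x $ Min UNIV) * u t x) * wave \<theta> x)))"
        using i1 i2 by (intro integral_Re integrable_mult_right Bochner_Integration.integrable_add) 
      also have "\<dots> = Re (a * J t)"
        using i1 i2 unfolding J_def c_def f_def by simp
      finally show ?case .
    qed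
    have "(LINT t|lebesgue. LINT x|lebesgue. ?I t x) = 0"
      using weak \<zeta>(1) unfolding weak_solution_def by blast
    then show ?thesis
      using integral_lebesgue_cong_AE[OF inner] by simp
  qed
  have "integral\<^sup>L lebesgue J = 0"
  \<comment> \<open>If J is not integrable, its integral is 0 by convention.\<close>
  proof (cases "integrable lebesgue J")
    case True
    have "Re (a * integral\<^sup>L lebesgue J) = 0" for a
    proof -
      have "Re (a * integral\<^sup>L lebesgue J) = Re (LINT t|lebesgue. a * J t)" by simp
      also have "\<dots> = (LINT t|lebesgue. Re (a * J t))"
        using True by (intro integral_Re[symmetric] integrable_mult_right)
      finally show ?thesis using key by simp
    qed
    from this[of 1] this[of "- \<i>"] show ?thesis by (simp add: complex_eq_iff)
  qed (simp add: not_integrable_integral_eq)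
  moreover have "?J = J"
    unfolding J_def c_def f_def D_def Q_def \<sigma>_def by (simp add: fun_eq_iff algebra_simps)
  ultimately show ?thesis by simp
qed

section \<open>Compactly supported solutions\<close>

text \<open>A violation would persist on a nonempty open set, which is not negligible. This upgrades
  essential bounds on moments to bounds at every time.\<close>

lemma continuous_AE_bounded:
  fixes f :: "real \<Rightarrow> complex"
  assumes f: "continuous_on UNIV f" and b: "AE t in lebesgue. norm (f t) \<le> B"
  shows "norm (f t) \<le> B"
proof (rule ccontr)
  assume "\<not> norm (f t) \<le> B"
  then have t: "t \<in> {t. B < norm (f t)}" by simp
  have o: "open {t. B < norm (f t)}"
    by (intro open_Collect_less continuous_intros f)
  have "AE t in lborel. t \<notin> {t. B < norm (f t)}"
    using b by (simp add: AE_completion_iff not_less)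
  then have "{t. B < norm (f t)} \<in> null_sets lborel"
    using o by (subst (asm) AE_iff_null_sets[symmetric]) auto
  then have "negligible {t. B < norm (f t)}"
    by (simp add: negligible_iff_null_sets null_sets_completionI)
  then show False
    using open_not_negligible[OF o] t by blast
qed

section \<open>Solutions supported in a fixed ball\<close>

locale plate_solution =
  fixes p :: "real \<Rightarrow> real \<Rightarrow> real"
    and q :: "('n::{finite, linorder} \<Rightarrow> nat) \<Rightarrow> real \<Rightarrow> real"
    and u :: "real \<Rightarrow> real ^ 'n::{finite, linorder} \<Rightarrow> real"
    and r :: real
  assumes p: "p \<in> Linfty_L1loc"
    and q: "\<And>\<alpha>. mi_order \<alpha> \<le> 2 \<Longrightarrow> q \<alpha> \<in> Linfty"
    and uC: "u \<in> C_L1loc" and uL: "u \<in> Linfty_L1loc"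
    and pu: "(\<lambda>t x. p t (x $ Min UNIV) * u t x) \<in> Linfty_L1loc"
    and weak: "weak_solution q p u"
    and r: "r > 0"
    and supp: "\<And>t. AE x in lebesgue. norm x \<ge> r \<longrightarrow> u t x = 0"
begin

abbreviation "\<iota> \<equiv> Min (UNIV :: 'n set)"

lemma restrict_support:
  fixes h :: "real ^ 'n::{finite, linorder} \<Rightarrow> real"
  assumes i: "set_integrable lebesgue (cball 0 r) h" and s: "AE x in lebesgue. norm x \<ge> r \<longrightarrow> h x = 0"
  shows "integrable lebesgue h" and "(LINT x|lebesgue. \<bar>h x\<bar>) = (LINT x:cball 0 r|lebesgue. \<bar>h x\<bar>)"
proof -
  have ae: "AE x in lebesgue. h x = indicator (cball 0 r) x *\<^sub>R h x"
    using s by eventually_elim (auto simp: indicator_def)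
  have i': "integrable lebesgue (\<lambda>x. indicator (cball 0 r) x *\<^sub>R h x)"
    using i by (simp add: set_integrable_def)
  have m: "h \<in> borel_measurable lebesgue"
    by (rule borel_measurable_lebesgue_cong_AE[OF _ ae]) (use i' in simp)
  have ae': "AE x in lebesgue. indicator (cball 0 r) x *\<^sub>R h x = h x"
    using ae by eventually_elim simp
  show "integrable lebesgue h"
    by (rule integrable_cong_AE_imp[OF i' m ae'])
  have ae2: "AE x in lebesgue. \<bar>h x\<bar> = indicator (cball 0 r) x *\<^sub>R \<bar>h x\<bar>"
    using s by eventually_elim (auto simp: indicator_def)
  show "(LINT x|lebesgue. \<bar>h x\<bar>) = (LINT x:cball 0 r|lebesgue. \<bar>h x\<bar>)"
    unfolding set_lebesgue_integral_def by (rule integral_lebesgue_cong_AE[OF ae2])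
qed

lemma u_integrable: "integrable lebesgue (u t)"
  by (rule restrict_support[OF _ supp]) (use uC in \<open>simp add: C_L1loc_def\<close>)

section \<open>Exponential moments of \<open>u\<close> and of p u\<close>

definition moment :: "('n \<Rightarrow> complex) \<Rightarrow> real \<Rightarrow> complex" where
  "moment \<theta> t = (LINT x|lebesgue. of_real (u t x) * wave \<theta> x)"

definition p_moment :: "('n \<Rightarrow> complex) \<Rightarrow> real \<Rightarrow> complex" where
  "p_moment \<theta> t = (LINT x|lebesgue. of_real (p t (x $ \<iota>) * u t x) * wave \<theta> x)"

lemma pu_supp: "AE x in lebesgue. norm x \<ge> r \<longrightarrow> p t (x $ \<iota>) * u t x = 0"
  using supp[of t] by eventually_elim simp

lemma u_bound: "\<exists>C\<ge>0. AE t in lebesgue. (LINT x|lebesgue. \<bar>u t x\<bar>) \<le> C"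
proof -
  obtain C where C: "C \<ge> 0" "AE t in lebesgue. u t \<in> borel_measurable lebesgue \<and> set_integrable lebesgue (cball 0 r) (u t)
     \<and> (LINT x:cball 0 r|lebesgue. \<bar>u t x\<bar>) \<le> C"
    using Linfty_L1loc_AE_bounded[OF uL, of "cball 0 r"] by auto
  have "AE t in lebesgue. (LINT x|lebesgue. \<bar>u t x\<bar>) \<le> C"
    using C(2) by eventually_elim (simp add: restrict_support(2)[OF _ supp])
  then show ?thesis using C(1) by blast
qed

lemma pu_bound: "\<exists>C\<ge>0. AE t in lebesgue. integrable lebesgue (\<lambda>x. p t (x $ \<iota>) * u t x)
   \<and> (LINT x|lebesgue. \<bar>p t (x $ \<iota>) * u t x\<bar>) \<le> C"
proof -
  obtain C where C: "C \<ge> 0" "AE t in lebesgue. (\<lambda>x. p t (x $ \<iota>) * u t x) \<in> borel_measurable lebesgue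
     \<and> set_integrable lebesgue (cball 0 r) (\<lambda>x. p t (x $ \<iota>) * u t x)
     \<and> (LINT x:cball 0 r|lebesgue. \<bar>p t (x $ \<iota>) * u t x\<bar>) \<le> C"
    using Linfty_L1loc_AE_bounded[OF pu, of "cball 0 r"] by auto
  have "AE t in lebesgue. integrable lebesgue (\<lambda>x. p t (x $ \<iota>) * u t x)
   \<and> (LINT x|lebesgue. \<bar>p t (x $ \<iota>) * u t x\<bar>) \<le> C"
    using C(2) by eventually_elim (simp add: restrict_support[OF _ pu_supp])
  then show ?thesis using C(1) by blast
qed

lemma moment_continuous: "continuous_on UNIV (moment \<theta>)"
proof (intro continuous_at_imp_continuous_on ballI)
  fix t :: real
  let ?E = "exp (\<Sum>i\<in>UNIV. \<bar>Re (\<theta> i)\<bar> * r)"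
  have bd: "norm (moment \<theta> s - moment \<theta> t) \<le> ?E * (LINT x:cball 0 r|lebesgue. \<bar>u s x - u t x\<bar>)" for s
  proof -
    have i: "integrable lebesgue (\<lambda>x. u s x - u t x)" using u_integrable by simp
    have s: "AE x in lebesgue. norm x \<ge> r \<longrightarrow> u s x - u t x = 0"
      using supp[of s] supp[of t] by eventually_elim simp
    have w: "integrable lebesgue (\<lambda>x. of_real (u t x) * wave \<theta> x)" for t
      by (rule integrable_times_wave[OF u_integrable supp, of _ "\<lambda>i. \<bar>Re (\<theta> i)\<bar>"]) simp
    have "moment \<theta> s - moment \<theta> t = (LINT x|lebesgue. of_real (u s x - u t x) * wave \<theta> x)"
      unfolding moment_def using w[of s] w[of t]
      by (simp add: left_diff_distrib)
    also have "norm \<dots> \<le> ?E * (LINT x|lebesgue. \<bar>u s x - u t x\<bar>)"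
      by (rule integrable_times_wave[OF i s]) simp
    also have "(LINT x|lebesgue. \<bar>u s x - u t x\<bar>) = (LINT x:cball 0 r|lebesgue. \<bar>u s x - u t x\<bar>)"
      by (rule restrict_support[OF _ s]) (use uC in \<open>auto simp: C_L1loc_def\<close>)
    finally show ?thesis .
  qed
  have "((\<lambda>s. ?E * (LINT x:cball 0 r|lebesgue. \<bar>u s x - u t x\<bar>)) \<longlongrightarrow> ?E * 0) (at t)"
    by (intro tendsto_mult tendsto_const) (use uC in \<open>auto simp: C_L1loc_def\<close>)
  then have "((\<lambda>s. moment \<theta> s - moment \<theta> t) \<longlongrightarrow> 0) (at t)"
    by (intro Lim_null_comparison[OF always_eventually[OF allI[OF bd]]]) simp
  then show "isCont (moment \<theta>) t"
    by (simp add: isCont_def LIM_zero_iff)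
qed

lemma moment_bounded: "\<exists>S. \<forall>t. norm (moment \<theta> t) \<le> S"
proof -
  obtain C where C: "AE t in lebesgue. (LINT x|lebesgue. \<bar>u t x\<bar>) \<le> C" using u_bound by blast
  let ?E = "exp (\<Sum>i\<in>UNIV. \<bar>Re (\<theta> i)\<bar> * r)"
  have le: "norm (moment \<theta> t) \<le> ?E * (LINT x|lebesgue. \<bar>u t x\<bar>)" for t
    unfolding moment_def by (rule integrable_times_wave[OF u_integrable supp]) simp
  have "AE t in lebesgue. norm (moment \<theta> t) \<le> ?E * C"
    using C
  proof eventually_elim
    case (elim t)
    show ?case
      by (rule order_trans[OF le mult_left_mono[OF elim]]) simp
  qed
  then show ?thesis
    using continuous_AE_bounded[OF moment_continuous] by blast
qed

lemma p_moment_measurable: "p_moment \<theta> \<in> borel_measurable lebesgue"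
  unfolding p_moment_def
  by (rule section_integral_measurable) (use pu in \<open>auto simp: Linfty_L1loc_def\<close>)

lemma q_measurable: "mi_order \<alpha> \<le> 2 \<Longrightarrow> q \<alpha> \<in> borel_measurable lebesgue"
  using q by (auto simp: Linfty_def)

lemma q_bound: "\<exists>B\<ge>0. AE t in lebesgue. (\<Sum>\<alpha> | mi_order \<alpha> \<le> 2. \<bar>q \<alpha> t\<bar>) \<le> B"
proof -
  obtain C where C: "\<And>\<alpha>. mi_order \<alpha> \<le> 2 \<Longrightarrow> C \<alpha> \<ge> 0 \<and> (AE t in lebesgue. \<bar>q \<alpha> t\<bar> \<le> C \<alpha>)"
    using Linfty_AE_bounded[OF q] by metis
  have "AE t in lebesgue. \<forall>\<alpha>\<in>{\<alpha>. mi_order \<alpha> \<le> 2}. \<bar>q \<alpha> t\<bar> \<le> C \<alpha>"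
    by (rule AE_finite_allI[OF finite_mi_order_le]) (use C in auto)
  then have "AE t in lebesgue. (\<Sum>\<alpha> | mi_order \<alpha> \<le> 2. \<bar>q \<alpha> t\<bar>) \<le> (\<Sum>\<alpha> | mi_order \<alpha> \<le> 2. C \<alpha>)"
    by eventually_elim (intro sum_mono, auto)
  moreover have "(\<Sum>\<alpha> | mi_order \<alpha> \<le> 2. C \<alpha>) \<ge> 0" by (intro sum_nonneg) (use C in auto)
  ultimately show ?thesis by blast
qed

text \<open>
  The lower-order terms are estimated by the moment itself and absorbed, which needs
  \<open>- Im \<sigma> \<ge> 4 B\<close>.
\<close>

lemma moment_bound:
  fixes \<theta> :: "'n \<Rightarrow> complex"
  defines "\<sigma> \<equiv> (\<Sum>i\<in>UNIV. (\<theta> i)\<^sup>2)"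
  assumes B: "B \<ge> 0" "AE t in lebesgue. (\<Sum>\<alpha> | mi_order \<alpha> \<le> 2. \<bar>q \<alpha> t\<bar>) \<le> B"
    and F: "AE t in lebesgue. norm (p_moment \<theta> t) \<le> F"
    and T: "T \<ge> 1" "\<And>i. norm (\<theta> i) \<le> T" and \<sigma>: "norm \<sigma> \<ge> T\<^sup>2 / 2" "Im \<sigma> < 0" "- Im \<sigma> \<ge> 4 * B"
  shows "norm (moment \<theta> t) \<le> 2 * F / (norm \<sigma> * (- Im \<sigma>))"
proof -
  \<comment> \<open>This supremum is finite by the assumed bound on \<open>u\<close>, before the
    equation is used; that makes it legitimate to absorb half of it at the end.\<close>
  define S where "S = (SUP t. norm (moment \<theta> t))"
  have bdd: "bdd_above (range (\<lambda>t. norm (moment \<theta> t)))"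
    using moment_bounded[of \<theta>] by (auto simp: bdd_above_def)
  have S: "norm (moment \<theta> t) \<le> S" for t
    unfolding S_def by (rule cSUP_upper[OF UNIV_I bdd])
  have S0: "S \<ge> 0" using S[of 0] norm_ge_zero order_trans by blast
  define Q where "Q t = (\<Sum>\<alpha> | mi_order \<alpha> \<le> 2. (-1) ^ mi_order \<alpha> * of_real (q \<alpha> t) * (\<Prod>i\<in>UNIV. \<theta> i ^ \<alpha> i))" for t
  have prod: "norm (\<Prod>i\<in>UNIV. \<theta> i ^ \<alpha> i) \<le> T\<^sup>2" if "mi_order \<alpha> \<le> 2" for \<alpha>
  proof -
    have "norm (\<Prod>i\<in>UNIV. \<theta> i ^ \<alpha> i) = (\<Prod>i\<in>UNIV. norm (\<theta> i) ^ \<alpha> i)"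
      by (simp add: prod_norm[symmetric] norm_power)
    also have "\<dots> \<le> (\<Prod>i\<in>UNIV. T ^ \<alpha> i)"
      by (intro prod_mono) (auto intro: power_mono T)
    also have "\<dots> = T ^ mi_order \<alpha>" by (simp add: mi_order_def power_sum)
    also have "\<dots> \<le> T\<^sup>2" using T(1) that by (intro power_increasing)
    finally show ?thesis .
  qed
  have Qle: "AE t in lebesgue. norm (Q t) \<le> B * T\<^sup>2"
    using B(2)
  proof eventually_elim
    case (elim t)
    have "norm (Q t) \<le> (\<Sum>\<alpha> | mi_order \<alpha> \<le> 2. \<bar>q \<alpha> t\<bar> * T\<^sup>2)"
      unfolding Q_def
      by (rule sum_norm_le) (auto simp: norm_mult norm_power intro!: mult_left_mono prod)
    also have "\<dots> \<le> B * T\<^sup>2"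
      unfolding sum_distrib_right[symmetric] by (rule mult_right_mono[OF elim]) simp
    finally show ?case .
  qed
  define g where "g t = Q t * moment \<theta> t + p_moment \<theta> t" for t
  have gm: "g \<in> borel_measurable lebesgue"
  proof -
    have mm: "moment \<theta> \<in> borel_measurable lebesgue"
      using borel_measurable_continuous_onI[OF moment_continuous] by (intro measurable_completion) simp
    have "(\<lambda>t. (-1) ^ mi_order \<alpha> * of_real (q \<alpha> t) * (\<Prod>i\<in>UNIV. \<theta> i ^ \<alpha> i)) \<in> borel_measurable lebesgue"
      if "mi_order \<alpha> \<le> 2" for \<alpha>
      by (intro borel_measurable_times borel_measurable_const measurable_compose[OF q_measurable[OF that]]) simp
    then have "Q \<in> borel_measurable lebesgue"
      unfolding Q_def by (intro borel_measurable_sum) auto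
    then show ?thesis
      unfolding g_def by (intro borel_measurable_add borel_measurable_times mm p_moment_measurable)
  qed
  have gB: "AE t in lebesgue. norm (g t) \<le> B * T\<^sup>2 * S + F"
    using Qle F
  proof eventually_elim
    case (elim t)
    have "norm (Q t * moment \<theta> t) \<le> B * T\<^sup>2 * S"
      unfolding norm_mult using elim(1) S B(1) by (intro mult_mono) auto
    then show ?case
      unfolding g_def using elim(2) norm_triangle_ineq[of "Q t * moment \<theta> t" "p_moment \<theta> t"] by linarith
  qed
  obtain C where C: "AE t in lebesgue. integrable lebesgue (\<lambda>x. p t (x $ \<iota>) * u t x)
   \<and> (LINT x|lebesgue. \<bar>p t (x $ \<iota>) * u t x\<bar>) \<le> C"
    using pu_bound by blast
  then have pu_int: "AE t in lebesgue. integrable lebesgue (\<lambda>x. p t (x $ \<iota>) * u t x)"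
    by eventually_elim simp
  \<comment> \<open>Multiplication by \<i> turns + \<sigma>^2 into - \<kappa>^2 and the negative
    imaginary part of \<sigma> into a positive real part, while the modulus is unchanged.\<close>
  let ?\<kappa> = "\<i> * \<sigma>"
  have bnd: "norm (moment \<theta> t) \<le> (B * T\<^sup>2 * S + F) / (norm ?\<kappa> * Re ?\<kappa>)" for t
  proof (rule weak_second_order_bound[OF moment_continuous S gm gB])
    show "Re ?\<kappa> > 0" using \<sigma>(2) by simp
    fix \<phi> :: "real \<Rightarrow> real"
    assume \<phi>: "smooth \<phi>" "\<exists>d. \<forall>x. \<bar>x\<bar> > d \<longrightarrow> \<phi> x = 0"
    have "?\<kappa>\<^sup>2 = - \<sigma>\<^sup>2" by (simp add: power_mult_distrib)
    then show "(LINT t|lebesgue. deriv (deriv \<phi>) t * moment \<theta> t - ?\<kappa>\<^sup>2 * (\<phi> t * moment \<theta> t) + \<phi> t * g t) = 0"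
      using weak_solution_plane_wave[OF weak u_integrable pu_int supp less_imp_le[OF r] \<phi>, of \<theta>]
      by (simp add: moment_def p_moment_def g_def Q_def \<sigma>_def)
  qed
  define n where "n = norm \<sigma>"
  define i where "i = - Im \<sigma>"
  have n0: "n > 0" using \<sigma>(1) T(1) by (smt (verit) n_def one_le_power divide_pos_pos)
  have i0: "i > 0" using \<sigma>(2) by (simp add: i_def)
  have "norm (moment \<theta> t) \<le> S / 2 + F / (n * i)" for t
  proof -
    \<comment> \<open>T^2 bounds every symbol of order at most 2, and one factor |\<sigma>| of the
      denominator pays for it. The other factor is at least 4 B and leaves the constant 1/2.\<close>
    have "B * T\<^sup>2 * S \<le> B * (2 * n) * S"
      using \<sigma>(1) B(1) S0 by (intro mult_right_mono mult_left_mono) (auto simp: n_def)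
    also have "\<dots> = (4 * B) * n * S / 2" by simp
    also have "\<dots> \<le> i * n * S / 2"
      using \<sigma>(3) n0 S0 by (intro divide_right_mono mult_right_mono) (auto simp: i_def)
    finally have "(B * T\<^sup>2 * S + F) / (n * i) \<le> (i * n * S / 2 + F) / (n * i)"
      using n0 i0 by (intro divide_right_mono) auto
    also have "\<dots> = S / 2 + F / (n * i)" using n0 i0 by (simp add: field_simps)
    finally show ?thesis
      using bnd[of t] by (simp add: norm_mult n_def i_def)
  qed
  then have "S \<le> S / 2 + F / (n * i)"
    unfolding S_def by (intro cSUP_least) auto
  then have "S \<le> 2 * F / (n * i)" by simp
  then show ?thesis using S[of t] unfolding n_def i_def by linarith
qed

section \<open>Exponents with one oscillating component\<close>

definition freq :: "('n \<Rightarrow> real) \<Rightarrow> real \<Rightarrow> real \<Rightarrow> nat \<Rightarrow> 'n \<Rightarrow> complex" where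
  "freq \<xi> \<epsilon> \<Lambda> k i = (if i = \<iota> then Complex \<Lambda> (- half_freq \<epsilon> k) else of_real (\<xi> i))"

text \<open>The modulus of \<open>wave (freq \<xi> \<epsilon> \<Lambda> k)\<close>. It is
  independent of \<open>k\<close>, so all these moments are Fourier coefficients of one weighted
  function.\<close>

definition weight :: "('n \<Rightarrow> real) \<Rightarrow> real \<Rightarrow> real ^ 'n::{finite, linorder} \<Rightarrow> real" where
  "weight \<xi> \<Lambda> x = exp (\<Sum>i\<in>UNIV. (if i = \<iota> then \<Lambda> else \<xi> i) * x $ i)"

lemma wave_freq: "wave (freq \<xi> \<epsilon> \<Lambda> k) x = of_real (weight \<xi> \<Lambda> x) * cis (- (half_freq \<epsilon> k * x $ \<iota>))"
proof -
  have "(\<Sum>i\<in>UNIV. freq \<xi> \<epsilon> \<Lambda> k i * of_real (x $ i))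
     = (\<Sum>i\<in>UNIV. of_real ((if i = \<iota> then \<Lambda> else \<xi> i) * x $ i) + (if i = \<iota> then \<i> * of_real (- (half_freq \<epsilon> k * x $ \<iota>)) else 0))"
    by (intro sum.cong) (auto simp: freq_def complex_eq_iff)
  also have "\<dots> = of_real (\<Sum>i\<in>UNIV. (if i = \<iota> then \<Lambda> else \<xi> i) * x $ i) + \<i> * of_real (- (half_freq \<epsilon> k * x $ \<iota>))"
    unfolding sum.distrib of_real_sum by simp
  finally show ?thesis
    by (simp only: wave_def weight_def exp_add cis_conv_exp exp_of_real)
qed

lemma weighted_integrable:
  assumes h: "integrable lebesgue h" and s: "AE x in lebesgue. norm x \<ge> r \<longrightarrow> h x = 0"
  shows "integrable lebesgue (\<lambda>x. h x * weight \<xi> \<Lambda> x)"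
proof -
  have "integrable lebesgue (\<lambda>x. of_real (h x) * wave (\<lambda>i. of_real (if i = \<iota> then \<Lambda> else \<xi> i)) x)"
    by (rule integrable_times_wave(1)[OF h s order_refl])
  moreover have "of_real (h x) * wave (\<lambda>i. of_real (if i = \<iota> then \<Lambda> else \<xi> i)) x = of_real (h x * weight \<xi> \<Lambda> x)" for x
    by (simp only: wave_def weight_def of_real_mult[symmetric] of_real_sum[symmetric] exp_of_real)
  ultimately show ?thesis by (simp only: complex_of_real_integrable_eq)
qed

text \<open>The square of the first component has modulus \<Lambda>^2 + \<omega>^2 and imaginary
  part -2 \<Lambda> \<omega>. The other squares are real with sum at most \<Lambda>^2 / 2, so they
  cost at most half of the modulus and leave the imaginary part alone.\<close>

lemma freq_bounds:
  fixes \<xi> \<epsilon> \<Lambda> k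
  defines "\<omega> \<equiv> half_freq \<epsilon> k" and "\<sigma> \<equiv> (\<Sum>i\<in>UNIV. (freq \<xi> \<epsilon> \<Lambda> k i)\<^sup>2)"
  assumes \<epsilon>: "\<epsilon> > 0" and \<Lambda>: "\<Lambda> \<ge> 1" "\<And>i. \<bar>\<xi> i\<bar> \<le> \<Lambda>" "(\<Sum>i\<in>UNIV. (\<xi> i)\<^sup>2) \<le> \<Lambda>\<^sup>2 / 2"
  shows "sqrt (\<Lambda>\<^sup>2 + \<omega>\<^sup>2) \<ge> 1" "norm (freq \<xi> \<epsilon> \<Lambda> k i) \<le> sqrt (\<Lambda>\<^sup>2 + \<omega>\<^sup>2)"
    and "norm \<sigma> \<ge> (sqrt (\<Lambda>\<^sup>2 + \<omega>\<^sup>2))\<^sup>2 / 2" "- Im \<sigma> = 2 * \<Lambda> * \<omega>"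
proof -
  have "1 \<le> \<Lambda>\<^sup>2 + \<omega>\<^sup>2" using \<Lambda>(1) by (simp add: add_increasing2)
  then show "sqrt (\<Lambda>\<^sup>2 + \<omega>\<^sup>2) \<ge> 1" by simp
  have "\<bar>\<xi> i\<bar> \<le> sqrt (\<Lambda>\<^sup>2 + \<omega>\<^sup>2)"
    by (rule order_trans[OF \<Lambda>(2)]) (use \<Lambda>(1) in \<open>auto intro: real_le_rsqrt\<close>)
  then show "norm (freq \<xi> \<epsilon> \<Lambda> k i) \<le> sqrt (\<Lambda>\<^sup>2 + \<omega>\<^sup>2)"
    by (cases "i = \<iota>") (simp_all add: freq_def cmod_def \<omega>_def)
  define s where "s = (\<Sum>i\<in>UNIV - {\<iota>}. (\<xi> i)\<^sup>2)"
  have s: "0 \<le> s" "s \<le> \<Lambda>\<^sup>2 / 2"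
  proof -
    show "0 \<le> s" unfolding s_def by (intro sum_nonneg) simp
    have "s \<le> (\<Sum>i\<in>UNIV. (\<xi> i)\<^sup>2)" unfolding s_def by (intro sum_mono2) auto
    then show "s \<le> \<Lambda>\<^sup>2 / 2" using \<Lambda>(3) by simp
  qed
  have \<sigma>: "\<sigma> = of_real s + (Complex \<Lambda> (- \<omega>))\<^sup>2"
  proof -
    have "\<sigma> = (freq \<xi> \<epsilon> \<Lambda> k \<iota>)\<^sup>2 + (\<Sum>i\<in>UNIV - {\<iota>}. (freq \<xi> \<epsilon> \<Lambda> k i)\<^sup>2)"
      unfolding \<sigma>_def by (rule sum.remove) auto
    also have "(\<Sum>i\<in>UNIV - {\<iota>}. (freq \<xi> \<epsilon> \<Lambda> k i)\<^sup>2) = of_real s"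
      unfolding s_def of_real_sum by (intro sum.cong) (auto simp: freq_def)
    finally show ?thesis by (simp add: freq_def \<omega>_def)
  qed
  have "norm ((Complex \<Lambda> (- \<omega>))\<^sup>2) = \<Lambda>\<^sup>2 + \<omega>\<^sup>2"
    unfolding norm_power by (simp add: cmod_def)
  moreover have "norm ((Complex \<Lambda> (- \<omega>))\<^sup>2) \<le> norm \<sigma> + s"
    using norm_triangle_ineq4[of \<sigma> "of_real s"] s(1) unfolding \<sigma> by simp
  moreover have "(sqrt (\<Lambda>\<^sup>2 + \<omega>\<^sup>2))\<^sup>2 = \<Lambda>\<^sup>2 + \<omega>\<^sup>2" by simp
  ultimately show "norm \<sigma> \<ge> (sqrt (\<Lambda>\<^sup>2 + \<omega>\<^sup>2))\<^sup>2 / 2"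
    using s(2) zero_le_power2[of \<omega>] by linarith
  show "- Im \<sigma> = 2 * \<Lambda> * \<omega>"
    unfolding \<sigma> by (simp add: power2_eq_square)
qed

text \<open>The denominator |\<sigma>| |Im \<sigma>| is at least (\<omega>^2 / 2) (2 \<Lambda>
  \<omega>) = \<Lambda> \<omega>^3, and \<omega> \<ge> \<epsilon> (k + 1) / 2 gives 16 = 2 * 8. The
  cube of k + 1 is relaxed to a square, which suffices for summability; the factor 1/\<Lambda> is
  kept for smallness.\<close>

lemma freq_moment_bound:
  assumes \<epsilon>: "\<epsilon> > 0" and \<Lambda>: "\<Lambda> \<ge> 1" "\<And>i. \<bar>\<xi> i\<bar> \<le> \<Lambda>" "(\<Sum>i\<in>UNIV. (\<xi> i)\<^sup>2) \<le> \<Lambda>\<^sup>2 / 2" "\<Lambda> \<ge> 4 * B / \<epsilon>"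
    and B: "B \<ge> 0" "AE t in lebesgue. (\<Sum>\<alpha> | mi_order \<alpha> \<le> 2. \<bar>q \<alpha> t\<bar>) \<le> B"
    and F: "F \<ge> 0" "AE t in lebesgue. norm (p_moment (freq \<xi> \<epsilon> \<Lambda> k) t) \<le> F"
  shows "norm (moment (freq \<xi> \<epsilon> \<Lambda> k) t) \<le> 16 * F / (\<Lambda> * \<epsilon> ^ 3) * (1 / (real (Suc k))\<^sup>2)"
proof -
  define \<omega> where "\<omega> = half_freq \<epsilon> k"
  define \<sigma> where "\<sigma> = (\<Sum>i\<in>UNIV. (freq \<xi> \<epsilon> \<Lambda> k i)\<^sup>2)"
  note fb = freq_bounds[OF \<epsilon> \<Lambda>(1,2,3), of k, folded \<omega>_def \<sigma>_def]
  have "\<omega> \<ge> \<epsilon> * real (Suc k) / 2" "\<omega> \<ge> \<epsilon> / 2"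
    using \<epsilon> by (auto simp: \<omega>_def half_freq_def field_simps)
  then have \<omega>: "\<omega> \<ge> \<epsilon> * real (Suc k) / 2" "\<omega> \<ge> \<epsilon> / 2" "\<omega> > 0"
    using \<epsilon> by auto
  have "norm (moment (freq \<xi> \<epsilon> \<Lambda> k) t) \<le> 2 * F / (norm \<sigma> * (- Im \<sigma>))"
  proof (rule moment_bound[OF B F(2), where T = "sqrt (\<Lambda>\<^sup>2 + \<omega>\<^sup>2)", folded \<sigma>_def])
    show "sqrt (\<Lambda>\<^sup>2 + \<omega>\<^sup>2) \<ge> 1" by (rule fb)
    show "norm (freq \<xi> \<epsilon> \<Lambda> k i) \<le> sqrt (\<Lambda>\<^sup>2 + \<omega>\<^sup>2)" for i by (rule fb)
    show "norm \<sigma> \<ge> (sqrt (\<Lambda>\<^sup>2 + \<omega>\<^sup>2))\<^sup>2 / 2" by (rule fb)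
    have "0 < 2 * \<Lambda> * \<omega>" using \<Lambda>(1) \<omega>(3) by simp
    then show "Im \<sigma> < 0" using fb(4) by linarith
    have "4 * B \<le> \<Lambda> * \<epsilon>" using \<Lambda>(4) \<epsilon> by (simp add: field_simps)
    also have "\<dots> \<le> \<Lambda> * (2 * \<omega>)" using \<Lambda>(1) \<omega>(2) by (intro mult_left_mono) auto
    finally show "- Im \<sigma> \<ge> 4 * B" using fb(4) by (simp add: mult_ac)
  qed
  also have "\<dots> \<le> 2 * F / (\<Lambda> * \<epsilon> ^ 3 * (real (Suc k))\<^sup>2 / 8)"
  proof (rule divide_left_mono)
    have "(\<epsilon> * real (Suc k) / 2) ^ 3 \<le> \<omega> ^ 3"
      using \<omega>(1) \<epsilon> by (intro power_mono) auto
    moreover have "\<epsilon> ^ 3 * (real (Suc k))\<^sup>2 / 8 \<le> (\<epsilon> * real (Suc k) / 2) ^ 3"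
    proof -
      have "(real (Suc k))\<^sup>2 \<le> (real (Suc k)) ^ 3" by (intro power_increasing) auto
      then have "\<epsilon> ^ 3 * (real (Suc k))\<^sup>2 \<le> \<epsilon> ^ 3 * (real (Suc k)) ^ 3"
        using \<epsilon> by (intro mult_left_mono) auto
      then show ?thesis by (simp only: power_mult_distrib power_divide) simp
    qed
    ultimately have "\<epsilon> ^ 3 * (real (Suc k))\<^sup>2 / 8 \<le> \<omega> ^ 3" by linarith
    then have "\<Lambda> * (\<epsilon> ^ 3 * (real (Suc k))\<^sup>2 / 8) \<le> \<Lambda> * \<omega> ^ 3"
      using \<Lambda>(1) by (intro mult_left_mono) auto
    also have "\<dots> = \<omega>\<^sup>2 / 2 * (2 * \<Lambda> * \<omega>)" by (simp add: power2_eq_square power3_eq_cube)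
    also have "\<dots> \<le> norm \<sigma> * (2 * \<Lambda> * \<omega>)"
    proof (rule mult_right_mono)
      have "\<omega>\<^sup>2 / 2 \<le> (sqrt (\<Lambda>\<^sup>2 + \<omega>\<^sup>2))\<^sup>2 / 2" by simp
      then show "\<omega>\<^sup>2 / 2 \<le> norm \<sigma>" using fb(3) by linarith
    qed (use \<Lambda>(1) \<omega>(3) in simp)
    finally show le: "\<Lambda> * \<epsilon> ^ 3 * (real (Suc k))\<^sup>2 / 8 \<le> norm \<sigma> * (- Im \<sigma>)"
      using fb(4) by (simp add: mult_ac)
    have "0 < \<Lambda> * \<epsilon> ^ 3 * (real (Suc k))\<^sup>2 / 8" using \<Lambda>(1) \<epsilon> by simp
    then show "0 < norm \<sigma> * (- Im \<sigma>) * (\<Lambda> * \<epsilon> ^ 3 * (real (Suc k))\<^sup>2 / 8)"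
      by (intro mult_pos_pos[OF less_le_trans[OF _ le]])
  qed (use F(1) in simp)
  also have "\<dots> = 16 * F / (\<Lambda> * \<epsilon> ^ 3) * (1 / (real (Suc k))\<^sup>2)" by simp
  finally show ?thesis .
qed

section \<open>The contraction between moments of \<open>u\<close> and of p u\<close>

lemma inverse_squares: "summable (\<lambda>k. 1 / (real (Suc k))\<^sup>2)"
  using summable_Suc_iff[of "\<lambda>k. 1 / (real k)\<^sup>2"] inverse_power_summable[of 2, where 'a = real]
  by (simp add: inverse_eq_divide)

text \<open>The real parts of the exponents do not depend on \<open>k\<close>, so one constant
  serves all frequencies; this starts the iteration.\<close>

lemma p_moment_initial_bound:
  "\<exists>F\<ge>0. \<forall>k. AE t in lebesgue. norm (p_moment (freq \<xi> \<epsilon> \<Lambda> k) t) \<le> F"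
proof -
  obtain C where C: "C \<ge> 0" "AE t in lebesgue. integrable lebesgue (\<lambda>x. p t (x $ \<iota>) * u t x)
   \<and> (LINT x|lebesgue. \<bar>p t (x $ \<iota>) * u t x\<bar>) \<le> C"
    using pu_bound by blast
  let ?A = "\<lambda>i. \<bar>if i = \<iota> then \<Lambda> else \<xi> i\<bar>"
  let ?E = "exp (\<Sum>i\<in>UNIV. ?A i * r)"
  have "AE t in lebesgue. norm (p_moment (freq \<xi> \<epsilon> \<Lambda> k) t) \<le> ?E * C" for k
    using C(2)
  proof eventually_elim
    case (elim t)
    have "norm (p_moment (freq \<xi> \<epsilon> \<Lambda> k) t) \<le> ?E * (LINT x|lebesgue. \<bar>p t (x $ \<iota>) * u t x\<bar>)"
      unfolding p_moment_def
      by (rule integrable_times_wave(2)[OF conjunct1[OF elim] pu_supp]) (simp add: freq_def)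
    then show ?case
      by (rule order_trans[OF _ mult_left_mono[OF conjunct2[OF elim]]]) simp
  qed
  then show ?thesis using C(1) by (intro exI[of _ "?E * C"]) simp
qed

lemma component_measurable: "(\<lambda>x. x $ \<iota>) \<in> borel_measurable (lebesgue :: (real ^ 'n::{finite, linorder}) measure)"
  by (intro measurable_completion) (simp add: borel_measurable_continuous_onI continuous_intros)

lemma weighted_supp:
  assumes "pi / \<epsilon> > r"
  shows "AE x in lebesgue. u t x * weight \<xi> \<Lambda> x \<noteq> 0 \<longrightarrow> \<bar>x $ \<iota>\<bar> < pi / \<epsilon>"
  using supp[of t]
proof eventually_elim
  case (elim x)
  show ?case
    using elim component_le_norm_cart[of x \<iota>] assms by (cases "norm x \<ge> r") auto
qed

lemma moment_freq: "moment (freq \<xi> \<epsilon> \<Lambda> k) t = (LINT x|lebesgue. of_real (u t x * weight \<xi> \<Lambda> x) * cis (- (half_freq \<epsilon> k * x $ \<iota>)))"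
  by (simp add: moment_def wave_freq mult.assoc)

text \<open>
  Although \<open>p\<close> is only integrable in \<open>x\<^sub>1\<close>, its moments are controlled because the
  \<open>x\<^sub>1\<close>-marginal of the weighted solution is a bounded function.
\<close>

lemma p_moment_improved_bound:
  assumes \<epsilon>: "\<epsilon> > 0" "pi / \<epsilon> > r"
    and P: "AE t in lebesgue. p t \<in> borel_measurable lebesgue \<and> set_integrable lebesgue {- pi / \<epsilon>..pi / \<epsilon>} (p t)
       \<and> (LINT y:{- pi / \<epsilon>..pi / \<epsilon>}|lebesgue. \<bar>p t y\<bar>) \<le> P"
    and summ: "\<And>t. summable (\<lambda>k. norm (moment (freq \<xi> \<epsilon> \<Lambda> k) t))"
    and H: "\<And>t. (\<Sum>k. norm (moment (freq \<xi> \<epsilon> \<Lambda> k) t)) \<le> H" "H \<ge> 0"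
  shows "AE t in lebesgue. norm (p_moment (freq \<xi> \<epsilon> \<Lambda> k) t) \<le> \<epsilon> / pi * H * P"
proof -
  let ?I = "{- pi / \<epsilon>..pi / \<epsilon>}"
  obtain C where C: "AE t in lebesgue. integrable lebesgue (\<lambda>x. p t (x $ \<iota>) * u t x)
   \<and> (LINT x|lebesgue. \<bar>p t (x $ \<iota>) * u t x\<bar>) \<le> C"
    using pu_bound by blast
  show ?thesis
    using P C
  proof eventually_elim
    case (elim t)
    let ?c = "\<lambda>k. moment (freq \<xi> \<epsilon> \<Lambda> k) t"
    let ?W = "\<lambda>x. u t x * weight \<xi> \<Lambda> x"
    \<comment> \<open>The marginal estimate composes the coefficient with the first coordinate and
      asks for a Borel function. \<open>AE_lebesgue_component\<close> carries the exchange of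
      \<open>p t\<close> for P' over to integrals in space.\<close>
    obtain P' where P': "P' \<in> borel_measurable lborel" "AE y in lborel. p t y = P' y"
      using completion_ex_borel_measurable_real[of "p t" lborel] elim(1) by blast
    have P'b: "P' \<in> borel_measurable borel" using P'(1) by simp
    have ae: "AE y in lebesgue. p t y = P' y" by (rule AE_completion[OF P'(2)])
    have aex: "AE x in lebesgue. p t ((x :: real ^ 'n::{finite, linorder}) $ \<iota>) = P' (x $ \<iota>)"
      by (rule AE_lebesgue_component[OF ae])
    have P'm: "P' \<in> borel_measurable lebesgue" by (rule measurable_completion[OF P'(1)])
    have PIs: "integrable lebesgue (\<lambda>y. indicator ?I y *\<^sub>R P' y)"
    proof (rule integrable_cong_AE_imp)
      show "integrable lebesgue (\<lambda>y. indicator ?I y *\<^sub>R p t y)"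
        using elim(1) by (simp add: set_integrable_def)
      show "(\<lambda>y. indicator ?I y *\<^sub>R P' y) \<in> borel_measurable lebesgue"
        by (intro borel_measurable_scaleR borel_measurable_indicator P'm) simp
      show "AE y in lebesgue. indicator ?I y *\<^sub>R p t y = indicator ?I y *\<^sub>R P' y"
        using ae by eventually_elim simp
    qed
    then have PI: "integrable (lebesgue_on ?I) P'"
      by (subst integrable_restrict_space) auto
    have "(LINT y|lebesgue_on ?I. \<bar>P' y\<bar>) = (LINT y|lebesgue. indicator ?I y *\<^sub>R \<bar>P' y\<bar>)"
      by (subst integral_restrict_space) auto
    also have "\<dots> = (LINT y:?I|lebesgue. \<bar>p t y\<bar>)"
      unfolding set_lebesgue_integral_def
      by (rule integral_lebesgue_cong_AE) (use ae in \<open>eventually_elim, simp\<close>)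
    finally have PP: "(LINT y|lebesgue_on ?I. \<bar>P' y\<bar>) \<le> P" using elim(1) by simp
    have Wi: "integrable lebesgue ?W" by (rule weighted_integrable[OF u_integrable supp])
    have aeW: "AE x in lebesgue. p t (x $ \<iota>) * u t x * weight \<xi> \<Lambda> x = ?W x * P' (x $ \<iota>)"
      using aex by eventually_elim simp
    have WP: "integrable lebesgue (\<lambda>x. ?W x * P' (x $ \<iota>))"
    proof (rule integrable_cong_AE_imp[OF _ _ aeW])
      show "integrable lebesgue (\<lambda>x. p t (x $ \<iota>) * u t x * weight \<xi> \<Lambda> x)"
        by (rule weighted_integrable[OF conjunct1[OF elim(2)] pu_supp])
      show "(\<lambda>x. ?W x * P' (x $ \<iota>)) \<in> borel_measurable lebesgue"
        by (rule borel_measurable_times[OF borel_measurable_integrable[OF Wi]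
              measurable_compose[OF component_measurable P'b]])
    qed
    have "p_moment (freq \<xi> \<epsilon> \<Lambda> k) t = (LINT x|lebesgue. of_real (?W x * P' (x $ \<iota>)) * cis (- half_freq \<epsilon> k * x $ \<iota>))"
      unfolding p_moment_def wave_freq
      by (rule integral_lebesgue_cong_AE) (use aex in \<open>eventually_elim, simp\<close>)
    also have "norm \<dots> \<le> \<epsilon> / pi * (\<Sum>k. norm (?c k)) * (LINT y|lebesgue_on ?I. \<bar>P' y\<bar>)"
      by (rule norm_marginal_product_le[OF \<epsilon>(1) summ Wi component_measurable weighted_supp[OF \<epsilon>(2)] moment_freq[symmetric] P'b WP PI])
    also have "\<dots> \<le> \<epsilon> / pi * H * P"
      using \<epsilon>(1) H PP suminf_nonneg[OF summ]
      by (intro mult_mono mult_nonneg_nonneg integral_nonneg_AE) auto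
    finally show ?case .
  qed
qed

text \<open>A uniform essential bound G on the moments of p u bounds the moments of \<open>u\<close>
  by a summable sequence, hence the marginal, hence the moments of p u again, now by (K / \<Lambda>)
  G \<le> G / 2. Repeating this n times gives F / 2^n, and the bounds on the moments of
  \<open>u\<close> tend to 0.\<close>

lemma weighted_moments_vanish:
  "\<exists>\<epsilon> \<Lambda>. \<epsilon> > 0 \<and> pi / \<epsilon> > r \<and> (\<forall>k t. moment (freq \<xi> \<epsilon> \<Lambda> k) t = 0)"
proof -
  \<comment> \<open>Half a period is r + 1, so the x_1-support lies strictly inside the period
    interval.\<close>
  define \<epsilon> where "\<epsilon> = pi / (r + 1)"
  have \<epsilon>: "\<epsilon> > 0" "pi / \<epsilon> > r" using r by (auto simp: \<epsilon>_def)
  obtain B where B: "B \<ge> 0" "AE t in lebesgue. (\<Sum>\<alpha> | mi_order \<alpha> \<le> 2. \<bar>q \<alpha> t\<bar>) \<le> B"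
    using q_bound by blast
  obtain P where P: "P \<ge> 0" "AE t in lebesgue. p t \<in> borel_measurable lebesgue \<and> set_integrable lebesgue {- pi / \<epsilon>..pi / \<epsilon>} (p t)
       \<and> (LINT y:{- pi / \<epsilon>..pi / \<epsilon>}|lebesgue. \<bar>p t y\<bar>) \<le> P"
    using Linfty_L1loc_AE_bounded[OF p compact_Icc] by blast
  define Z where "Z = (\<Sum>k. 1 / (real (Suc k))\<^sup>2)"
  have Z: "Z \<ge> 0" unfolding Z_def by (rule suminf_nonneg[OF inverse_squares]) simp
  define s where "s = (\<Sum>i\<in>UNIV. (\<xi> i)\<^sup>2)"
  \<comment> \<open>The round trip multiplies a bound by K / \<Lambda>. K is fixed by \<epsilon> and
    P before \<Lambda> is chosen.\<close>
  define K where "K = \<epsilon> / pi * (16 / \<epsilon> ^ 3 * Z) * P"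
  \<comment> \<open>One summand per requirement: \<Lambda> \<ge> 1; the real squares stay below
    \<Lambda>^2 / 2 (from \<Lambda> \<ge> 2 s and \<Lambda> \<ge> 1); each |\<xi> i| is at most
    \<Lambda>; the \<open>q\<close>-terms can be absorbed; the round trip halves.\<close>
  define \<Lambda> where "\<Lambda> = 1 + 2 * s + (\<Sum>i\<in>UNIV. \<bar>\<xi> i\<bar>) + 4 * B / \<epsilon> + 2 * K"
  have s: "s \<ge> 0" unfolding s_def by (intro sum_nonneg) simp
  have K: "K \<ge> 0" unfolding K_def using \<epsilon>(1) Z P(1) by simp
  have a: "\<bar>\<xi> i\<bar> \<le> (\<Sum>i\<in>UNIV. \<bar>\<xi> i\<bar>)" for i by (intro member_le_sum) auto
  have a0: "(\<Sum>i\<in>UNIV. \<bar>\<xi> i\<bar>) \<ge> 0" by (intro sum_nonneg) simp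
  have b0: "4 * B / \<epsilon> \<ge> 0" using B(1) \<epsilon>(1) by simp
  have \<Lambda>: "\<Lambda> \<ge> 1" "\<And>i. \<bar>\<xi> i\<bar> \<le> \<Lambda>" "\<Lambda> \<ge> 4 * B / \<epsilon>" "\<Lambda> \<ge> 2 * K" "\<Lambda> \<ge> 2 * s"
    using s K a a0 b0 by (auto simp: \<Lambda>_def intro: order_trans[OF a])
  have \<Lambda>s: "(\<Sum>i\<in>UNIV. (\<xi> i)\<^sup>2) \<le> \<Lambda>\<^sup>2 / 2"
  proof -
    have "\<Lambda> * 1 \<le> \<Lambda> * \<Lambda>" using \<Lambda>(1) by (intro mult_left_mono) auto
    then show ?thesis using \<Lambda>(5) unfolding s_def power2_eq_square by simp
  qed
  obtain F where F: "F \<ge> 0" "\<And>k. AE t in lebesgue. norm (p_moment (freq \<xi> \<epsilon> \<Lambda> k) t) \<le> F"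
    using p_moment_initial_bound[of \<xi> \<epsilon> \<Lambda>] by blast
  have step: "norm (moment (freq \<xi> \<epsilon> \<Lambda> k) t) \<le> 16 * G / (\<Lambda> * \<epsilon> ^ 3) * (1 / (real (Suc k))\<^sup>2)"
    if "G \<ge> 0" "\<And>k. AE t in lebesgue. norm (p_moment (freq \<xi> \<epsilon> \<Lambda> k) t) \<le> G" for G k t
    by (rule freq_moment_bound[OF \<epsilon>(1) \<Lambda>(1,2) \<Lambda>s \<Lambda>(3) B that(1) that(2)])
  have iter: "AE t in lebesgue. norm (p_moment (freq \<xi> \<epsilon> \<Lambda> k) t) \<le> F / 2 ^ n" for n k
  proof (induction n arbitrary: k)
    case 0
    then show ?case using F(2) by simp
  next
    case (Suc n)
    define G where "G = F / 2 ^ n"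
    have G: "G \<ge> 0" using F(1) by (simp add: G_def)
    define D where "D = 16 * G / (\<Lambda> * \<epsilon> ^ 3)"
    have D: "D \<ge> 0" using G \<Lambda>(1) \<epsilon>(1) by (simp add: D_def)
    have le: "norm (moment (freq \<xi> \<epsilon> \<Lambda> k) t) \<le> D * (1 / (real (Suc k))\<^sup>2)" for k t
      unfolding D_def by (rule step[OF G]) (use Suc in \<open>simp add: G_def\<close>)
    have summ: "summable (\<lambda>k. norm (moment (freq \<xi> \<epsilon> \<Lambda> k) t))" for t
      by (rule summable_comparison_test'[OF summable_mult[OF inverse_squares, of D], of 0]) (use le in simp)
    have H: "(\<Sum>k. norm (moment (freq \<xi> \<epsilon> \<Lambda> k) t)) \<le> D * Z" for t
    proof -
      have "(\<Sum>k. norm (moment (freq \<xi> \<epsilon> \<Lambda> k) t)) \<le> (\<Sum>k. D * (1 / (real (Suc k))\<^sup>2))"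
        by (rule suminf_le[OF le summ summable_mult[OF inverse_squares]])
      also have "\<dots> = D * Z" unfolding Z_def by (rule suminf_mult[OF inverse_squares])
      finally show ?thesis .
    qed
    have "AE t in lebesgue. norm (p_moment (freq \<xi> \<epsilon> \<Lambda> k) t) \<le> \<epsilon> / pi * (D * Z) * P"
      by (rule p_moment_improved_bound[OF \<epsilon> P(2) summ H]) (use D Z in simp)
    moreover have "\<epsilon> / pi * (D * Z) * P \<le> F / 2 ^ Suc n"
    proof -
      have "\<epsilon> / pi * (D * Z) * P = K / \<Lambda> * G" by (simp add: D_def K_def mult_ac)
      also have "\<dots> \<le> 1 / 2 * G"
        using \<Lambda>(1,4) G by (intro mult_right_mono) (auto simp: field_simps)
      finally show ?thesis by (simp add: G_def)
    qed
    ultimately show ?case by (auto elim!: eventually_mono)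
  qed
  have "moment (freq \<xi> \<epsilon> \<Lambda> k) t = 0" for k t
  proof -
    have lim: "(\<lambda>n. 16 * (F / 2 ^ n) / (\<Lambda> * \<epsilon> ^ 3) * (1 / (real (Suc k))\<^sup>2)) \<longlonglongrightarrow> 16 * 0 / (\<Lambda> * \<epsilon> ^ 3) * (1 / (real (Suc k))\<^sup>2)"
      using \<Lambda>(1) \<epsilon>(1) by (intro tendsto_intros LIMSEQ_divide_realpow_zero) auto
    have "norm (moment (freq \<xi> \<epsilon> \<Lambda> k) t) \<le> 16 * (F / 2 ^ n) / (\<Lambda> * \<epsilon> ^ 3) * (1 / (real (Suc k))\<^sup>2)" for n
      by (rule step[OF _ iter]) (use F(1) in simp)
    then have "norm (moment (freq \<xi> \<epsilon> \<Lambda> k) t) \<le> 16 * 0 / (\<Lambda> * \<epsilon> ^ 3) * (1 / (real (Suc k))\<^sup>2)"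
      by (intro LIMSEQ_le_const[OF lim]) blast
    then show ?thesis by simp
  qed
  then show ?thesis using \<epsilon> by blast
qed

text \<open>Moments were treated only for a large first exponent \<Lambda>. Since all their
  frequencies vanish, the whole weighted x_1-marginal vanishes, and pairing it with exp((\<eta>_1 -
  \<Lambda>) x_1) replaces \<Lambda> by the desired exponent.\<close>

lemma exponential_moments_vanish: "(LINT x|lebesgue. u t x * exp (\<eta> \<bullet> x)) = 0"
proof -
  obtain \<epsilon> \<Lambda> where \<epsilon>: "\<epsilon> > 0" "pi / \<epsilon> > r" and zero: "\<And>k. moment (freq (\<lambda>i. \<eta> $ i) \<epsilon> \<Lambda> k) t = 0"
    using weighted_moments_vanish[of "\<lambda>i. \<eta> $ i"] by blast
  let ?W = "\<lambda>x. u t x * weight (\<lambda>i. \<eta> $ i) \<Lambda> x"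
  \<comment> \<open>The indicator makes the exponential bounded; it equals 1 wherever the first
    coordinate of a point of the support can lie.\<close>
  define \<phi> where "\<phi> y = complex_of_real (indicator (cball 0 r) y * exp ((\<eta> $ \<iota> - \<Lambda>) * y))" for y :: real
  have "continuous_on (cball 0 r) (\<lambda>y :: real. complex_of_real (exp ((\<eta> $ \<iota> - \<Lambda>) * y)))"
    by (intro continuous_intros)
  from bounded_borel_restrict[OF compact_cball this] have \<phi>: "\<phi> \<in> bounded_borel"
    by (simp add: \<phi>_def[abs_def] of_real_indicator)
  have "(LINT x|lebesgue. ?W x * \<phi> (x $ \<iota>)) =
     integral\<^sup>L (lebesgue_on {- pi / \<epsilon>..pi / \<epsilon>}) (\<lambda>y. half_series \<epsilon> (\<lambda>k. 0) y * \<phi> y)"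
    by (rule marginal_eq_half_series[OF \<epsilon>(1) _ weighted_integrable[OF u_integrable supp] component_measurable
          weighted_supp[OF \<epsilon>(2)] _ \<phi>]) (use zero moment_freq in auto)
  also have "\<dots> = 0" by (simp add: half_series_def)
  finally have 0: "(LINT x|lebesgue. ?W x * \<phi> (x $ \<iota>)) = 0" .
  have "(LINT x|lebesgue. complex_of_real (u t x * exp (\<eta> \<bullet> x))) = (LINT x|lebesgue. ?W x * \<phi> (x $ \<iota>))"
  proof (rule integral_lebesgue_cong_AE)
    show "AE x in lebesgue. complex_of_real (u t x * exp (\<eta> \<bullet> x)) = ?W x * \<phi> (x $ \<iota>)"
      using supp[of t]
    proof eventually_elim
      case (elim x)
      show ?case
      proof (cases "norm x \<ge> r")
        case False
        then have "\<bar>x $ \<iota>\<bar> \<le> r" using component_le_norm_cart[of x \<iota>] by simp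
        moreover have "\<eta> \<bullet> x = (\<Sum>i\<in>UNIV. (if i = \<iota> then \<Lambda> else \<eta> $ i) * x $ i) + (\<eta> $ \<iota> - \<Lambda>) * x $ \<iota>"
        proof -
          have "\<eta> \<bullet> x = (\<Sum>i\<in>UNIV. (if i = \<iota> then \<Lambda> else \<eta> $ i) * x $ i
              + (if i = \<iota> then (\<eta> $ \<iota> - \<Lambda>) * x $ \<iota> else 0))"
            unfolding inner_vec_def by (intro sum.cong) (auto simp: algebra_simps)
          then show ?thesis unfolding sum.distrib by simp
        qed
        ultimately show ?thesis
          by (simp only: \<phi>_def weight_def exp_add) simp
      qed (use elim in simp)
    qed
  qed
  then have "complex_of_real (LINT x|lebesgue. u t x * exp (\<eta> \<bullet> x)) = 0"
    unfolding 0 by (simp only: integral_complex_of_real)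
  then show ?thesis by (simp only: of_real_eq_0_iff)
qed

end

theorem theorem1p1:
  fixes p :: "real \<Rightarrow> real \<Rightarrow> real"
    and q :: "('n::{finite, linorder} \<Rightarrow> nat) \<Rightarrow> real \<Rightarrow> real"
    and u :: "real \<Rightarrow> real ^ 'n::{finite, linorder} \<Rightarrow> real"
  assumes "p \<in> Linfty_L1loc"
    and "\<And>\<alpha>. mi_order \<alpha> \<le> 2 \<Longrightarrow> q \<alpha> \<in> Linfty"
    and "u \<in> C_L1loc \<inter> Linfty_L1loc"
    and "(\<lambda>t x. p t (x $ Min UNIV) * u t x) \<in> Linfty_L1loc"
    and "weak_solution q p u"
    and "\<exists>r>0. \<forall>t. AE x in lebesgue. norm x \<ge> r \<longrightarrow> u t x = 0"
  shows "\<forall>t. AE x in lebesgue. u t x = 0"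
proof
  fix t
  obtain r where r: "r > 0" "\<And>t. AE x in lebesgue. norm x \<ge> r \<longrightarrow> u t x = 0"
    using assms(6) by blast
  interpret plate_solution p q u r
    by unfold_locales (use assms r in auto)
  show "AE x in lebesgue. u t x = 0"
    by (rule AE_zero_of_exponential_moments[OF u_integrable supp exponential_moments_vanish])
qed

end
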